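(* Fix $T>0$. Let $\varphi\in C^5(\mathbb T^2;\mathbb{R}^2)$ be divergence free with $\int_{\mathbb T^2}\varphi(x)\,dx=0$. Let $u\in C([0,T];C^5(\mathbb T^2;\mathbb{R}^2))$ be the unique solution of the backward 2D Navier–Stokes equation on the torus $$\partial_su+\nu\Delta u+u\cdot\nabla u+\nabla p=0,\qquad\operatorname{div}u=0,\qquad u(T)=\varphi ,$$ where $\nu$ is the viscosity constant and $p$ the pressure. Let $w_0=\operatorname{curl}\varphi$ and for $\varepsilon\in(0,1)$ let $(X^\varepsilon,w_\varepsilon,u_\varepsilon)$ be the solution of the system, $0\le s\le t\le T$, $x\in\mathbb T^2$, $$X^\varepsilon_{s,t}(x)=x+\varepsilon\int_s^tu_\varepsilon(r,X^\varepsilon_{s,r-}(x))\,d\mathcal N^\varepsilon_r+\sqrt{\varepsilon\nu}\,(H^\varepsilon_t-H^\varepsilon_s),$$ $$w_\varepsilon(s,x)=\mathbb{E}\,w_0(X^\varepsilon_{s,T}(x)),\qquad u_\varepsilon=K_2*w_\varepsilon .$$ Then there is a constant $C>0$ such that for all $\varepsilon\in(0,1)$, $$\sup_{s\in[0,T]}\|u_\varepsilon(s)-u(s)\|_\infty\le C\varepsilon .$$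
   Context: $\mathbb T^2=[-\pi,\pi]^2$ is the torus; $\operatorname{curl}u=\partial_1u_2-\partial_2u_1$. $K_2$ is the Biot–Savart kernel on the torus, so that $u=K_2*\operatorname{curl}u$ for mean-zero divergence-free $u$; it has the form $K_2(x)=(-x_2,x_1)/(2\pi|x|^2)+K_0(x)$ with $K_0\in C^\infty([-\pi,\pi]^2)$, and $*$ is convolution (in $x$) on $\mathbb T^2$. $\mathcal N^\varepsilon$ is a Poisson process with intensity $1/\varepsilon$, $(\xi_n)_{n\ge1}$ is an i.i.d. sequence independent of $\mathcal N^\varepsilon$ with values in $\mathbb Z^2$ and $\mathbb P(\xi_n=z)=1/4$ for $|z|=1$ (that is, uniform on $\{\pm e_1,\pm e_2\}$), and $H^\varepsilon_t:=\sum_{1\le n\le\mathcal N^\varepsilon_t}\xi_n$. The system has a unique solution with $w_\varepsilon\in C([0,T];C^1_b(\mathbb T^2))$. $\|\cdot\|_\infty$ is the sup norm on $\mathbb T^2$.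
   Formalization: The noise term is taken as √(4εν)(H_t−H_s) instead of √(εν)(H_t−H_s): with steps of covariance I/2 the printed amplitude yields viscosity ν/4, and the claim fails for φ=(sin x₂,0), ν>0. *)

theory Defs
  imports "HOL-Probability.Probability"
begin

section \<open>Function spaces on the torus\<close>

text \<open>Functions on the torus are \<open>2\<pi>\<close>-periodic functions on the plane; integrals over the
  torus are taken over the cell \<open>[-\<pi>,\<pi>]\<^sup>2\<close>.\<close>

definition torus_cell :: "(real^2) set" where
  "torus_cell = cbox (vec (-pi)) (vec pi)"

definition torus_periodic :: "(real^2 \<Rightarrow> 'b) \<Rightarrow> bool" where
  "torus_periodic f \<longleftrightarrow> (\<forall>x i. f (x + (2*pi) *\<^sub>R axis i 1) = f x)"

definition has_partials :: "(real^2 \<Rightarrow> 'b::real_normed_vector) \<Rightarrow> bool" where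
  "has_partials f \<longleftrightarrow> (\<forall>i x. (\<lambda>h::real. f (x + h *\<^sub>R axis i 1)) differentiable (at 0))"

definition partial :: "2 \<Rightarrow> (real^2 \<Rightarrow> 'b::real_normed_vector) \<Rightarrow> real^2 \<Rightarrow> 'b" where
  "partial i f x = vector_derivative (\<lambda>h::real. f (x + h *\<^sub>R axis i 1)) (at 0)"

text \<open>A list of directions encodes an iterated partial derivative, its length being the order.\<close>

abbreviation partials :: "2 list \<Rightarrow> (real^2 \<Rightarrow> 'b::real_normed_vector) \<Rightarrow> real^2 \<Rightarrow> 'b" where
  "partials ds f \<equiv> foldr partial ds f"

definition Ck :: "nat \<Rightarrow> (real^2 \<Rightarrow> 'b::real_normed_vector) \<Rightarrow> bool" where
  "Ck k f \<longleftrightarrow> (\<forall>ds. length ds < k \<longrightarrow> has_partials (partials ds f)) \<and>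
             (\<forall>ds. length ds \<le> k \<longrightarrow> continuous_on UNIV (partials ds f))"

definition Ck_torus :: "nat \<Rightarrow> (real^2 \<Rightarrow> 'b::real_normed_vector) \<Rightarrow> bool" where
  "Ck_torus k f \<longleftrightarrow> torus_periodic f \<and> Ck k f"

text \<open>The space \<open>C([0,T]; C\<^sup>k)\<close>: continuity in time for the \<open>C\<^sup>k\<close> norm.\<close>

definition C_time_Ck_torus ::
    "real \<Rightarrow> nat \<Rightarrow> (real \<Rightarrow> real^2 \<Rightarrow> 'b::real_normed_vector) \<Rightarrow> bool" where
  "C_time_Ck_torus T k f \<longleftrightarrow>
     (\<forall>s\<in>{0..T}. Ck_torus k (f s)) \<and>
     (\<forall>ds. length ds \<le> k \<longrightarrow> (\<forall>s\<in>{0..T}.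
        uniform_limit UNIV (\<lambda>r. partials ds (f r)) (partials ds (f s)) (at s within {0..T})))"

text \<open>The value is an extended real, so that the supremum is meaningful for unbounded functions too.\<close>

definition sup_norm :: "(real^2 \<Rightarrow> 'b::real_normed_vector) \<Rightarrow> ereal" where
  "sup_norm f = (SUP x. ereal (norm (f x)))"


section \<open>Vector calculus and the backward Navier--Stokes equation\<close>

definition divergence :: "(real^2 \<Rightarrow> real^2) \<Rightarrow> real^2 \<Rightarrow> real" where
  "divergence v x = (\<Sum>i\<in>UNIV. partial i v x $ i)"

definition curl :: "(real^2 \<Rightarrow> real^2) \<Rightarrow> real^2 \<Rightarrow> real" where
  "curl v x = partial 1 v x $ 2 - partial 2 v x $ 1"

definition gradient :: "(real^2 \<Rightarrow> real) \<Rightarrow> real^2 \<Rightarrow> real^2" where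
  "gradient q x = (\<chi> i. partial i q x)"

definition laplacian :: "(real^2 \<Rightarrow> 'b::real_normed_vector) \<Rightarrow> real^2 \<Rightarrow> 'b" where
  "laplacian f x = (\<Sum>i\<in>UNIV. partial i (partial i f) x)"

definition advection :: "(real^2 \<Rightarrow> real^2) \<Rightarrow> (real^2 \<Rightarrow> 'b::real_normed_vector) \<Rightarrow> real^2 \<Rightarrow> 'b" where
  "advection v f x = (\<Sum>i\<in>UNIV. (v x $ i) *\<^sub>R partial i f x)"

text \<open>Classical solutions. The pressure is a function on the torus, i.e. periodic; without this the
  equation would not determine the velocity.\<close>

definition backward_navier_stokes ::
    "real \<Rightarrow> real \<Rightarrow> (real^2 \<Rightarrow> real^2) \<Rightarrow> (real \<Rightarrow> real^2 \<Rightarrow> real^2) \<Rightarrow> bool" where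
  "backward_navier_stokes \<nu> T \<phi> u \<longleftrightarrow>
     C_time_Ck_torus T 5 u \<and>
     (\<forall>s\<in>{0..T}. \<forall>x. divergence (u s) x = 0) \<and>
     u T = \<phi> \<and>
     (\<exists>(p :: real \<Rightarrow> real^2 \<Rightarrow> real) (u' :: real \<Rightarrow> real^2 \<Rightarrow> real^2). C_time_Ck_torus T 1 p \<and>
        (\<forall>s\<in>{0..T}. \<forall>x.
           ((\<lambda>r. u r x) has_vector_derivative u' s x) (at s within {0..T}) \<and>
           u' s x + \<nu> *\<^sub>R laplacian (u s) x + advection (u s) (u s) x + gradient (p s) x = 0))"


section \<open>The Biot--Savart kernel\<close>

definition torus_conv :: "(real^2 \<Rightarrow> real^2) \<Rightarrow> (real^2 \<Rightarrow> real) \<Rightarrow> real^2 \<Rightarrow> real^2" where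
  "torus_conv K w x = (LINT y:torus_cell|lborel. w y *\<^sub>R K (x - y))"

text \<open>The conditions determine the kernel up to an additive constant vector, since the curl of a
  periodic field has mean zero, and up to its (irrelevant) values at the lattice points.
  Smoothness of the regular part on the closed cell is smoothness of some extension to the plane.\<close>

definition biot_savart_kernel :: "(real^2 \<Rightarrow> real^2) \<Rightarrow> bool" where
  "biot_savart_kernel K \<longleftrightarrow>
     torus_periodic K \<and>
     (\<exists>K0 :: real^2 \<Rightarrow> real^2. (\<forall>k. Ck k K0) \<and>
        (\<forall>x\<in>torus_cell - {0}.
           K x = (1 / (2 * pi * (norm x)\<^sup>2)) *\<^sub>R vector [- (x $ 2), x $ 1] + K0 x)) \<and>
     (\<forall>v :: real^2 \<Rightarrow> real^2.
        Ck_torus 1 v \<and> (\<forall>x. divergence v x = 0) \<and> (LINT x:torus_cell|lborel. v x) = 0 \<longrightarrow>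
        (\<forall>x. v x = torus_conv K (curl v) x))"


section \<open>The driving noise\<close>

definition poisson_process :: "'w measure \<Rightarrow> real \<Rightarrow> (real \<Rightarrow> 'w \<Rightarrow> nat) \<Rightarrow> bool" where
  "poisson_process M rate N \<longleftrightarrow>
     (\<forall>t\<ge>0. N t \<in> measurable M (count_space UNIV)) \<and>
     (AE \<omega> in M. N 0 \<omega> = 0 \<and> mono_on {0..} (\<lambda>t. N t \<omega>) \<and>
        (\<forall>t\<ge>0. continuous (at_right t) (\<lambda>r. real (N r \<omega>)))) \<and>
     (\<forall>s t. 0 \<le> s \<and> s < t \<longrightarrow>
        distr M (count_space UNIV) (\<lambda>\<omega>. N t \<omega> - N s \<omega>) = measure_pmf (poisson_pmf (rate * (t - s)))) \<and>
     (\<forall>ts. sorted_wrt (<) ts \<and> (\<forall>t\<in>set ts. 0 \<le> t) \<longrightarrow>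
        prob_space.indep_vars M (\<lambda>_. count_space UNIV)
          (\<lambda>i \<omega>. N (ts ! Suc i) \<omega> - N (ts ! i) \<omega>) {i. Suc i < length ts})"

definition random_walk_steps :: "'w measure \<Rightarrow> (nat \<Rightarrow> 'w \<Rightarrow> real^2) \<Rightarrow> bool" where
  "random_walk_steps M \<xi> \<longleftrightarrow>
     prob_space.indep_vars M (\<lambda>_. borel) \<xi> {1..} \<and>
     (\<forall>n\<ge>1. \<forall>\<omega>\<in>space M. \<forall>i. \<xi> n \<omega> $ i \<in> \<int>) \<and>
     (\<forall>n\<ge>1. \<forall>z. (\<forall>i. z $ i \<in> \<int>) \<and> norm z = 1 \<longrightarrow>
        measure M {\<omega>\<in>space M. \<xi> n \<omega> = z} = 1/4)"

definition steps_indep_of_process ::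
    "'w measure \<Rightarrow> (nat \<Rightarrow> 'w \<Rightarrow> real^2) \<Rightarrow> (real \<Rightarrow> 'w \<Rightarrow> nat) \<Rightarrow> bool" where
  "steps_indep_of_process M \<xi> N \<longleftrightarrow>
     prob_space.indep_set M
       (sets (vimage_algebra (space M) (\<lambda>\<omega>. \<lambda>n\<in>{1..}. \<xi> n \<omega>) (\<Pi>\<^sub>M n\<in>{1..}. borel)))
       (sets (vimage_algebra (space M) (\<lambda>\<omega>. \<lambda>t\<in>{0..}. N t \<omega>) (\<Pi>\<^sub>M t\<in>{0..}. count_space UNIV)))"

definition compound_walk ::
    "(nat \<Rightarrow> 'w \<Rightarrow> real^2) \<Rightarrow> (real \<Rightarrow> 'w \<Rightarrow> nat) \<Rightarrow> real \<Rightarrow> 'w \<Rightarrow> real^2" where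
  "compound_walk \<xi> N t \<omega> = (\<Sum>n\<in>{1..N t \<omega>}. \<xi> n \<omega>)"


section \<open>The particle system\<close>

definition cadlag_on :: "real \<Rightarrow> real \<Rightarrow> (real \<Rightarrow> 'b::topological_space) \<Rightarrow> bool" where
  "cadlag_on a b f \<longleftrightarrow>
     (\<forall>t\<in>{a..<b}. (f \<longlongrightarrow> f t) (at_right t)) \<and> (\<forall>t\<in>{a<..b}. \<exists>l. (f \<longlongrightarrow> l) (at_left t))"

text \<open>The Lebesgue--Stieltjes integral of \<open>f\<close> over \<open>(s,t]\<close> with respect to a counting path \<open>n\<close>;
  the path is extended by its initial value to negative times.\<close>

definition path_integral :: "(real \<Rightarrow> nat) \<Rightarrow> real \<Rightarrow> real \<Rightarrow> (real \<Rightarrow> real^2) \<Rightarrow> real^2" where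
  "path_integral n s t f = (LINT r:{s<..t}|interval_measure (\<lambda>r. real (n (max 0 r))). f r)"

text \<open>The noise amplitude is \<open>sqrt (\<epsilon> * \<kappa>)\<close>. As the steps have covariance \<open>I/2\<close> and the clock has
  rate \<open>1/\<epsilon>\<close>, the generator of the noise converges to \<open>(\<kappa>/4)\<Delta>\<close>; hence viscosity \<open>\<nu>\<close> corresponds
  to \<open>\<kappa> = 4 * \<nu>\<close>.\<close>

definition particle_system ::
    "real \<Rightarrow> real \<Rightarrow> (real^2 \<Rightarrow> real^2) \<Rightarrow> (real^2 \<Rightarrow> real) \<Rightarrow> 'w measure \<Rightarrow>
     (real \<Rightarrow> 'w \<Rightarrow> nat) \<Rightarrow> (nat \<Rightarrow> 'w \<Rightarrow> real^2) \<Rightarrow> real \<Rightarrow>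
     (real \<Rightarrow> real \<Rightarrow> real^2 \<Rightarrow> 'w \<Rightarrow> real^2) \<Rightarrow> (real \<Rightarrow> real^2 \<Rightarrow> real) \<Rightarrow>
     (real \<Rightarrow> real^2 \<Rightarrow> real^2) \<Rightarrow> bool" where
  "particle_system \<kappa> T K w0 M N \<xi> \<epsilon> X w u \<longleftrightarrow>
     (\<forall>s t x. 0 \<le> s \<and> s \<le> t \<and> t \<le> T \<longrightarrow> X s t x \<in> borel_measurable M) \<and>
     (\<forall>s\<in>{0..T}. \<forall>x. AE \<omega> in M.
        cadlag_on s T (\<lambda>t. X s t x \<omega>) \<and>
        (\<forall>t\<in>{s..T}.
           X s t x \<omega> =
             x + \<epsilon> *\<^sub>R path_integral (\<lambda>r. N r \<omega>) s t (\<lambda>r. u r (Lim (at_left r) (\<lambda>q. X s q x \<omega>)))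
               + sqrt (\<epsilon> * \<kappa>) *\<^sub>R (compound_walk \<xi> N t \<omega> - compound_walk \<xi> N s \<omega>))) \<and>
     C_time_Ck_torus T 1 w \<and>
     (\<forall>s\<in>{0..T}. \<forall>x. w s x = prob_space.expectation M (\<lambda>\<omega>. w0 (X s T x \<omega>))) \<and>
     (\<forall>s\<in>{0..T}. \<forall>x. u s x = torus_conv K (w s) x)"

end

theory Submission
  imports Defs
begin

text \<open>
The error is controlled at the level of vorticities. Let \<open>w = curl u\<close>. Taking the curl of the backward
Navier--Stokes equation removes the pressure and gives the transport equation
\<open>\<partial>\<^sub>s w + \<nu> \<Delta> w + u \<cdot> \<nabla> w = 0\<close> with terminal value \<open>curl \<phi>\<close>
(\<open>vorticity_equation\<close>), and the Biot--Savart kernel recovers \<open>u\<close> from \<open>w\<close>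
(\<open>biot_savart_law\<close>), because the mean of \<open>u\<close> is conserved. As the kernel is integrable over the cell,
the velocity error is at most a constant times the uniform vorticity error (\<open>velocity_error\<close>).

For the particle system, \<open>w\<^sub>\<epsilon>(s,x)\<close> is the mean of \<open>w(T,\<cdot>)\<close> at the end point of the path from
\<open>(s,x)\<close>. That path is approximated by an Euler scheme on a grid of \<open>m\<close> cells which freezes the velocity at
the left end point of each cell. A counting path has finitely many jumps, so on a fine grid every cell holds at
most one jump time, and since \<open>u\<^sub>\<epsilon>\<close> is Lipschitz in space and uniformly continuous in time the scheme
converges along almost every path (\<open>euler_converges\<close>). Along the grid the scheme is a Markov chain driven by
independent Poisson increments and fresh marks; in a cell of length \<open>\<delta>\<close> it jumps once with probability
\<open>\<delta>/\<epsilon> + O(\<delta>\<^sup>2)\<close> and more than once with probability \<open>O(\<delta>\<^sup>2)\<close>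
(\<open>one_step\<close>).

Telescoping \<open>w(t\<^sub>j, Y\<^sub>j)\<close> along the chain \<open>Y\<close> leaves, in each cell, \<open>\<delta>\<close> times the
difference between the generator of the jump process and \<open>u \<cdot> \<nabla> + \<nu> \<Delta>\<close>. The four steps are
symmetric, hence odd Taylor terms in the noise cancel, and four derivatives of \<open>w\<close> bound this difference by
\<open>(u\<^sub>\<epsilon> - u) \<cdot> \<nabla> w + O(\<epsilon>)\<close> (\<open>generator_estimate\<close>,
\<open>local_error\<close>); here viscosity \<open>\<nu>\<close> fits noise amplitude \<open>sqrt (4 \<epsilon> \<nu>)\<close>, the steps having
covariance one half of the identity. The first term is again bounded by the vorticity error, and a Gronwall
argument with the weight \<open>exp (\<beta> (T - s))\<close> closes the estimate: for large \<open>\<beta>\<close> every bound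
\<open>E\<close> on the weighted error improves to \<open>E/2 + O(\<epsilon>)\<close> (\<open>vorticity_error\<close>).
\<close>

section \<open>Partial derivatives along the axes\<close>


text \<open>Existence and value of an axis derivative at all points in one relation, so that the rules for sums and products
compose without separate differentiability conditions.\<close>

definition has_partial :: "2 \<Rightarrow> (real^2 \<Rightarrow> 'b::real_normed_vector) \<Rightarrow> (real^2 \<Rightarrow> 'b) \<Rightarrow> bool" where
  "has_partial i f f' \<longleftrightarrow> (\<forall>x. ((\<lambda>h. f (x + h *\<^sub>R axis i 1)) has_vector_derivative f' x) (at 0))"

lemma has_partial_imp_partial: "has_partial i f f' \<Longrightarrow> partial i f = f'"
  by (auto simp: has_partial_def partial_def fun_eq_iff vector_derivative_at)

lemma has_partials_iff: "has_partials f \<longleftrightarrow> (\<forall>i. has_partial i f (partial i f))"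
  unfolding has_partials_def has_partial_def partial_def
  by (auto simp: vector_derivative_works differentiableI_vector)

lemma has_partial_at:
  assumes "has_partial i f f'"
  shows "((\<lambda>h. f (x + h *\<^sub>R axis i 1)) has_vector_derivative f' (x + t *\<^sub>R axis i 1)) (at t)"
proof -
  have "((\<lambda>h. f (x + t *\<^sub>R axis i 1 + h *\<^sub>R axis i 1)) has_vector_derivative f' (x + t *\<^sub>R axis i 1)) (at (t - t))"
    using assms by (simp add: has_partial_def)
  then have "((\<lambda>h. f (x + t *\<^sub>R axis i 1 + h *\<^sub>R axis i 1)) \<circ> (\<lambda>h. h - t)
      has_vector_derivative 1 *\<^sub>R f' (x + t *\<^sub>R axis i 1)) (at t)"
    by (intro vector_diff_chain_at) (auto intro!: derivative_eq_intros)
  moreover have "(\<lambda>h. f (x + t *\<^sub>R axis i 1 + h *\<^sub>R axis i 1)) \<circ> (\<lambda>h. h - t) = (\<lambda>h. f (x + h *\<^sub>R axis i 1))"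
    by (auto simp: fun_eq_iff algebra_simps)
  ultimately show ?thesis by simp
qed

lemma has_partial_real_at:
  fixes f :: "real^2 \<Rightarrow> real"
  assumes "has_partial i f f'"
  shows "((\<lambda>h. f (x + h *\<^sub>R axis i 1)) has_real_derivative f' (x + t *\<^sub>R axis i 1)) (at t)"
  using has_partial_at[OF assms] by (simp add: has_real_derivative_iff_has_vector_derivative)

lemma has_partial_add: "has_partial i f f' \<Longrightarrow> has_partial i g g' \<Longrightarrow> has_partial i (\<lambda>x. f x + g x) (\<lambda>x. f' x + g' x)"
  unfolding has_partial_def by (auto intro!: derivative_eq_intros)

lemma has_partial_diff: "has_partial i f f' \<Longrightarrow> has_partial i g g' \<Longrightarrow> has_partial i (\<lambda>x. f x - g x) (\<lambda>x. f' x - g' x)"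
  unfolding has_partial_def by (auto intro!: derivative_eq_intros)

lemma has_partial_minus: "has_partial i f f' \<Longrightarrow> has_partial i (\<lambda>x. - f x) (\<lambda>x. - f' x)"
  unfolding has_partial_def by (auto intro!: derivative_eq_intros)

lemma has_partial_mult:
  fixes f g :: "real^2 \<Rightarrow> real"
  assumes "has_partial i f f'" "has_partial i g g'"
  shows "has_partial i (\<lambda>x. f x * g x) (\<lambda>x. f' x * g x + f x * g' x)"
  unfolding has_partial_def
proof
  fix x
  show "((\<lambda>h. f (x + h *\<^sub>R axis i 1) * g (x + h *\<^sub>R axis i 1)) has_vector_derivative f' x * g x + f x * g' x) (at 0)"
    using has_vector_derivative_mult[OF assms(1)[unfolded has_partial_def, rule_format, of x]
        assms(2)[unfolded has_partial_def, rule_format, of x]] by (simp add: add.commute)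
qed

lemma has_partial_cmult: 
  fixes f :: "real^2 \<Rightarrow> real"
  shows "has_partial i f f' \<Longrightarrow> has_partial i (\<lambda>x. c * f x) (\<lambda>x. c * f' x)"
  unfolding has_partial_def by (auto intro!: derivative_eq_intros simp: has_vector_derivative_mult_right)

lemma has_partial_nth:
  fixes f :: "real^2 \<Rightarrow> real^2"
  shows "has_partial i f f' \<Longrightarrow> has_partial i (\<lambda>x. f x $ j) (\<lambda>x. f' x $ j)"
  unfolding has_partial_def
  by (auto intro: bounded_linear.has_vector_derivative[OF bounded_linear_vec_nth])

lemma axis_mean_value:
  fixes f :: "real^2 \<Rightarrow> real"
  assumes "has_partial i f f'"
  shows "\<exists>t. \<bar>t\<bar> \<le> \<bar>h\<bar> \<and> f (x + h *\<^sub>R axis i 1) - f x = h * f' (x + t *\<^sub>R axis i 1)"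
proof -
  have "\<exists>t. \<bar>t\<bar> \<le> \<bar>h\<bar> \<and> f (x + h *\<^sub>R axis i 1) = 
    (\<Sum>m<1. (if m = 0 then (\<lambda>h. f (x + h *\<^sub>R axis i 1)) else (\<lambda>h. f' (x + h *\<^sub>R axis i 1))) 0 / fact m * h ^ m)
    + (if (1::nat) = 0 then (\<lambda>h. f (x + h *\<^sub>R axis i 1)) else (\<lambda>h. f' (x + h *\<^sub>R axis i 1))) t / fact 1 * h ^ 1"
    by (rule Maclaurin_bi_le) (auto intro: has_partial_real_at[OF assms])
  then show ?thesis by (auto simp: mult.commute)
qed

lemma axis_lipschitz:
  fixes f :: "real^2 \<Rightarrow> real"
  assumes "has_partial i f f'" "\<And>y. \<bar>f' y\<bar> \<le> B"
  shows "\<bar>f (x + h *\<^sub>R axis i 1) - f x\<bar> \<le> B * \<bar>h\<bar>"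
proof -
  obtain t where "f (x + h *\<^sub>R axis i 1) - f x = h * f' (x + t *\<^sub>R axis i 1)"
    using axis_mean_value[OF assms(1)] by blast
  then show ?thesis using mult_left_mono[OF assms(2)[of "x + t *\<^sub>R axis i 1"], of "\<bar>h\<bar>"]
    by (simp add: abs_mult mult.commute)
qed

lemma axis_taylor1:
  fixes f :: "real^2 \<Rightarrow> real"
  assumes f: "has_partial i f f'" and f': "has_partial i f' f''" and B: "\<And>y. \<bar>f'' y\<bar> \<le> B"
  shows "\<bar>f (x + h *\<^sub>R axis i 1) - f x - h * f' x\<bar> \<le> B * h\<^sup>2"
proof -
  obtain t where t: "\<bar>t\<bar> \<le> \<bar>h\<bar>" "f (x + h *\<^sub>R axis i 1) - f x = h * f' (x + t *\<^sub>R axis i 1)"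
    using axis_mean_value[OF f] by blast
  have B0: "B \<ge> 0" using B[of x] by linarith
  have "\<bar>f (x + h *\<^sub>R axis i 1) - f x - h * f' x\<bar> = \<bar>h\<bar> * \<bar>f' (x + t *\<^sub>R axis i 1) - f' x\<bar>"
    by (simp add: t(2) right_diff_distrib[symmetric] abs_mult del: right_diff_distrib)
  also have "\<dots> \<le> \<bar>h\<bar> * (B * \<bar>t\<bar>)"
    by (intro mult_left_mono axis_lipschitz[OF f' B]) auto
  also have "\<dots> \<le> \<bar>h\<bar> * (B * \<bar>h\<bar>)"
    by (intro mult_left_mono t B0) auto
  finally show ?thesis by (simp add: power2_eq_square abs_mult[symmetric] mult.assoc mult.left_commute)
qed

text \<open>The cubic and linear terms cancel in the symmetric combination, so the remainder is of fourth order. This is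
where the symmetry of the random steps pays off.\<close>

lemma axis_taylor_sym:
  fixes f0 f1 f2 f3 f4 :: "real^2 \<Rightarrow> real"
  assumes f: "has_partial i f0 f1" "has_partial i f1 f2" "has_partial i f2 f3" "has_partial i f3 f4"
    and B: "\<And>y. \<bar>f4 y\<bar> \<le> B"
  shows "\<bar>f0 (x + h *\<^sub>R axis i 1) + f0 (x - h *\<^sub>R axis i 1) - 2 * f0 x - h\<^sup>2 * f2 x\<bar> \<le> B * h^4"
proof -
  define F where "F m = (if m = 0 then f0 else if m = 1 then f1 else if m = 2 then f2 else if m = 3 then f3 else f4)" for m :: nat
  define d where "d m h = F m (x + h *\<^sub>R axis i 1)" for m h
  have D: "m < 4 \<Longrightarrow> DERIV (d m) t :> d (Suc m) t" for m t
    unfolding d_def using f[THEN has_partial_real_at, of x t] by (auto simp: F_def less_Suc_eq numeral_eq_Suc)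
  have T: "\<bar>f0 (x + h *\<^sub>R axis i 1) - (f0 x + f1 x * h + f2 x / 2 * h\<^sup>2 + f3 x / 6 * h^3)\<bar> \<le> B / 2 * h^4" for h
  proof -
    have "\<exists>t. \<bar>t\<bar> \<le> \<bar>h\<bar> \<and> d 0 h = (\<Sum>m<4. d m 0 / (fact m) * h ^ m) + d 4 t / (fact 4) * h ^ 4"
      by (rule Maclaurin_bi_le) (use D in auto)
    then obtain t where t: "d 0 h = (\<Sum>m<4. d m 0 / (fact m) * h ^ m) + d 4 t / (fact 4) * h ^ 4" by blast
    then have "f0 (x + h *\<^sub>R axis i 1) - (f0 x + f1 x * h + f2 x / 2 * h\<^sup>2 + f3 x / 6 * h^3) = f4 (x + t *\<^sub>R axis i 1) / 24 * h^4"
      by (simp add: d_def F_def lessThan_nat_numeral fact_numeral algebra_simps)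
    moreover have "\<bar>f4 (x + t *\<^sub>R axis i 1) / 24 * h^4\<bar> \<le> B / 2 * h^4"
      using B[of "x + t *\<^sub>R axis i 1"] unfolding abs_mult by (intro mult_mono) auto
    ultimately show ?thesis by (simp only:)
  qed
  have "f0 (x + h *\<^sub>R axis i 1) + f0 (x - h *\<^sub>R axis i 1) - 2 * f0 x - h\<^sup>2 * f2 x =
      (f0 (x + h *\<^sub>R axis i 1) - (f0 x + f1 x * h + f2 x / 2 * h\<^sup>2 + f3 x / 6 * h^3)) +
      (f0 (x + (- h) *\<^sub>R axis i 1) - (f0 x + f1 x * (- h) + f2 x / 2 * (- h)\<^sup>2 + f3 x / 6 * (- h)^3))"
    by (simp add: algebra_simps)
  moreover have "B / 2 * (- h)^4 = B / 2 * h^4" by simp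
  ultimately show ?thesis using T[of h] T[of "-h"] by linarith
qed

lemma continuous_axis2_tendsto:
  fixes f :: "real^2 \<Rightarrow> real"
  assumes "continuous_on UNIV f" "\<And>n. \<bar>a n\<bar> \<le> 1 / real (Suc n)" "\<And>n. \<bar>b n\<bar> \<le> 1 / real (Suc n)"
  shows "(\<lambda>n. f (x + a n *\<^sub>R axis i 1 + b n *\<^sub>R axis j 1)) \<longlonglongrightarrow> f x"
proof -
  have a: "c \<longlonglongrightarrow> 0" if "\<And>n. \<bar>c n\<bar> \<le> 1 / real (Suc n)" for c :: "nat \<Rightarrow> real"
    by (rule Lim_null_comparison[OF _ LIMSEQ_inverse_real_of_nat]) (use that in \<open>auto simp: inverse_eq_divide\<close>)
  have "(\<lambda>n. x + a n *\<^sub>R axis i 1 + b n *\<^sub>R axis j 1) \<longlonglongrightarrow> x + 0 *\<^sub>R axis i 1 + 0 *\<^sub>R axis j 1"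
    using assms by (intro tendsto_intros a)
  moreover have "isCont f x" using assms(1) by (simp add: continuous_on_eq_continuous_at)
  ultimately show ?thesis by (auto intro: isCont_tendsto_compose)
qed

text \<open>Two applications of the mean value theorem to the second difference over a square.\<close>

lemma mixed_difference_mean_value:
  fixes f :: "real^2 \<Rightarrow> real"
  assumes "has_partial i f fi" "has_partial j fi fij"
  shows "\<exists>s t. \<bar>s\<bar> \<le> \<bar>h\<bar> \<and> \<bar>t\<bar> \<le> \<bar>h\<bar> \<and>
    f (x + h *\<^sub>R axis i 1 + h *\<^sub>R axis j 1) - f (x + h *\<^sub>R axis i 1) - f (x + h *\<^sub>R axis j 1) + f x
      = h * h * fij (x + s *\<^sub>R axis i 1 + t *\<^sub>R axis j 1)"
proof -
  define g where "g y = f (y + h *\<^sub>R axis j 1) - f y" for y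
  have "has_partial i g (\<lambda>y. fi (y + h *\<^sub>R axis j 1) - fi y)"
    unfolding has_partial_def g_def
  proof (intro allI has_vector_derivative_diff)
    fix y
    show "((\<lambda>ha. f (y + ha *\<^sub>R axis i 1 + h *\<^sub>R axis j 1)) has_vector_derivative fi (y + h *\<^sub>R axis j 1)) (at 0)"
      using has_partial_at[OF assms(1), of "y + h *\<^sub>R axis j 1" 0] by (simp add: algebra_simps)
    show "((\<lambda>ha. f (y + ha *\<^sub>R axis i 1)) has_vector_derivative fi y) (at 0)"
      using has_partial_at[OF assms(1), of y 0] by simp
  qed
  from axis_mean_value[OF this, of h x] obtain s where s: "\<bar>s\<bar> \<le> \<bar>h\<bar>" "g (x + h *\<^sub>R axis i 1) - g x
     = h * (fi (x + s *\<^sub>R axis i 1 + h *\<^sub>R axis j 1) - fi (x + s *\<^sub>R axis i 1))" by blast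
  obtain t where "\<bar>t\<bar> \<le> \<bar>h\<bar>" "fi (x + s *\<^sub>R axis i 1 + h *\<^sub>R axis j 1) - fi (x + s *\<^sub>R axis i 1) = h * fij (x + s *\<^sub>R axis i 1 + t *\<^sub>R axis j 1)"
    using axis_mean_value[OF assms(2)] by blast
  with s show ?thesis by (intro exI[of _ s] exI[of _ t]) (auto simp: g_def)
qed

text \<open>The theorem of Schwarz: both mixed derivatives are limits of the same second difference quotients
over shrinking squares.\<close>

lemma mixed_partials_commute:
  fixes f :: "real^2 \<Rightarrow> real"
  assumes "has_partial i f fi" "has_partial j fi fij" "has_partial j f fj" "has_partial i fj fji"
    and c: "continuous_on UNIV fij" "continuous_on UNIV fji"
  shows "fij = fji"
proof
  fix x
  define h where "h n = 1 / real (Suc n)" for n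
  have h0: "h n > 0" for n by (simp add: h_def)
  have "\<forall>n. \<exists>s t. \<bar>s\<bar> \<le> h n \<and> \<bar>t\<bar> \<le> h n \<and>
    f (x + h n *\<^sub>R axis i 1 + h n *\<^sub>R axis j 1) - f (x + h n *\<^sub>R axis i 1) - f (x + h n *\<^sub>R axis j 1) + f x
      = h n * h n * fij (x + s *\<^sub>R axis i 1 + t *\<^sub>R axis j 1)"
    using mixed_difference_mean_value[OF assms(1,2), of "h _" x] h0 by (simp add: abs_of_pos)
  then obtain s t where st: "\<And>n. \<bar>s n\<bar> \<le> h n" "\<And>n. \<bar>t n\<bar> \<le> h n" 
    "\<And>n. f (x + h n *\<^sub>R axis i 1 + h n *\<^sub>R axis j 1) - f (x + h n *\<^sub>R axis i 1) - f (x + h n *\<^sub>R axis j 1) + f x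
      = h n * h n * fij (x + s n *\<^sub>R axis i 1 + t n *\<^sub>R axis j 1)" by metis
  have "\<forall>n. \<exists>s t. \<bar>s\<bar> \<le> h n \<and> \<bar>t\<bar> \<le> h n \<and>
    f (x + h n *\<^sub>R axis j 1 + h n *\<^sub>R axis i 1) - f (x + h n *\<^sub>R axis j 1) - f (x + h n *\<^sub>R axis i 1) + f x
      = h n * h n * fji (x + s *\<^sub>R axis j 1 + t *\<^sub>R axis i 1)"
    using mixed_difference_mean_value[OF assms(3,4), of "h _" x] h0 by (simp add: abs_of_pos)
  then obtain s' t' where st': "\<And>n. \<bar>s' n\<bar> \<le> h n" "\<And>n. \<bar>t' n\<bar> \<le> h n" 
    "\<And>n. f (x + h n *\<^sub>R axis j 1 + h n *\<^sub>R axis i 1) - f (x + h n *\<^sub>R axis j 1) - f (x + h n *\<^sub>R axis i 1) + f x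
      = h n * h n * fji (x + s' n *\<^sub>R axis j 1 + t' n *\<^sub>R axis i 1)" by metis
  have "fij (x + s n *\<^sub>R axis i 1 + t n *\<^sub>R axis j 1) = fji (x + s' n *\<^sub>R axis j 1 + t' n *\<^sub>R axis i 1)" for n
  proof -
    have "x + h n *\<^sub>R axis j 1 + h n *\<^sub>R axis i 1 = x + h n *\<^sub>R axis i 1 + h n *\<^sub>R axis j 1" by (simp add: add_ac)
    then have "h n * h n * fij (x + s n *\<^sub>R axis i 1 + t n *\<^sub>R axis j 1) = h n * h n * fji (x + s' n *\<^sub>R axis j 1 + t' n *\<^sub>R axis i 1)"
      using st(3)[of n] st'(3)[of n] by (simp only:)
    then show ?thesis using h0[of n] by simp
  qed
  moreover have "(\<lambda>n. fij (x + s n *\<^sub>R axis i 1 + t n *\<^sub>R axis j 1)) \<longlonglongrightarrow> fij x"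
    using continuous_axis2_tendsto[OF c(1)] st(1,2) unfolding h_def by blast
  moreover have "(\<lambda>n. fji (x + s' n *\<^sub>R axis j 1 + t' n *\<^sub>R axis i 1)) \<longlonglongrightarrow> fji x"
    using continuous_axis2_tendsto[OF c(2)] st'(1,2) unfolding h_def by blast
  ultimately show "fij x = fji x" by (simp add: LIMSEQ_unique)
qed

section \<open>Iterated partial derivatives\<close>

lemma Ck_has_partial: "Ck k f \<Longrightarrow> length ds < k \<Longrightarrow> has_partial i (partials ds f) (partials (i # ds) f)"
  by (simp add: Ck_def has_partials_iff)

lemma Ck_continuous: "Ck k f \<Longrightarrow> length ds \<le> k \<Longrightarrow> continuous_on UNIV (partials ds f)"
  by (simp add: Ck_def)

lemma CkI:
  assumes "\<And>ds i. length ds < k \<Longrightarrow> has_partial i (partials ds f) (partials (i # ds) f)"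
    and "\<And>ds. length ds \<le> k \<Longrightarrow> continuous_on UNIV (partials ds f)"
  shows "Ck k f"
  using assms by (simp add: Ck_def has_partials_iff)

text \<open>Order matters in the induction: differentiability is available only below the order \<open>k\<close>, so each new
derivative is taken of a list that is already known to commute with the projection.\<close>

lemma partials_nth:
  fixes f :: "real^2 \<Rightarrow> real^2"
  assumes "Ck k f" "length ds \<le> k"
  shows "partials ds (\<lambda>x. f x $ j) = (\<lambda>x. partials ds f x $ j)"
  using assms(2)
proof (induction ds)
  case (Cons i ds)
  then show ?case
    using has_partial_imp_partial[OF has_partial_nth[OF Ck_has_partial[OF assms(1), of ds i]]] by simp
qed simp

lemma Ck_nth:
  fixes f :: "real^2 \<Rightarrow> real^2"
  assumes "Ck k f" shows "Ck k (\<lambda>x. f x $ j)"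
proof (rule CkI)
  fix ds :: "2 list" and i assume l: "length ds < k"
  then show "has_partial i (partials ds (\<lambda>x. f x $ j)) (partials (i # ds) (\<lambda>x. f x $ j))"
    unfolding partials_nth[OF assms less_imp_le[OF l]] 
      partials_nth[OF assms, of "i # ds", unfolded length_Cons, OF Suc_leI[OF l]]
    by (intro has_partial_nth Ck_has_partial[OF assms])
next
  fix ds :: "2 list" assume l: "length ds \<le> k"
  then show "continuous_on UNIV (partials ds (\<lambda>x. f x $ j))"
    unfolding partials_nth[OF assms l] by (intro continuous_intros Ck_continuous[OF assms])
qed

lemma partials_partial: "partials ds (partial i f) = partials (ds @ [i]) f"
  by simp

lemma Ck_partial: "Ck (Suc k) f \<Longrightarrow> Ck k (partial i f)"
  using Ck_has_partial[of "Suc k" f "_ @ [i]"] Ck_continuous[of "Suc k" f "_ @ [i]"]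
  by (intro CkI) simp_all

lemma partials_diff:
  assumes "Ck k f" "Ck k g" "length ds \<le> k"
  shows "partials ds (\<lambda>x. f x - g x) = (\<lambda>x. partials ds f x - partials ds g x)"
  using assms(3)
proof (induction ds)
  case (Cons i ds)
  then show ?case
    using has_partial_imp_partial[OF has_partial_diff[OF Ck_has_partial[OF assms(1), of ds i] Ck_has_partial[OF assms(2), of ds i]]] by simp
qed simp

lemma Ck_diff:
  assumes "Ck k f" "Ck k g" shows "Ck k (\<lambda>x. f x - g x)"
proof (rule CkI)
  fix ds :: "2 list" and i assume l: "length ds < k"
  then show "has_partial i (partials ds (\<lambda>x. f x - g x)) (partials (i # ds) (\<lambda>x. f x - g x))"
    unfolding partials_diff[OF assms less_imp_le[OF l]] 
      partials_diff[OF assms, of "i # ds", unfolded length_Cons, OF Suc_leI[OF l]]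
    by (intro has_partial_diff Ck_has_partial[OF assms(1)] Ck_has_partial[OF assms(2)])
next
  fix ds :: "2 list" assume l: "length ds \<le> k"
  then show "continuous_on UNIV (partials ds (\<lambda>x. f x - g x))"
    unfolding partials_diff[OF assms l] by (intro continuous_intros Ck_continuous[OF assms(1)] Ck_continuous[OF assms(2)])
qed

lemma Ck_mono: "Ck k f \<Longrightarrow> l \<le> k \<Longrightarrow> Ck l f"
  by (auto simp: Ck_def)

section \<open>Periodic functions and the tiling of the plane\<close>

lemma torus_periodic_partial:
  assumes "torus_periodic f" shows "torus_periodic (partial i f)"
proof -
  have "f (x + (2 * pi) *\<^sub>R axis j 1 + h *\<^sub>R axis i 1) = f (x + h *\<^sub>R axis i 1)" for x j h
    using assms[unfolded torus_periodic_def, rule_format, of "x + h *\<^sub>R axis i 1" j] by (simp add: algebra_simps)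
  then show ?thesis unfolding torus_periodic_def partial_def by simp
qed

lemma torus_periodic_partials: "torus_periodic f \<Longrightarrow> torus_periodic (partials ds f)"
  by (induction ds) (auto intro: torus_periodic_partial)

lemma torus_periodic_comp: "torus_periodic f \<Longrightarrow> torus_periodic (\<lambda>x. g (f x))"
  by (simp add: torus_periodic_def)

lemma torus_periodic_comp2: "torus_periodic f \<Longrightarrow> torus_periodic f2 \<Longrightarrow> torus_periodic (\<lambda>x. g (f x) (f2 x))"
  by (simp add: torus_periodic_def)

definition lattice_vec :: "int \<times> int \<Rightarrow> real^2" where
  "lattice_vec k = (2 * pi) *\<^sub>R vector [of_int (fst k), of_int (snd k)]"

lemma lattice_vec_nth [simp]: "lattice_vec k $ 1 = 2 * pi * of_int (fst k)" "lattice_vec k $ 2 = 2 * pi * of_int (snd k)"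
  by (simp_all add: lattice_vec_def)

lemma periodic_int_shift:
  assumes "\<And>x. g (x + v) = g x" shows "g (x + of_int k *\<^sub>R v) = g (x :: 'a::real_vector)"
proof (induction k arbitrary: x rule: int_induct[of _ 0])
  case (step1 i)
  have "g (x + of_int (i + 1) *\<^sub>R v) = g ((x + of_int i *\<^sub>R v) + v)" by (simp add: algebra_simps)
  then show ?case using step1 assms by simp
next
  case (step2 i)
  have "g (x + of_int (i - 1) *\<^sub>R v) = g ((x + of_int (i - 1) *\<^sub>R v) + v)" by (simp add: assms)
  also have "(x + of_int (i - 1) *\<^sub>R v) + v = x + of_int i *\<^sub>R v" by (simp add: algebra_simps)
  finally show ?case using step2 by simp
qed simp

lemma torus_periodic_lattice:
  assumes "torus_periodic f" shows "f (x + lattice_vec k) = f x"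
proof -
  have "x + lattice_vec k = x + of_int (fst k) *\<^sub>R ((2*pi) *\<^sub>R axis 1 1) + of_int (snd k) *\<^sub>R ((2*pi) *\<^sub>R axis 2 1)"
    by (simp add: vec_eq_iff forall_2 axis_def)
  also have "f \<dots> = f x"
    using assms unfolding torus_periodic_def by (simp only: periodic_int_shift[where g=f])
  finally show ?thesis .
qed

definition half_open_cell :: "(real^2) set" where
  "half_open_cell = {x. \<forall>i. -pi \<le> x $ i \<and> x $ i < pi}"

lemma half_open_interval_shift:
  "\<exists>!k::int. -pi \<le> a - 2 * pi * of_int k \<and> a - 2 * pi * of_int k < pi"
proof
  define k where "k = \<lfloor>(a + pi) / (2 * pi)\<rfloor>"
  have "of_int k \<le> (a + pi) / (2 * pi)" "(a + pi) / (2 * pi) < of_int k + 1"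
    unfolding k_def by linarith+
  then show "-pi \<le> a - 2 * pi * of_int k \<and> a - 2 * pi * of_int k < pi"
    by (simp add: field_simps)
  fix l :: int assume l: "-pi \<le> a - 2 * pi * of_int l \<and> a - 2 * pi * of_int l < pi"
  then have "of_int l \<le> (a + pi) / (2 * pi)" "(a + pi) / (2 * pi) < of_int l + 1"
    by (simp_all add: field_simps)
  then show "l = k" unfolding k_def by linarith
qed

text \<open>The half-open cell is used because its translates cover every point exactly once; the closed cell of the
statement differs from it by a null set.\<close>

lemma half_open_cell_tiling: "\<exists>k0. {k. x - lattice_vec k \<in> half_open_cell} = {k0}"
proof -
  have ex: "\<exists>k::int. \<forall>m. (-pi \<le> a - 2 * pi * of_int m \<and> a - 2 * pi * of_int m < pi) = (m = k)" for a
    using half_open_interval_shift[of a] by (elim ex1E) (rule exI, blast)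
  obtain k where k: "\<forall>m. (-pi \<le> x $ 1 - 2 * pi * of_int m \<and> x $ 1 - 2 * pi * of_int m < pi) = (m = k)"
    using ex[of "x $ 1"] ..
  obtain l where l: "\<forall>m. (-pi \<le> x $ 2 - 2 * pi * of_int m \<and> x $ 2 - 2 * pi * of_int m < pi) = (m = l)"
    using ex[of "x $ 2"] ..
  have "{k. x - lattice_vec k \<in> half_open_cell} = {(k, l)}"
  proof (rule set_eqI)
    fix m :: "int \<times> int"
    show "m \<in> {k. x - lattice_vec k \<in> half_open_cell} \<longleftrightarrow> m \<in> {(k, l)}"
      using spec[OF k, of "fst m"] spec[OF l, of "snd m"] unfolding half_open_cell_def forall_2
      by (simp only: mem_Collect_eq vector_minus_component lattice_vec_nth singleton_iff prod_eq_iff fst_conv snd_conv)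
  qed
  then show ?thesis by blast
qed

lemma half_open_cell_subset: "half_open_cell \<subseteq> torus_cell"
  unfolding half_open_cell_def torus_cell_def by (simp add: subset_iff mem_box_cart less_imp_le)

text \<open>Uniform statements about periodic functions reduce to the compact cell. The representative does not depend on the
function, so several functions can be reduced at once.\<close>

lemma periodic_representative:
  obtains y where "y \<in> torus_cell" "\<And>f :: real^2 \<Rightarrow> 'b. torus_periodic f \<Longrightarrow> f x = f y"
proof -
  obtain k where "x - lattice_vec k \<in> half_open_cell" using half_open_cell_tiling[of x] by blast
  moreover have "f x = f (x - lattice_vec k)" if "torus_periodic f" for f :: "real^2 \<Rightarrow> 'b"
    using torus_periodic_lattice[OF that, of "x - lattice_vec k" k] by simp
  ultimately show ?thesis using that half_open_cell_subset by blast
qed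

section \<open>Families of functions depending on time\<close>

text \<open>Time is restricted to the compact interval and space is not restricted, which is what integration over time
under a space derivative requires.\<close>

definition jointly_continuous :: "real \<Rightarrow> (real \<Rightarrow> real^2 \<Rightarrow> 'b::topological_space) \<Rightarrow> bool" where
  "jointly_continuous T f \<longleftrightarrow> continuous_on ({0..T} \<times> UNIV) (\<lambda>(r, x). f r x)"

lemma jointly_continuousI:
  fixes f :: "real \<Rightarrow> real^2 \<Rightarrow> 'b::metric_space"
  assumes u: "\<And>s. s \<in> {0..T} \<Longrightarrow> uniform_limit UNIV f (f s) (at s within {0..T})"
    and c: "\<And>s. s \<in> {0..T} \<Longrightarrow> continuous_on UNIV (f s)"
  shows "jointly_continuous T f"
  unfolding jointly_continuous_def continuous_on_iff
proof (intro ballI allI impI)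
  fix z :: "real \<times> (real^2)" and e :: real assume "z \<in> {0..T} \<times> UNIV" and e: "e > 0"
  then obtain s x where s: "s \<in> {0..T}" and z: "z = (s, x)" by auto
  from uniform_limitD[OF u[OF s], of "e/2"] e obtain d where d: "d > 0" 
    "\<And>r. r \<in> {0..T} \<Longrightarrow> r \<noteq> s \<Longrightarrow> dist r s < d \<Longrightarrow> \<forall>x. dist (f r x) (f s x) < e/2"
    by (auto simp: eventually_at)
  from c[OF s, unfolded continuous_on_iff, rule_format, of x "e/2"] e obtain d' where d': "d' > 0"
    "\<And>y. dist y x < d' \<Longrightarrow> dist (f s y) (f s x) < e/2" by auto
  have "dist (f r y) (f s x) < e" if "r \<in> {0..T}" "dist (r, y) (s, x) < min d d'" for r y
  proof -
    have *: "dist r s < d" "dist y x < d'"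
      using that(2) dist_fst_le[of "(r,y)" "(s,x)"] dist_snd_le[of "(r,y)" "(s,x)"] by auto
    have "dist (f r y) (f s y) < e/2" using d(2)[OF that(1) _ *(1)] e by (cases "r = s") auto
    with d'(2)[OF *(2)] show ?thesis
      using dist_triangle[of "f r y" "f s x" "f s y"] by linarith
  qed
  then show "\<exists>d>0. \<forall>x'\<in>{0..T} \<times> UNIV. dist x' z < d \<longrightarrow> dist (case x' of (r, x) \<Rightarrow> f r x) (case z of (r, x) \<Rightarrow> f r x) < e"
    using d(1) d'(1) unfolding z by (intro exI[of _ "min d d'"]) auto
qed

lemma jointly_continuous_space: "jointly_continuous T f \<Longrightarrow> s \<in> {0..T} \<Longrightarrow> continuous_on UNIV (f s)"
  unfolding jointly_continuous_def
  by (rule continuous_on_compose2[of _ "\<lambda>(r,x). f r x" _ "\<lambda>x. (s, x)", simplified]) (auto intro!: continuous_intros)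

lemma jointly_continuous_time: "jointly_continuous T f \<Longrightarrow> continuous_on {0..T} (\<lambda>r. f r x)"
  unfolding jointly_continuous_def
  by (rule continuous_on_compose2[of _ "\<lambda>(r,x). f r x" _ "\<lambda>r. (r, x)", simplified]) (auto intro!: continuous_intros)

lemma jointly_continuous_add:
  fixes f g :: "real \<Rightarrow> real^2 \<Rightarrow> real"
  shows "jointly_continuous T f \<Longrightarrow> jointly_continuous T g \<Longrightarrow> jointly_continuous T (\<lambda>s x. f s x + g s x)"
  unfolding jointly_continuous_def case_prod_unfold by (intro continuous_intros)

lemma jointly_continuous_mult:
  fixes f g :: "real \<Rightarrow> real^2 \<Rightarrow> real"
  shows "jointly_continuous T f \<Longrightarrow> jointly_continuous T g \<Longrightarrow> jointly_continuous T (\<lambda>s x. f s x * g s x)"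
  unfolding jointly_continuous_def case_prod_unfold by (intro continuous_intros)

lemma jointly_continuous_cmult:
  fixes f :: "real \<Rightarrow> real^2 \<Rightarrow> real"
  shows "jointly_continuous T f \<Longrightarrow> jointly_continuous T (\<lambda>s x. c * f s x)"
  unfolding jointly_continuous_def case_prod_unfold by (intro continuous_intros)

text \<open>Compactness of the time interval times the cell.\<close>

lemma jointly_continuous_periodic_bounded:
  fixes f :: "real \<Rightarrow> real^2 \<Rightarrow> 'b::real_normed_vector"
  assumes "jointly_continuous T f" "\<And>s. s \<in> {0..T} \<Longrightarrow> torus_periodic (f s)"
  obtains B where "B > 0" "\<And>s x. s \<in> {0..T} \<Longrightarrow> norm (f s x) \<le> B"
proof -
  have "compact ((\<lambda>(r, x). f r x) ` ({0..T} \<times> torus_cell))"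
    using assms(1) unfolding jointly_continuous_def
    by (intro compact_continuous_image compact_Times)
       (auto intro: continuous_on_subset simp: torus_cell_def)
  from compact_imp_bounded[OF this] obtain B where B: "B > 0" "\<And>z. z \<in> (\<lambda>(r, x). f r x) ` ({0..T} \<times> torus_cell) \<Longrightarrow> norm z \<le> B"
    unfolding bounded_pos by blast
  have "norm (f s x) \<le> B" if s: "s \<in> {0..T}" for s x
  proof -
    obtain y where "y \<in> torus_cell" "f s x = f s y" using periodic_representative[of x] assms(2)[OF s] by metis
    then show ?thesis using s by (intro B(2)) auto
  qed
  with B(1) show ?thesis using that by blast
qed

lemma partial_time_integral:
  fixes f f' :: "real \<Rightarrow> real^2 \<Rightarrow> real"
  assumes f: "jointly_continuous T f" and f': "jointly_continuous T f'"
    and d: "\<And>r. r \<in> {0..T} \<Longrightarrow> has_partial i (f r) (f' r)" and st: "0 \<le> s" "s \<le> t" "t \<le> T"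
  shows "has_partial i (\<lambda>x. integral {s..t} (\<lambda>r. f r x)) (\<lambda>x. integral {s..t} (\<lambda>r. f' r x))"
  unfolding has_partial_def
proof
  fix x
  have "((\<lambda>h. integral (cbox s t) ((\<lambda>h r. f r (x + h *\<^sub>R axis i 1)) h)) has_vector_derivative 
      integral (cbox s t) ((\<lambda>h r. f' r (x + h *\<^sub>R axis i 1)) 0)) (at 0 within UNIV)"
  proof (rule leibniz_rule_vector_derivative)
    show "((\<lambda>h. f r (x + h *\<^sub>R axis i 1)) has_vector_derivative f' r (x + h *\<^sub>R axis i 1)) (at h within UNIV)"
      if "r \<in> cbox s t" for h r
      using d[of r] that st by (auto intro!: has_partial_at)
    show "(\<lambda>r. f r (x + h *\<^sub>R axis i 1)) integrable_on cbox s t" for h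
      using st by (intro integrable_continuous continuous_on_subset[OF jointly_continuous_time[OF f]]) auto
    have "continuous_on (UNIV \<times> cbox s t) (\<lambda>z. (\<lambda>(r, x). f' r x) (snd z, x + fst z *\<^sub>R axis i 1))"
      by (rule continuous_on_compose2[OF f'[unfolded jointly_continuous_def]]) (use st in \<open>auto intro!: continuous_intros\<close>)
    then show "continuous_on (UNIV \<times> cbox s t) (\<lambda>(h, r). f' r (x + h *\<^sub>R axis i 1))"
      by (simp add: case_prod_unfold)
  qed auto
  then show "((\<lambda>h. integral {s..t} (\<lambda>r. f r (x + h *\<^sub>R axis i 1))) has_vector_derivative integral {s..t} (\<lambda>r. f' r x)) (at 0)"
    by simp
qed

lemma continuous_time_integral:
  fixes f :: "real \<Rightarrow> real^2 \<Rightarrow> real"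
  assumes f: "jointly_continuous T f" and st: "0 \<le> s" "t \<le> T"
  shows "continuous_on UNIV (\<lambda>x. integral {s..t} (\<lambda>r. f r x))"
proof -
  have "continuous_on (UNIV \<times> cbox s t) (\<lambda>z. (\<lambda>(r, x). f r x) (snd z, fst z))"
    by (rule continuous_on_compose2[OF f[unfolded jointly_continuous_def]]) (use st in \<open>auto intro!: continuous_intros\<close>)
  then have "continuous_on (UNIV \<times> cbox s t) (\<lambda>(x, r). f r x)" by (simp add: case_prod_unfold)
  from integral_continuous_on_param[OF this] show ?thesis by simp
qed

lemma C_time_Ck: "C_time_Ck_torus T k f \<Longrightarrow> s \<in> {0..T} \<Longrightarrow> Ck k (f s)"
  by (simp add: C_time_Ck_torus_def Ck_torus_def)

lemma C_time_periodic: "C_time_Ck_torus T k f \<Longrightarrow> s \<in> {0..T} \<Longrightarrow> torus_periodic (f s)"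
  by (simp add: C_time_Ck_torus_def Ck_torus_def)

lemma C_time_uniform_limit: 
  "C_time_Ck_torus T k f \<Longrightarrow> length ds \<le> k \<Longrightarrow> s \<in> {0..T} \<Longrightarrow> 
     uniform_limit UNIV (\<lambda>r. partials ds (f r)) (partials ds (f s)) (at s within {0..T})"
  by (simp add: C_time_Ck_torus_def)

lemma C_time_jointly_continuous:
  fixes f :: "real \<Rightarrow> real^2 \<Rightarrow> 'b::real_normed_vector"
  shows "C_time_Ck_torus T k f \<Longrightarrow> length ds \<le> k \<Longrightarrow> jointly_continuous T (\<lambda>s. partials ds (f s))"
  by (rule jointly_continuousI) (auto intro: C_time_uniform_limit Ck_continuous[OF C_time_Ck])

text \<open>One constant for all derivatives up to order \<open>k\<close> at all times; there are finitely many lists of directions.\<close>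

lemma C_time_bounded:
  fixes f :: "real \<Rightarrow> real^2 \<Rightarrow> 'b::real_normed_vector"
  assumes f: "C_time_Ck_torus T k f"
  obtains B where "B > 0" "\<And>ds s x. length ds \<le> k \<Longrightarrow> s \<in> {0..T} \<Longrightarrow> norm (partials ds (f s) x) \<le> B"
proof -
  have "\<exists>B>0. \<forall>s\<in>{0..T}. \<forall>x. norm (partials ds (f s) x) \<le> B" if "length ds \<le> k" for ds
    using jointly_continuous_periodic_bounded[OF C_time_jointly_continuous[OF f that]]
      torus_periodic_partials[OF C_time_periodic[OF f]] by metis
  then obtain B where B: "\<And>ds. length ds \<le> k \<Longrightarrow> B ds > 0" 
     "\<And>ds s x. length ds \<le> k \<Longrightarrow> s \<in> {0..T} \<Longrightarrow> norm (partials ds (f s) x) \<le> B ds" by metis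
  let ?L = "{ds :: 2 list. length ds \<le> k}"
  have fin: "finite ?L" using finite_lists_length_le[of "UNIV :: 2 set" k] by simp
  show ?thesis
  proof (rule that)
    show "(\<Sum>ds\<in>?L. B ds) > 0" using fin B(1) by (intro sum_pos) (auto intro: exI[of _ "[]"])
    fix ds :: "2 list" and s x assume *: "length ds \<le> k" "s \<in> {0..T}"
    have "B ds \<le> (\<Sum>ds\<in>?L. B ds)" using fin * B(1) by (intro member_le_sum) (auto intro: less_imp_le)
    then show "norm (partials ds (f s) x) \<le> (\<Sum>ds\<in>?L. B ds)" using B(2)[OF *] by (rule order_trans[rotated])
  qed
qed

lemma C_time_nth:
  fixes f :: "real \<Rightarrow> real^2 \<Rightarrow> real^2"
  assumes f: "C_time_Ck_torus T k f"
  shows "C_time_Ck_torus T k (\<lambda>s x. f s x $ j)"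
  unfolding C_time_Ck_torus_def Ck_torus_def
proof (intro conjI ballI allI impI)
  fix s assume s: "s \<in> {0..T}"
  show "torus_periodic (\<lambda>x. f s x $ j)" by (rule torus_periodic_comp[OF C_time_periodic[OF f s]])
  show "Ck k (\<lambda>x. f s x $ j)" by (intro Ck_nth C_time_Ck[OF f s])
next
  fix ds :: "2 list" and s assume ds: "length ds \<le> k" and s: "s \<in> {0..T}"
  have "uniform_limit UNIV (\<lambda>r x. partials ds (f r) x $ j) (\<lambda>x. partials ds (f s) x $ j) (at s within {0..T})"
    by (rule bounded_linear.uniform_limit[OF bounded_linear_vec_nth C_time_uniform_limit[OF f ds s]])
  moreover have "\<forall>\<^sub>F r in at s within {0..T}. \<forall>x\<in>UNIV. partials ds (f r) x $ j = partials ds (\<lambda>x. f r x $ j) x"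
    unfolding eventually_at_filter by (auto simp: partials_nth[OF C_time_Ck[OF f] ds])
  ultimately show "uniform_limit UNIV (\<lambda>r. partials ds (\<lambda>x. f r x $ j)) (partials ds (\<lambda>x. f s x $ j)) (at s within {0..T})"
    unfolding partials_nth[OF C_time_Ck[OF f s] ds] by (subst uniform_limit_cong[symmetric]) auto
qed

lemma C_time_partial:
  assumes f: "C_time_Ck_torus T (Suc k) f"
  shows "C_time_Ck_torus T k (\<lambda>s. partial i (f s))"
  unfolding C_time_Ck_torus_def Ck_torus_def partials_partial
  by (intro conjI ballI allI impI C_time_uniform_limit[OF f] torus_periodic_partial C_time_periodic[OF f] Ck_partial C_time_Ck[OF f])
     auto

lemma C_time_diff:
  assumes f: "C_time_Ck_torus T k f" and g: "C_time_Ck_torus T k g"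
  shows "C_time_Ck_torus T k (\<lambda>s x. f s x - g s x)"
  unfolding C_time_Ck_torus_def Ck_torus_def
proof (intro conjI ballI allI impI)
  fix s assume s: "s \<in> {0..T}"
  show "torus_periodic (\<lambda>x. f s x - g s x)" by (rule torus_periodic_comp2[OF C_time_periodic[OF f s] C_time_periodic[OF g s]])
  show "Ck k (\<lambda>x. f s x - g s x)" by (intro Ck_diff C_time_Ck[OF f s] C_time_Ck[OF g s])
next
  fix ds :: "2 list" and s assume ds: "length ds \<le> k" and s: "s \<in> {0..T}"
  have "uniform_limit UNIV (\<lambda>r x. partials ds (f r) x - partials ds (g r) x) (\<lambda>x. partials ds (f s) x - partials ds (g s) x) (at s within {0..T})"
    by (intro uniform_limit_intros C_time_uniform_limit[OF f ds s] C_time_uniform_limit[OF g ds s])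
  moreover have "\<forall>\<^sub>F r in at s within {0..T}. \<forall>x\<in>UNIV. partials ds (f r) x - partials ds (g r) x = partials ds (\<lambda>x. f r x - g r x) x"
    unfolding eventually_at_filter by (auto simp: partials_diff[OF C_time_Ck[OF f] C_time_Ck[OF g] ds])
  ultimately show "uniform_limit UNIV (\<lambda>r. partials ds (\<lambda>x. f r x - g r x)) (partials ds (\<lambda>x. f s x - g s x)) (at s within {0..T})"
    unfolding partials_diff[OF C_time_Ck[OF f s] C_time_Ck[OF g s] ds] by (subst uniform_limit_cong[symmetric]) auto
qed

section \<open>Integrals of periodic functions over the cell\<close>


lemma borel_measurable_vec_nth' [measurable]: "(\<lambda>x::real^2. x $ i) \<in> borel_measurable borel"
  by (intro borel_measurable_continuous_onI continuous_intros)

lemma half_open_cell_sets [measurable]: "half_open_cell \<in> sets borel"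
proof -
  have "half_open_cell = {x \<in> space borel. (-pi \<le> x $ 1 \<and> x $ 1 < pi) \<and> (-pi \<le> x $ 2 \<and> x $ 2 < pi)}"
    by (simp add: half_open_cell_def forall_2)
  also have "\<dots> \<in> sets borel" by measurable
  finally show ?thesis .
qed

lemma torus_cell_sets [measurable]: "torus_cell \<in> sets borel"
  by (simp add: torus_cell_def)

lemma AE_cell: "AE x in lborel. x \<in> torus_cell \<longleftrightarrow> x \<in> half_open_cell"
proof -
  have sub: "box (vec (-pi)) (vec pi) \<subseteq> half_open_cell"
    unfolding half_open_cell_def by (simp add: subset_iff mem_box_cart less_imp_le)
  have "emeasure lborel (torus_cell - box (vec (-pi)) (vec pi)) = 0"
    unfolding torus_cell_def
    by (subst emeasure_Diff)
       (auto simp: box_subset_cbox emeasure_lborel_cbox_eq emeasure_lborel_box_eq emeasure_lborel_box_finite)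
  then have "AE x in lborel. x \<notin> torus_cell - box (vec (-pi)) (vec pi)"
    by (intro AE_not_in) (auto simp: null_sets_def torus_cell_def)
  then show ?thesis by eventually_elim (use sub half_open_cell_subset in blast)
qed

lemma nn_integral_lborel_reflect:
  fixes g :: "real^2 \<Rightarrow> ennreal"
  assumes [measurable]: "g \<in> borel_measurable borel"
  shows "(\<integral>\<^sup>+y. g (c - y) \<partial>lborel) = (\<integral>\<^sup>+y. g y \<partial>lborel)"
proof -
  have "(\<integral>\<^sup>+y. g y \<partial>lborel) = (\<integral>\<^sup>+y. g y \<partial>density (distr lborel borel (\<lambda>x. c + (-1) *\<^sub>R x)) (\<lambda>_. ennreal (\<bar>-1::real\<bar>^DIM(real^2))))"
    by (subst lborel_affine[of "-1" c]) simp_all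
  also have "\<dots> = (\<integral>\<^sup>+y. g (c - y) \<partial>lborel)"
    by (simp add: nn_integral_density nn_integral_distr)
  finally show ?thesis by simp
qed

lemma nn_integral_tiles: "(\<integral>\<^sup>+k. indicator half_open_cell (x - lattice_vec k) \<partial>count_space UNIV) = (1::ennreal)"
proof -
  obtain k0 where k0: "{k. x - lattice_vec k \<in> half_open_cell} = {k0}" using half_open_cell_tiling by blast
  have "(\<lambda>k. indicator half_open_cell (x - lattice_vec k) :: ennreal) = indicator {k0}"
    unfolding k0[symmetric] by (auto simp: indicator_def fun_eq_iff)
  then show ?thesis by simp
qed

text \<open>Integrals of a periodic function over a shifted and reflected cell agree with the integral over the cell: cut the
moved cell along the tiling and move every piece back. Reflection is built in because convolution integrates
\<open>K (x - y)\<close>; applying the statement twice gives translations.\<close>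

lemma nn_integral_cell_reflect:
  fixes f :: "real^2 \<Rightarrow> ennreal"
  assumes [measurable]: "f \<in> borel_measurable borel" and per: "torus_periodic f"
  shows "(\<integral>\<^sup>+y. f (a - y) * indicator torus_cell y \<partial>lborel) = (\<integral>\<^sup>+y. f y * indicator torus_cell y \<partial>lborel)"
proof -
  let ?H = "half_open_cell"
  have cell: "(\<integral>\<^sup>+y. g y * indicator torus_cell y \<partial>lborel) = (\<integral>\<^sup>+y. g y * indicator ?H y \<partial>lborel)" for g :: "real^2 \<Rightarrow> ennreal"
    using AE_cell by (intro nn_integral_cong_AE) (auto elim!: eventually_mono simp: indicator_def)
  have "(\<integral>\<^sup>+y. f (a - y) * indicator ?H y \<partial>lborel) = 
     (\<integral>\<^sup>+y. (\<integral>\<^sup>+k. f (a - y) * indicator ?H y * indicator ?H (a - y - lattice_vec k) \<partial>count_space UNIV) \<partial>lborel)"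
    by (simp add: nn_integral_cmult nn_integral_tiles)
  also have "\<dots> = (\<integral>\<^sup>+k. (\<integral>\<^sup>+y. f (a - y) * indicator ?H y * indicator ?H (a - y - lattice_vec k) \<partial>lborel) \<partial>count_space UNIV)"
    by (rule nn_integral_count_space_nn_integral) auto
  \<comment> \<open>Substitute \<open>a - lattice_vec k - y\<close> for \<open>y\<close> in the piece with index \<open>k\<close>; periodicity removes the lattice vector.\<close>
  also have "\<dots> = (\<integral>\<^sup>+k. (\<integral>\<^sup>+y. f y * indicator ?H y * indicator ?H (a - y - lattice_vec k) \<partial>lborel) \<partial>count_space UNIV)"
  proof (rule nn_integral_cong)
    fix k
    have "(\<integral>\<^sup>+y. f (a - y) * indicator ?H y * indicator ?H (a - y - lattice_vec k) \<partial>lborel) =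
       (\<integral>\<^sup>+y. f (a - (a - lattice_vec k - y)) * indicator ?H (a - lattice_vec k - y) * indicator ?H (a - (a - lattice_vec k - y) - lattice_vec k) \<partial>lborel)"
      by (rule nn_integral_lborel_reflect[symmetric]) measurable
    also have "\<dots> = (\<integral>\<^sup>+y. f (y + lattice_vec k) * indicator ?H y * indicator ?H (a - y - lattice_vec k) \<partial>lborel)"
      by (intro nn_integral_cong) (simp add: algebra_simps)
    finally show "(\<integral>\<^sup>+y. f (a - y) * indicator ?H y * indicator ?H (a - y - lattice_vec k) \<partial>lborel) = 
       (\<integral>\<^sup>+y. f y * indicator ?H y * indicator ?H (a - y - lattice_vec k) \<partial>lborel)"
      by (simp add: torus_periodic_lattice[OF per])
  qed
  also have "\<dots> = (\<integral>\<^sup>+y. (\<integral>\<^sup>+k. f y * indicator ?H y * indicator ?H (a - y - lattice_vec k) \<partial>count_space UNIV) \<partial>lborel)"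
    by (rule nn_integral_count_space_nn_integral[symmetric]) auto
  also have "\<dots> = (\<integral>\<^sup>+y. f y * indicator ?H y \<partial>lborel)"
    by (simp add: nn_integral_cmult nn_integral_tiles)
  finally show ?thesis unfolding cell .
qed

lemma torus_periodic_reflect: "torus_periodic f \<Longrightarrow> torus_periodic (\<lambda>y. f (a - y))"
proof -
  assume f: "torus_periodic f"
  have "f (a - (x + (2*pi) *\<^sub>R axis i 1)) = f (a - x)" for x i
    using f[unfolded torus_periodic_def, rule_format, of "a - (x + (2*pi) *\<^sub>R axis i 1)" i] by (simp add: algebra_simps)
  then show ?thesis by (simp add: torus_periodic_def)
qed

lemma set_integrable_cell_iff:
  fixes f :: "real^2 \<Rightarrow> 'b::{banach, second_countable_topology}"
  assumes [measurable]: "f \<in> borel_measurable borel"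
  shows "set_integrable lborel torus_cell f \<longleftrightarrow> (\<integral>\<^sup>+y. ennreal (norm (f y)) * indicator torus_cell y \<partial>lborel) < \<infinity>"
proof -
  have "(\<integral>\<^sup>+ x. ennreal (norm (indicat_real torus_cell x *\<^sub>R f x)) \<partial>lborel) = (\<integral>\<^sup>+y. ennreal (norm (f y)) * indicator torus_cell y \<partial>lborel)"
    by (intro nn_integral_cong) (auto simp: indicator_def)
  then show ?thesis
    unfolding set_integrable_def integrable_iff_bounded by simp
qed

lemma set_integrable_cell_reflect:
  fixes f :: "real^2 \<Rightarrow> 'b::{banach, second_countable_topology}"
  assumes [measurable]: "f \<in> borel_measurable borel" and "torus_periodic f"
    and "set_integrable lborel torus_cell f"
  shows "set_integrable lborel torus_cell (\<lambda>y. f (a - y))"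
  using assms(3) nn_integral_cell_reflect[of "\<lambda>y. ennreal (norm (f y))" a] torus_periodic_comp[OF assms(2), of "\<lambda>z. ennreal (norm z)"]
  by (simp add: set_integrable_cell_iff)

text \<open>Positive and negative parts are handled by the statement for nonnegative functions.\<close>

lemma integral_cell_reflect_real:
  fixes f :: "real^2 \<Rightarrow> real"
  assumes [measurable]: "f \<in> borel_measurable borel" and per: "torus_periodic f"
    and int: "set_integrable lborel torus_cell f"
  shows "(LINT y:torus_cell|lborel. f (a - y)) = (LINT y:torus_cell|lborel. f y)"
proof -
  have *: "(LINT y:torus_cell|lborel. g y) = enn2real (\<integral>\<^sup>+y. ennreal (g y) * indicator torus_cell y \<partial>lborel)
      - enn2real (\<integral>\<^sup>+y. ennreal (- g y) * indicator torus_cell y \<partial>lborel)" 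
    if "set_integrable lborel torus_cell g" for g :: "real^2 \<Rightarrow> real"
    unfolding set_lebesgue_integral_def real_lebesgue_integral_def[OF that[unfolded set_integrable_def]]
    by (intro arg_cong2[where f="(-)"] arg_cong[where f=enn2real] nn_integral_cong) (auto simp: indicator_def)
  show ?thesis unfolding *[OF int] *[OF set_integrable_cell_reflect[OF assms]]
    using nn_integral_cell_reflect[of "\<lambda>y. ennreal (f y)" a] nn_integral_cell_reflect[of "\<lambda>y. ennreal (- f y)" a] 
      torus_periodic_comp[OF per, of ennreal] torus_periodic_comp[OF per, of "\<lambda>z. ennreal (- z)"] by simp
qed

lemma set_integral_vec_nth:
  fixes f :: "real^2 \<Rightarrow> real^2"
  assumes "set_integrable lborel A f"
  shows "set_integrable lborel A (\<lambda>x. f x $ j)" "(LINT x:A|lborel. f x) $ j = (LINT x:A|lborel. f x $ j)"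
  using integrable_bounded_linear[OF bounded_linear_vec_nth assms[unfolded set_integrable_def], of j]
    integral_bounded_linear[OF bounded_linear_vec_nth assms[unfolded set_integrable_def], of j]
  by (simp_all add: set_integrable_def set_lebesgue_integral_def)

lemma integral_cell_reflect:
  fixes f :: "real^2 \<Rightarrow> real^2"
  assumes [measurable]: "f \<in> borel_measurable borel" and per: "torus_periodic f"
    and int: "set_integrable lborel torus_cell f"
  shows "(LINT y:torus_cell|lborel. f (a - y)) = (LINT y:torus_cell|lborel. f y)"
proof -
  have m: "(\<lambda>y. f y $ j) \<in> borel_measurable borel" for j
    by (rule measurable_compose[OF assms(1) borel_measurable_vec_nth'])
  show ?thesis
    unfolding vec_eq_iff set_integral_vec_nth[OF int] set_integral_vec_nth[OF set_integrable_cell_reflect[OF assms]]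
    by (intro allI integral_cell_reflect_real m torus_periodic_comp[OF per] set_integral_vec_nth[OF int])
qed

lemma integral_cell_translate:
  fixes f :: "real^2 \<Rightarrow> real^2"
  assumes [measurable]: "f \<in> borel_measurable borel" and per: "torus_periodic f"
    and int: "set_integrable lborel torus_cell f"
  shows "(LINT y:torus_cell|lborel. f (y + a)) = (LINT y:torus_cell|lborel. f y)"
proof -
  have "(LINT y:torus_cell|lborel. (\<lambda>z. f (a - z)) (0 - y)) = (LINT y:torus_cell|lborel. f (a - y))"
    by (intro integral_cell_reflect torus_periodic_reflect per set_integrable_cell_reflect int) measurable
  then show ?thesis using integral_cell_reflect[OF assms, of a] by (simp add: add.commute)
qed

lemma integral_cell_translate_real:
  fixes f :: "real^2 \<Rightarrow> real"
  assumes [measurable]: "f \<in> borel_measurable borel" and per: "torus_periodic f"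
    and int: "set_integrable lborel torus_cell f"
  shows "(LINT y:torus_cell|lborel. f (y + a)) = (LINT y:torus_cell|lborel. f y)"
proof -
  have "(LINT y:torus_cell|lborel. (\<lambda>z. f (a - z)) (0 - y)) = (LINT y:torus_cell|lborel. f (a - y))"
    by (intro integral_cell_reflect_real torus_periodic_reflect per set_integrable_cell_reflect int) measurable
  then show ?thesis using integral_cell_reflect_real[OF assms, of a] by (simp add: add.commute)
qed

lemma set_integrable_cell_continuous:
  fixes f :: "real^2 \<Rightarrow> 'b::{banach, second_countable_topology}"
  assumes "continuous_on UNIV f" shows "set_integrable lborel torus_cell f"
  unfolding set_integrable_def torus_cell_def
  by (rule borel_integrable_compact) (auto intro: continuous_on_subset[OF assms])

lemma periodic_continuous_bounded:
  fixes f :: "real^2 \<Rightarrow> real"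
  assumes "continuous_on UNIV f" "torus_periodic f"
  obtains B where "B > 0" "\<And>x. \<bar>f x\<bar> \<le> B"
proof -
  have "jointly_continuous 0 (\<lambda>_. f)" 
    unfolding jointly_continuous_def case_prod_unfold
    by (rule continuous_on_compose2[OF assms(1)]) (auto intro!: continuous_intros)
  from jointly_continuous_periodic_bounded[OF this] assms(2) that show ?thesis by (metis atLeastAtMost_iff order_refl real_norm_def)
qed

text \<open>By translation invariance the integral of every difference quotient vanishes, and dominated convergence passes
to the derivative.\<close>

lemma integral_cell_partial:
  fixes f f' :: "real^2 \<Rightarrow> real"
  assumes d: "has_partial i f f'" and c: "continuous_on UNIV f" "continuous_on UNIV f'" and per: "torus_periodic f"
  shows "(LINT x:torus_cell|lborel. f' x) = 0"
proof -
  have per': "torus_periodic f'" using torus_periodic_partial[OF per, of i] has_partial_imp_partial[OF d] by simp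
  obtain B where B: "B > 0" "\<And>x. \<bar>f' x\<bar> \<le> B" using periodic_continuous_bounded[OF c(2) per'] by blast
  define h where "h n = 1 / real (Suc n)" for n
  have h: "h n > 0" for n by (simp add: h_def)
  define q where "q n x = (f (x + h n *\<^sub>R axis i 1) - f x) / h n" for n x
  have [measurable]: "f \<in> borel_measurable borel" "f' \<in> borel_measurable borel"
    using c by (auto intro: borel_measurable_continuous_onI)
  have [measurable]: "q n \<in> borel_measurable borel" for n unfolding q_def by measurable
  have "(\<lambda>n. LINT x|lborel. indicator torus_cell x *\<^sub>R q n x) \<longlonglongrightarrow> (LINT x|lborel. indicator torus_cell x *\<^sub>R f' x)"
  proof (rule integral_dominated_convergence[where w="\<lambda>x. indicator torus_cell x *\<^sub>R B"])
    show "integrable lborel (\<lambda>x. indicat_real torus_cell x *\<^sub>R B)"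
      using set_integrable_cell_continuous[of "\<lambda>_. B"] by (simp add: set_integrable_def)
    show "AE x in lborel. (\<lambda>n. indicat_real torus_cell x *\<^sub>R q n x) \<longlonglongrightarrow> indicat_real torus_cell x *\<^sub>R f' x"
    proof (intro AE_I2 tendsto_intros)
      fix x
      have "((\<lambda>h. f (x + h *\<^sub>R axis i 1)) has_real_derivative f' x) (at 0)"
        using has_partial_real_at[OF d, of x 0] by simp
      then have "(\<lambda>h. (f (x + h *\<^sub>R axis i 1) - f x) / h) \<midarrow>0\<rightarrow> f' x" by (simp add: DERIV_def)
      moreover have "filterlim h (at 0) sequentially"
        using h LIMSEQ_inverse_real_of_nat unfolding filterlim_at h_def by (auto simp: inverse_eq_divide)
      ultimately show "(\<lambda>n. q n x) \<longlonglongrightarrow> f' x" unfolding q_def by (rule filterlim_compose)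
    qed
    show "AE x in lborel. norm (indicat_real torus_cell x *\<^sub>R q n x) \<le> indicat_real torus_cell x *\<^sub>R B" for n
      using axis_lipschitz[OF d B(2), of _ "h n"] h[of n]
      by (intro AE_I2) (auto simp: q_def indicator_def field_simps)
  qed auto
  moreover have "(LINT x|lborel. indicator torus_cell x *\<^sub>R q n x) = 0" for n
  proof -
    have ct: "continuous_on UNIV (\<lambda>x. f (x + h n *\<^sub>R axis i 1))"
      by (rule continuous_on_compose2[OF c(1)]) (auto intro!: continuous_intros)
    have "(LINT x:torus_cell|lborel. q n x) = ((LINT x:torus_cell|lborel. f (x + h n *\<^sub>R axis i 1)) - (LINT x:torus_cell|lborel. f x)) / h n"
      unfolding q_def using set_integrable_cell_continuous[OF ct] set_integrable_cell_continuous[OF c(1)]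
      by (simp add: set_integral_diff)
    also have "\<dots> = 0" 
      by (simp add: integral_cell_translate_real per set_integrable_cell_continuous[OF c(1)])
    finally show ?thesis by (simp add: set_lebesgue_integral_def)
  qed
  ultimately show ?thesis by (simp add: set_lebesgue_integral_def LIMSEQ_const_iff)
qed

section \<open>Convolution with the Biot--Savart kernel\<close>


text \<open>Integrability at the origin, from the primitive of a power with exponent above \<open>-1\<close>.\<close>

lemma inverse_sqrt_integrable:
  "(\<integral>\<^sup>+t. ennreal (1 / sqrt \<bar>t\<bar>) * indicator {-pi..pi} t \<partial>lborel) < \<infinity>"
proof -
  define g where "g t = ennreal (t powr (-1/2)) * indicator {0..pi} t" for t :: real
  have [measurable]: "g \<in> borel_measurable borel" unfolding g_def by measurable
  have "((\<lambda>x. x powr (-1/2)) has_integral (pi powr (-1/2+1) / (-1/2+1))) {0..pi}"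
    by (rule has_integral_powr_from_0) auto
  from nn_integral_has_integral_lebesgue'[OF _ this]
  have g: "(\<integral>\<^sup>+t. g t \<partial>lborel) < \<infinity>" by (simp add: g_def)
  have le: "ennreal (1 / sqrt \<bar>t\<bar>) * indicator {-pi..pi} t \<le> g t + g (- t)" for t :: real
  proof -
    have p: "s powr (-1/2) = 1 / sqrt s" if "s \<ge> 0" for s :: real
      using that by (simp add: powr_minus_divide powr_half_sqrt)
    show ?thesis
      using p[of t] p[of "-t"] by (cases "t \<ge> 0") (auto simp: g_def indicator_def)
  qed
  have "(\<integral>\<^sup>+t. g (- t) \<partial>lborel) = (\<integral>\<^sup>+t. g t \<partial>lborel)"
    using nn_integral_distr[of uminus lborel borel g] by (simp add: lborel_distr_uminus)
  have "(\<integral>\<^sup>+t. ennreal (1 / sqrt \<bar>t\<bar>) * indicator {-pi..pi} t \<partial>lborel) \<le> (\<integral>\<^sup>+t. g t + g (- t) \<partial>lborel)"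
    by (intro nn_integral_mono le)
  also have "\<dots> = (\<integral>\<^sup>+t. g t \<partial>lborel) + (\<integral>\<^sup>+t. g (- t) \<partial>lborel)" by (rule nn_integral_add) auto
  also have "\<dots> < \<infinity>" using g \<open>(\<integral>\<^sup>+t. g (- t) \<partial>lborel) = _\<close> by simp
  finally show ?thesis .
qed

lemma nn_integral_lborel_prod2:
  assumes [measurable]: "f \<in> borel_measurable borel"
  shows "(\<integral>\<^sup>+x. f (x $ 1) * f (x $ 2) \<partial>(lborel :: (real^2) measure)) = (\<integral>\<^sup>+t. f t \<partial>lborel) * (\<integral>\<^sup>+t. f (t::real) \<partial>lborel)"
proof -
  have B: "(\<Prod>b\<in>(Basis :: (real^2) set). F b) = F (axis 1 1) * F (axis 2 1)" for F :: "real^2 \<Rightarrow> ennreal"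
  proof -
    have B: "(Basis :: (real^2) set) = {axis 1 1, axis 2 1}" 
      by (simp add: Basis_vec_def UNIV_2 insert_commute)
    have ne: "(axis 1 1 :: real^2) \<noteq> axis 2 1" by (simp add: axis_eq_axis)
    have "prod F {axis 1 1, axis 2 1} = F (axis 1 1) * F (axis 2 1)" using ne by simp
    then show ?thesis unfolding B .
  qed
  have "(\<integral>\<^sup>+x. (\<Prod>b\<in>Basis. f ((x::real^2) \<bullet> b)) \<partial>lborel) = (\<Prod>b\<in>(Basis :: (real^2) set). (\<integral>\<^sup>+x. f x \<partial>lborel))"
    by (rule nn_integral_lborel_prod) auto
  then show ?thesis unfolding B by (simp add: inner_axis)
qed

lemma AE_nth_nonzero: "AE x in (lborel :: (real^2) measure). x $ 1 \<noteq> 0 \<and> x $ 2 \<noteq> 0"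
proof -
  have "AE x in lborel. (x::real^2) $ i \<noteq> 0" for i
  proof -
    have "negligible {x::real^2. axis i 1 \<bullet> x = 0}" by (rule negligible_hyperplane) (simp add: axis_eq_0_iff)
    then have "{x::real^2. x $ i = 0} \<in> null_sets lebesgue" by (simp add: inner_axis' negligible_iff_null_sets)
    moreover have "{x::real^2. x $ i = 0} \<in> sets lborel" by measurable
    ultimately have "{x::real^2. x $ i = 0} \<in> null_sets lborel" using null_sets_completion_iff by blast
    from AE_not_in[OF this] show ?thesis by simp
  qed
  then show ?thesis by simp
qed

locale biot_savart =
  fixes K :: "real^2 \<Rightarrow> real^2"
  assumes kernel: "biot_savart_kernel K"
begin

lemma periodic: "torus_periodic K"
  using kernel by (simp add: biot_savart_kernel_def)

lemma decomposition:
  obtains K0 where "continuous_on UNIV K0"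
    "\<And>x. x \<in> torus_cell \<Longrightarrow> x \<noteq> 0 \<Longrightarrow> K x = (1 / (2 * pi * (norm x)\<^sup>2)) *\<^sub>R vector [- (x $ 2), x $ 1] + K0 x"
proof -
  obtain K0 where K0: "\<forall>k. Ck k K0" "\<forall>x\<in>torus_cell - {0}. K x = (1 / (2 * pi * (norm x)\<^sup>2)) *\<^sub>R vector [- (x $ 2), x $ 1] + K0 x"
    using kernel unfolding biot_savart_kernel_def by blast
  have "continuous_on UNIV K0" using Ck_continuous[of 0 K0 "[]"] K0(1) by simp
  then show ?thesis using that K0(2) by blast
qed

text \<open>On each tile the kernel is an explicit measurable function shifted by a lattice vector, and there are countably
many tiles.\<close>

lemma measurable_kernel [measurable]: "K \<in> borel_measurable borel"
proof -
  obtain K0 where K0: "continuous_on UNIV K0"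
    "\<And>x. x \<in> torus_cell \<Longrightarrow> x \<noteq> 0 \<Longrightarrow> K x = (1 / (2 * pi * (norm x)\<^sup>2)) *\<^sub>R vector [- (x $ 2), x $ 1] + K0 x"
    using decomposition by blast
  have [measurable]: "K0 \<in> borel_measurable borel" using K0(1) by (rule borel_measurable_continuous_onI)
  have lin: "continuous_on UNIV (\<lambda>x::real^2. vector [- (x $ 2), x $ 1] :: real^2)"
  proof (rule continuous_on_vec_lambda[of UNIV "\<lambda>i x. if i = 1 then - (x $ 2) else x $ 1", THEN continuous_on_eq])
    show "continuous_on UNIV (\<lambda>x::real^2. if i = 1 then - (x $ 2) else x $ 1)" for i :: 2
      by (cases "i = 1") (auto intro!: continuous_intros)
  qed (simp add: vec_eq_iff forall_2)
  have [measurable]: "(\<lambda>x::real^2. vector [- (x $ 2), x $ 1] :: real^2) \<in> borel_measurable borel"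
    using lin by (rule borel_measurable_continuous_onI)
  define K1 where "K1 x = (if x = 0 then K 0 else (1 / (2 * pi * (norm x)\<^sup>2)) *\<^sub>R vector [- (x $ 2), x $ 1] + K0 x)" for x
  have [measurable]: "K1 \<in> borel_measurable borel" unfolding K1_def by measurable
  have K1: "K x = K1 x" if "x \<in> torus_cell" for x using K0(2)[OF that] by (simp add: K1_def)
  let ?C = "range (\<lambda>k. {x. x - lattice_vec k \<in> half_open_cell})"
  have S: "{x. x - lattice_vec k \<in> half_open_cell} \<in> sets borel" for k
  proof -
    have "(\<lambda>x. x - lattice_vec k) -` half_open_cell \<inter> space borel \<in> sets borel" by measurable
    then show ?thesis by (simp add: vimage_def)
  qed
  show ?thesis
  proof (rule measurable_piecewise_restrict[of ?C])
    show "countable ?C" by simp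
    show "\<Omega> \<inter> space borel \<in> sets borel" if "\<Omega> \<in> ?C" for \<Omega> using that S by auto
    show "space borel \<subseteq> \<Union> ?C" using half_open_cell_tiling by blast
    fix \<Omega> assume "\<Omega> \<in> ?C"
    then obtain k where k: "\<Omega> = {x. x - lattice_vec k \<in> half_open_cell}" by blast
    have "K x = K1 (x - lattice_vec k)" if "x \<in> \<Omega>" for x
      using torus_periodic_lattice[OF periodic, of "x - lattice_vec k" k] K1 that half_open_cell_subset by (auto simp: k)
    moreover have "(\<lambda>x. K1 (x - lattice_vec k)) \<in> borel_measurable (restrict_space borel \<Omega>)"
      by (intro measurable_restrict_space1) measurable
    ultimately show "K \<in> borel_measurable (restrict_space borel \<Omega>)"
      by (subst measurable_cong[of _ _ "\<lambda>x. K1 (x - lattice_vec k)"]) (auto simp: space_restrict_space)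
  qed
qed

text \<open>The singularity is integrable since \<open>1 / |x|\<close> is at most \<open>1 / (sqrt |x\<^sub>1| sqrt |x\<^sub>2|)\<close>, a product of
integrable functions of one variable.\<close>

lemma integrable_kernel: "set_integrable lborel torus_cell K"
proof -
  obtain K0 where K0: "continuous_on UNIV K0"
    "\<And>x. x \<in> torus_cell \<Longrightarrow> x \<noteq> 0 \<Longrightarrow> K x = (1 / (2 * pi * (norm x)\<^sup>2)) *\<^sub>R vector [- (x $ 2), x $ 1] + K0 x"
    using decomposition by blast
  have [measurable]: "K0 \<in> borel_measurable borel" using K0(1) by (rule borel_measurable_continuous_onI)
  define h where "h t = ennreal (1 / sqrt \<bar>t\<bar>) * indicator {-pi..pi} t" for t :: real
  have [measurable]: "h \<in> borel_measurable borel" unfolding h_def by measurable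
  have "AE x in lborel. ennreal (norm (K x)) * indicator torus_cell x \<le> h (x $ 1) * h (x $ 2) + ennreal (norm (K0 x)) * indicator torus_cell x"
    using AE_nth_nonzero
  proof eventually_elim
    fix x :: "real^2" assume x: "x $ 1 \<noteq> 0 \<and> x $ 2 \<noteq> 0"
    show "ennreal (norm (K x)) * indicator torus_cell x \<le> h (x $ 1) * h (x $ 2) + ennreal (norm (K0 x)) * indicator torus_cell x"
    proof (cases "x \<in> torus_cell")
      case True
      have n2: "(norm x)\<^sup>2 = (x $ 1)\<^sup>2 + (x $ 2)\<^sup>2"
        by (simp add: norm_eq_sqrt_inner inner_vec_def sum_2 power2_eq_square)
      have nv: "norm (vector [- (x $ 2), x $ 1] :: real^2) = norm x"
        by (simp add: norm_eq_sqrt_inner inner_vec_def sum_2 add.commute)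
      have x0: "x \<noteq> 0" using x by auto
      have "norm (K x) \<le> norm ((1 / (2 * pi * (norm x)\<^sup>2)) *\<^sub>R (vector [- (x $ 2), x $ 1] :: real^2)) + norm (K0 x)"
        unfolding K0(2)[OF True x0] by (rule norm_triangle_ineq)
      also have "norm ((1 / (2 * pi * (norm x)\<^sup>2)) *\<^sub>R (vector [- (x $ 2), x $ 1] :: real^2)) = 1 / (2 * pi * norm x)"
        using x0 by (simp add: nv power2_eq_square)
      also have "1 / (2 * pi * norm x) \<le> 1 / norm x"
      proof (rule divide_left_mono)
        show "norm x \<le> 2 * pi * norm x" using mult_right_mono[of 1 "2 * pi" "norm x"] pi_gt3 by simp
      qed (use x0 in auto)
      \<comment> \<open>The geometric mean of the coordinates is at most the norm.\<close>
      also have "1 / norm x \<le> 1 / (sqrt \<bar>x $ 1\<bar> * sqrt \<bar>x $ 2\<bar>)"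
      proof (rule divide_left_mono)
        have "\<bar>x $ 1\<bar> * \<bar>x $ 2\<bar> \<le> (norm x)\<^sup>2"
        proof -
          have "0 \<le> (\<bar>x $ 1\<bar> - \<bar>x $ 2\<bar>)\<^sup>2 + \<bar>x $ 1\<bar>\<^sup>2 + \<bar>x $ 2\<bar>\<^sup>2" by simp
          then show ?thesis unfolding n2 by (simp add: power2_eq_square algebra_simps)
        qed
        then show "sqrt \<bar>x $ 1\<bar> * sqrt \<bar>x $ 2\<bar> \<le> norm x"
          by (metis real_sqrt_mult real_sqrt_le_mono real_sqrt_abs abs_norm_cancel)
      qed (use x x0 in auto)
      finally have "norm (K x) \<le> 1 / sqrt \<bar>x $ 1\<bar> * (1 / sqrt \<bar>x $ 2\<bar>) + norm (K0 x)" by simp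
      then have "ennreal (norm (K x)) \<le> ennreal (1 / sqrt \<bar>x $ 1\<bar>) * ennreal (1 / sqrt \<bar>x $ 2\<bar>) + ennreal (norm (K0 x))"
        by (simp add: ennreal_mult[symmetric] ennreal_plus[symmetric] del: ennreal_plus)
      moreover have "x $ i \<in> {-pi..pi}" for i using True by (auto simp: torus_cell_def mem_box_cart)
      ultimately show ?thesis using True by (simp add: h_def indicator_def)
    qed simp
  qed
  then have "(\<integral>\<^sup>+x. ennreal (norm (K x)) * indicator torus_cell x \<partial>lborel) \<le> (\<integral>\<^sup>+x. h (x $ 1) * h (x $ 2) + ennreal (norm (K0 x)) * indicator torus_cell x \<partial>lborel)"
    by (rule nn_integral_mono_AE)
  also have "\<dots> = (\<integral>\<^sup>+x. h (x $ 1) * h (x $ 2) \<partial>(lborel :: (real^2) measure)) + (\<integral>\<^sup>+x. ennreal (norm (K0 x)) * indicator torus_cell x \<partial>lborel)"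
    by (rule nn_integral_add) measurable
  also have "\<dots> < \<infinity>"
    using inverse_sqrt_integrable set_integrable_cell_continuous[OF K0(1)]
    by (simp add: nn_integral_lborel_prod2 set_integrable_cell_iff h_def[symmetric] ennreal_mult_less_top)
  finally show ?thesis by (simp add: set_integrable_cell_iff)
qed

definition kernel_mass :: real where
  "kernel_mass = (LINT y:torus_cell|lborel. norm (K y))"

lemma norm_kernel: "set_integrable lborel torus_cell (\<lambda>y. norm (K y))"
  using integrable_kernel by (simp add: set_integrable_cell_iff)

lemma kernel_mass_nonneg: "kernel_mass \<ge> 0"
  unfolding kernel_mass_def set_lebesgue_integral_def by (intro Bochner_Integration.integral_nonneg) simp

lemma kernel_mass_reflect: "(LINT y:torus_cell|lborel. norm (K (x - y))) = kernel_mass"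
  unfolding kernel_mass_def 
  using integral_cell_reflect_real[of "\<lambda>y. norm (K y)" x] torus_periodic_comp[OF periodic, of norm] norm_kernel by simp

lemma conv_integrable:
  assumes [measurable]: "w \<in> borel_measurable borel" and B: "\<And>y. \<bar>w y\<bar> \<le> B"
  shows "set_integrable lborel torus_cell (\<lambda>y. w y *\<^sub>R K (x - y))"
proof -
  have "set_integrable lborel torus_cell (\<lambda>y. B *\<^sub>R K (x - y))"
    using set_integrable_cell_reflect[OF measurable_kernel periodic integrable_kernel] by simp
  then show ?thesis unfolding set_integrable_def
  proof (rule Bochner_Integration.integrable_bound)
    show "AE y in lborel. norm (indicat_real torus_cell y *\<^sub>R w y *\<^sub>R K (x - y)) \<le> norm (indicat_real torus_cell y *\<^sub>R B *\<^sub>R K (x - y))"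
      using B by (intro AE_I2) (auto simp: indicator_def intro!: mult_right_mono order_trans[OF B abs_ge_self])
  qed measurable
qed

lemma conv_bound:
  assumes m: "w \<in> borel_measurable borel" and B: "\<And>y. \<bar>w y\<bar> \<le> B"
  shows "norm (torus_conv K w x) \<le> B * kernel_mass"
proof -
  have 1: "set_integrable lborel torus_cell (\<lambda>y. B * norm (K (x - y)))"
    using set_integrable_cell_reflect[of "\<lambda>y. norm (K y)" x] torus_periodic_comp[OF periodic, of norm] norm_kernel by simp
  have "norm (torus_conv K w x) \<le> (LINT y:torus_cell|lborel. norm (w y *\<^sub>R K (x - y)))"
    unfolding torus_conv_def by (rule set_integral_norm_bound[OF conv_integrable[OF assms]])
  also have "\<dots> \<le> (LINT y:torus_cell|lborel. B * norm (K (x - y)))"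
    by (rule set_integral_mono[OF set_integrable_norm[OF conv_integrable[OF assms]] 1]) (auto intro!: mult_right_mono B)
  also have "\<dots> = B * kernel_mass" by (simp add: kernel_mass_reflect)
  finally show ?thesis .
qed

lemma conv_diff:
  assumes "w \<in> borel_measurable borel" "\<And>y. \<bar>w y\<bar> \<le> B" "v \<in> borel_measurable borel" "\<And>y. \<bar>v y\<bar> \<le> B'"
  shows "torus_conv K w x - torus_conv K v x = torus_conv K (\<lambda>y. w y - v y) x"
  unfolding torus_conv_def
  by (subst set_integral_diff(2)[symmetric]) (auto intro!: conv_integrable assms simp: algebra_simps)

lemma conv_diff_bound:
  assumes "w \<in> borel_measurable borel" "\<And>y. \<bar>w y\<bar> \<le> B" "v \<in> borel_measurable borel" "\<And>y. \<bar>v y\<bar> \<le> B'"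
    and "\<And>y. \<bar>w y - v y\<bar> \<le> c"
  shows "norm (torus_conv K w x - torus_conv K v x) \<le> c * kernel_mass"
  unfolding conv_diff[OF assms(1-4)] using assms by (intro conv_bound) auto

text \<open>Moving the shift from the kernel to the density trades regularity of the kernel for regularity of the density.\<close>

lemma conv_translate:
  assumes [measurable]: "w \<in> borel_measurable borel" and "\<And>y. \<bar>w y\<bar> \<le> B" and per: "torus_periodic w"
  shows "torus_conv K w (x + a) = torus_conv K (\<lambda>y. w (y + a)) x"
proof -
  have "torus_conv K w (x + a) = (LINT y:torus_cell|lborel. (\<lambda>y. w y *\<^sub>R K (x + a - y)) (y + a))"
    unfolding torus_conv_def
    by (rule integral_cell_translate[symmetric])
       (auto intro!: conv_integrable assms torus_periodic_comp2[OF per torus_periodic_reflect[OF periodic]])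
  then show ?thesis by (simp add: torus_conv_def)
qed

text \<open>The kernel itself is unbounded, but the shift can be put on the Lipschitz density.\<close>

lemma conv_lipschitz:
  assumes m: "w \<in> borel_measurable borel" and b: "\<And>y. \<bar>w y\<bar> \<le> B" and per: "torus_periodic w"
    and L: "\<And>y a. \<bar>w (y + a) - w y\<bar> \<le> L * norm a"
  shows "norm (torus_conv K w x - torus_conv K w y) \<le> L * kernel_mass * norm (x - y)"
proof -
  have "(\<lambda>z. w (z + (x - y))) \<in> borel_measurable borel" using m by measurable
  then have "norm (torus_conv K (\<lambda>z. w (z + (x - y))) y - torus_conv K w y) \<le> (L * norm (x - y)) * kernel_mass"
    by (rule conv_diff_bound[where B=B and B'=B]) (auto intro: m b L)
  then show ?thesis using conv_translate[OF m b per, of y "x - y"] by (simp add: algebra_simps)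
qed

lemma representation:
  assumes "Ck_torus 1 v" "\<And>x. divergence v x = 0" "(LINT x:torus_cell|lborel. v x) = 0"
  shows "v x = torus_conv K (curl v) x"
  using kernel assms unfolding biot_savart_kernel_def by blast

end

section \<open>The vorticity equation\<close>


lemma Ck_commute:
  fixes f :: "real^2 \<Rightarrow> real"
  assumes "Ck k f" "length ds + 2 \<le> k"
  shows "partials (i # j # ds) f = partials (j # i # ds) f"
proof (rule mixed_partials_commute)
  have h: "has_partial l (partials es f) (partials (l # es) f)" if "length es \<le> length ds + 1" for l es
    by (rule Ck_has_partial[OF assms(1)]) (use assms(2) that in linarith)
  show "has_partial j (partials ds f) (partials (j # ds) f)" "has_partial i (partials ds f) (partials (i # ds) f)"
    "has_partial i (partials (j # ds) f) (partials (i # j # ds) f)" "has_partial j (partials (i # ds) f) (partials (j # i # ds) f)"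
    by (rule h, simp)+
  show "continuous_on UNIV (partials (i # j # ds) f)" "continuous_on UNIV (partials (j # i # ds) f)"
    by (rule Ck_continuous[OF assms(1)], use assms(2) in simp)+
qed

locale navier_stokes =
  fixes T \<nu> :: real and \<phi> :: "real^2 \<Rightarrow> real^2" and u :: "real \<Rightarrow> real^2 \<Rightarrow> real^2"
  assumes T: "T > 0" and ns: "backward_navier_stokes \<nu> T \<phi> u"
begin

text \<open>An iterated partial derivative of a velocity component; a constant keeps the list of directions folded under
simplification.\<close>

definition velocity_partial :: "2 list \<Rightarrow> 2 \<Rightarrow> real \<Rightarrow> real^2 \<Rightarrow> real" where
  "velocity_partial ds j s = partials ds (\<lambda>x. u s x $ j)"

lemma velocity_C5: "C_time_Ck_torus T 5 u" and div0: "s \<in> {0..T} \<Longrightarrow> divergence (u s) x = 0" and final: "u T = \<phi>"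
  using ns by (auto simp: backward_navier_stokes_def)

lemma component_C5: "C_time_Ck_torus T 5 (\<lambda>s x. u s x $ j)"
  by (rule C_time_nth[OF velocity_C5])

lemma velocity_partial_jc: "length ds \<le> 5 \<Longrightarrow> jointly_continuous T (velocity_partial ds j)"
  unfolding velocity_partial_def by (rule C_time_jointly_continuous[OF component_C5])

lemma velocity_partial_partial: "length ds \<le> 4 \<Longrightarrow> s \<in> {0..T} \<Longrightarrow> has_partial i (velocity_partial ds j s) (velocity_partial (i # ds) j s)"
  unfolding velocity_partial_def by (rule Ck_has_partial[OF C_time_Ck[OF component_C5]]) auto

lemma velocity_partial_periodic: "s \<in> {0..T} \<Longrightarrow> torus_periodic (velocity_partial ds j s)"
  unfolding velocity_partial_def by (rule torus_periodic_partials[OF C_time_periodic[OF component_C5]])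

lemma velocity_partial_commute: "length ds \<le> 3 \<Longrightarrow> s \<in> {0..T} \<Longrightarrow> velocity_partial (i # k # ds) j s = velocity_partial (k # i # ds) j s"
  unfolding velocity_partial_def by (rule Ck_commute[OF C_time_Ck[OF component_C5]]) auto

lemma velocity_partial_Cons: "length ds \<le> 4 \<Longrightarrow> s \<in> {0..T} \<Longrightarrow> partial i (velocity_partial ds j s) = velocity_partial (i # ds) j s"
  by (rule has_partial_imp_partial[OF velocity_partial_partial])

lemma velocity_partial_Nil: "velocity_partial [] j s x = u s x $ j"
  by (simp add: velocity_partial_def)

lemma velocity_partial_nth: "length ds \<le> 5 \<Longrightarrow> s \<in> {0..T} \<Longrightarrow> partials ds (u s) x $ j = velocity_partial ds j s x"
  unfolding velocity_partial_def by (subst partials_nth[OF C_time_Ck[OF velocity_C5]]) auto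

lemma divergence_zero: "s \<in> {0..T} \<Longrightarrow> velocity_partial [1] 1 s x + velocity_partial [2] 2 s x = 0"
  using div0[of s x] velocity_partial_nth[of "[1]" s x 1] velocity_partial_nth[of "[2]" s x 2] by (simp add: divergence_def sum_2)

text \<open>Everything in the momentum equation except the time derivative and the pressure gradient.\<close>

definition force :: "2 \<Rightarrow> real \<Rightarrow> real^2 \<Rightarrow> real" where
  "force j s x = \<nu> * (velocity_partial [1,1] j s x + velocity_partial [2,2] j s x) + (velocity_partial [] 1 s x * velocity_partial [1] j s x + velocity_partial [] 2 s x * velocity_partial [2] j s x)"

text \<open>The partial derivative of the force, in the form produced by the product rule.\<close>

definition force' :: "2 \<Rightarrow> 2 \<Rightarrow> real \<Rightarrow> real^2 \<Rightarrow> real" where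
  "force' i j s x = \<nu> * (velocity_partial [i,1,1] j s x + velocity_partial [i,2,2] j s x) 
     + ((velocity_partial [i] 1 s x * velocity_partial [1] j s x + velocity_partial [] 1 s x * velocity_partial [i,1] j s x) + (velocity_partial [i] 2 s x * velocity_partial [2] j s x + velocity_partial [] 2 s x * velocity_partial [i,2] j s x))"

lemma force_partial: "s \<in> {0..T} \<Longrightarrow> has_partial i (force j s) (force' i j s)"
  unfolding force_def force'_def
  by (intro has_partial_add has_partial_cmult has_partial_mult velocity_partial_partial) auto

lemma force_jc: "jointly_continuous T (force j)"
  unfolding force_def
  by (intro jointly_continuous_add jointly_continuous_cmult jointly_continuous_mult velocity_partial_jc) auto

lemma force'_jc: "jointly_continuous T (force' i j)"
  unfolding force'_def
  by (intro jointly_continuous_add jointly_continuous_cmult jointly_continuous_mult velocity_partial_jc) auto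

text \<open>The time-integrated momentum equation. The pressure is only once differentiable, but its time integral \<open>P\<close> has
as gradient a combination of differentiable functions, so \<open>P\<close> is twice continuously differentiable.\<close>

lemma momentum:
  assumes st: "0 \<le> s" "s \<le> t" "t \<le> T"
  obtains P where "\<And>j. has_partial j P (\<lambda>x. - (velocity_partial [] j t x - velocity_partial [] j s x + integral {s..t} (\<lambda>r. force j r x)))"
    "continuous_on UNIV P" "torus_periodic P"
proof -
  obtain p u' where p: "C_time_Ck_torus T 1 p"
    and d: "\<And>s x. s \<in> {0..T} \<Longrightarrow> ((\<lambda>r. u r x) has_vector_derivative u' s x) (at s within {0..T})"
    and e: "\<And>s x. s \<in> {0..T} \<Longrightarrow> u' s x + \<nu> *\<^sub>R laplacian (u s) x + advection (u s) (u s) x + gradient (p s) x = 0"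
    using ns unfolding backward_navier_stokes_def by blast
  have jp: "jointly_continuous T p" using C_time_jointly_continuous[OF p, of "[]"] by simp
  have jdp: "jointly_continuous T (\<lambda>s. partial j (p s))" for j using C_time_jointly_continuous[OF p, of "[j]"] by simp
  have dp: "has_partial j (p s) (partial j (p s))" if "s \<in> {0..T}" for j s
    using Ck_has_partial[OF C_time_Ck[OF p that], of "[]" j] by simp
  define P where "P x = integral {s..t} (\<lambda>r. p r x)" for x
  have dP: "has_partial j P (\<lambda>x. integral {s..t} (\<lambda>r. partial j (p r) x))" for j
    unfolding P_def using partial_time_integral[OF jp jdp dp st] by simp
  have u'j: "u' r x $ j = - (force j r x + partial j (p r) x)" if r: "r \<in> {0..T}" for r x j
  proof -
    have "(u' r x + \<nu> *\<^sub>R laplacian (u r) x + advection (u r) (u r) x + gradient (p r) x) $ j = 0"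
      using e[OF r] by simp
    then show ?thesis
      using velocity_partial_nth[of "[1,1]" r x j] velocity_partial_nth[of "[2,2]" r x j] velocity_partial_nth[of "[1]" r x j] velocity_partial_nth[of "[2]" r x j] r
      by (simp add: laplacian_def advection_def gradient_def sum_2 force_def velocity_partial_Nil del: sum_eq_0_iff)
  qed
  have V: "integral {s..t} (\<lambda>r. partial j (p r) x) = - (velocity_partial [] j t x - velocity_partial [] j s x + integral {s..t} (\<lambda>r. force j r x))" for j x
  proof -
    have "((\<lambda>r. - (force j r x + partial j (p r) x)) has_integral (u t x $ j - u s x $ j)) {s..t}"
    proof (rule fundamental_theorem_of_calculus[OF st(2)])
      fix r assume "r \<in> {s..t}"
      then have r: "r \<in> {0..T}" using st by auto
      have "((\<lambda>r. u r x $ j) has_vector_derivative u' r x $ j) (at r within {0..T})"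
        by (rule bounded_linear.has_vector_derivative[OF bounded_linear_vec_nth d[OF r]])
      then show "((\<lambda>r. u r x $ j) has_vector_derivative - (force j r x + partial j (p r) x)) (at r within {s..t})"
        unfolding u'j[OF r] by (rule has_vector_derivative_within_subset) (use st in auto)
    qed
    then have "integral {s..t} (\<lambda>r. - (force j r x + partial j (p r) x)) = u t x $ j - u s x $ j" by (rule integral_unique)
    moreover have "(\<lambda>r. force j r x) integrable_on {s..t}" "(\<lambda>r. partial j (p r) x) integrable_on {s..t}"
      using st by (auto intro!: integrable_continuous_interval continuous_on_subset[OF jointly_continuous_time[OF force_jc]] 
           continuous_on_subset[OF jointly_continuous_time[OF jdp]])
    then have "integral {s..t} (\<lambda>r. - (force j r x + partial j (p r) x)) = 
        - (integral {s..t} (\<lambda>r. force j r x) + integral {s..t} (\<lambda>r. partial j (p r) x))"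
      by (simp only: integral_neg integral_add)
    ultimately show ?thesis by (simp add: velocity_partial_Nil)
  qed
  show ?thesis
  proof (rule that)
    show "has_partial j P (\<lambda>x. - (velocity_partial [] j t x - velocity_partial [] j s x + integral {s..t} (\<lambda>r. force j r x)))" for j
      using dP[of j] unfolding V .
    show "continuous_on UNIV P" unfolding P_def by (rule continuous_time_integral[OF jp]) (use st in auto)
    have "integral {s..t} (\<lambda>r. p r (x + (2*pi) *\<^sub>R axis i 1)) = integral {s..t} (\<lambda>r. p r x)" for x i
      using C_time_periodic[OF p] st by (intro integral_cong) (auto simp: torus_periodic_def)
    then show "torus_periodic P" by (simp add: torus_periodic_def P_def)
  qed
qed

text \<open>The curl in terms of derivatives of components, to which the calculus of iterated partial derivatives applies.\<close>

definition vort :: "real \<Rightarrow> real^2 \<Rightarrow> real" where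
  "vort s x = velocity_partial [1] 2 s x - velocity_partial [2] 1 s x"

lemma curl_eq_vort: "s \<in> {0..T} \<Longrightarrow> curl (u s) = vort s"
  using velocity_partial_nth[of "[1]" s _ 2] velocity_partial_nth[of "[2]" s _ 1] by (simp add: curl_def vort_def fun_eq_iff)

lemma vort_C4: "C_time_Ck_torus T 4 vort"
proof -
  have "C_time_Ck_torus T 4 (\<lambda>s. velocity_partial [i] j s)" for i j
    using C_time_partial[of T 4 "\<lambda>s x. u s x $ j" i] component_C5[of j] by (simp add: velocity_partial_def)
  from C_time_diff[OF this this] show ?thesis by (simp add: vort_def[abs_def])
qed

lemma vort_partials:
  assumes s: "s \<in> {0..T}" and l: "length ds \<le> 4"
  shows "partials ds (vort s) x = velocity_partial (ds @ [1]) 2 s x - velocity_partial (ds @ [2]) 1 s x"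
proof -
  have "Ck 4 (velocity_partial [i] j s)" for i j
    unfolding velocity_partial_def using Ck_partial[of 4 "\<lambda>x. u s x $ j" i] C_time_Ck[OF component_C5[of j] s] by simp
  from partials_diff[OF this this l] show ?thesis
    by (simp add: vort_def[abs_def] velocity_partial_def)
qed

text \<open>Minus the time derivative of the vorticity.\<close>

definition drift :: "real \<Rightarrow> real^2 \<Rightarrow> real" where
  "drift s x = \<nu> * (partials [1,1] (vort s) x + partials [2,2] (vort s) x)
     + (u s x $ 1 * partials [1] (vort s) x + u s x $ 2 * partials [2] (vort s) x)"

text \<open>The stretching terms cancel against the divergence, as always in two dimensions.\<close>

lemma curl_force:
  assumes s: "s \<in> {0..T}"
  shows "force' 1 2 s x - force' 2 1 s x = drift s x"
proof -
  have c1: "velocity_partial [1,2,2] 2 s x = velocity_partial [2,2,1] 2 s x"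
    using velocity_partial_commute[of "[2]" s 1 2 2] velocity_partial_commute[of "[]" s 1 2 2] velocity_partial_Cons[of "[1,2]" s 2 2] velocity_partial_Cons[of "[2,1]" s 2 2] s by simp
  have c2: "velocity_partial [2,1,1] 1 s x = velocity_partial [1,1,2] 1 s x"
    using velocity_partial_commute[of "[1]" s 2 1 1] velocity_partial_commute[of "[]" s 2 1 1] velocity_partial_Cons[of "[2,1]" s 1 1] velocity_partial_Cons[of "[1,2]" s 1 1] s by simp
  have c3: "velocity_partial [2,1] j s x = velocity_partial [1,2] j s x" for j
    using velocity_partial_commute[of "[]" s 2 1 j] s by simp
  have d: "velocity_partial [1] 1 s x = - velocity_partial [2] 2 s x" using divergence_zero[OF s, of x] by simp
  have "drift s x = \<nu> * (velocity_partial [1,1,1] 2 s x - velocity_partial [1,1,2] 1 s x + (velocity_partial [2,2,1] 2 s x - velocity_partial [2,2,2] 1 s x))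
     + (velocity_partial [] 1 s x * (velocity_partial [1,1] 2 s x - velocity_partial [1,2] 1 s x) + velocity_partial [] 2 s x * (velocity_partial [2,1] 2 s x - velocity_partial [2,2] 1 s x))"
    unfolding drift_def velocity_partial_Nil using s by (subst vort_partials, simp, simp)+ simp
  then show ?thesis unfolding force'_def c1 c2 c3 d by (simp add: algebra_simps)
qed

text \<open>The pressure disappears because the gradient of its time integral has symmetric derivatives.\<close>

lemma vorticity_equation:
  assumes st: "0 \<le> s" "s \<le> t" "t \<le> T"
  shows "vort t x - vort s x = - integral {s..t} (\<lambda>r. drift r x)"
proof -
  have sT: "s \<in> {0..T}" and tT: "t \<in> {0..T}" using st by auto
  obtain P where P: "\<And>j. has_partial j P (\<lambda>x. - (velocity_partial [] j t x - velocity_partial [] j s x + integral {s..t} (\<lambda>r. force j r x)))"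
    using momentum[OF st] by metis
  define V' where "V' i j x = - (velocity_partial [i] j t x - velocity_partial [i] j s x + integral {s..t} (\<lambda>r. force' i j r x))" for i j x
  have V': "has_partial i (\<lambda>x. - (velocity_partial [] j t x - velocity_partial [] j s x + integral {s..t} (\<lambda>r. force j r x))) (V' i j)" for i j
    unfolding V'_def
    by (intro has_partial_minus has_partial_add has_partial_diff velocity_partial_partial sT tT partial_time_integral[OF force_jc force'_jc force_partial] st) auto
  have cV': "continuous_on UNIV (V' i j)" for i j
    unfolding V'_def
    by (intro continuous_intros continuous_time_integral[OF force'_jc] jointly_continuous_space[OF velocity_partial_jc] sT tT st) auto
  have "V' 2 1 = V' 1 2"
    by (rule mixed_partials_commute[OF P V' P V' cV' cV'])
  then have "V' 2 1 x = V' 1 2 x" by simp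
  moreover have int: "(\<lambda>r. force' i j r x) integrable_on {s..t}" for i j
    using st by (auto intro!: integrable_continuous_interval continuous_on_subset[OF jointly_continuous_time[OF force'_jc]])
  have "integral {s..t} (\<lambda>r. drift r x) = integral {s..t} (\<lambda>r. force' 1 2 r x - force' 2 1 r x)"
    using st by (intro integral_cong) (auto simp: curl_force)
  then have "integral {s..t} (\<lambda>r. drift r x) = integral {s..t} (\<lambda>r. force' 1 2 r x) - integral {s..t} (\<lambda>r. force' 2 1 r x)"
    by (simp add: integral_diff int)
  ultimately show ?thesis by (simp add: V'_def vort_def)
qed

text \<open>Momentum is conserved: by incompressibility the force is a divergence of a periodic field, and the pressure
enters through a gradient. Both have integral zero over the cell.\<close>

lemma mean_zero:
  assumes m: "(LINT x:torus_cell|lborel. \<phi> x) = 0" and s: "s \<in> {0..T}"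
  shows "(LINT x:torus_cell|lborel. u s x) = 0"
proof -
  have st: "0 \<le> s" "s \<le> T" "T \<le> T" and TT: "T \<in> {0..T}" using s by auto
  have c: "continuous_on UNIV (velocity_partial ds j r)" if "length ds \<le> 5" "r \<in> {0..T}" for ds j r
    by (rule jointly_continuous_space[OF velocity_partial_jc[OF that(1)] that(2)])
  have cu: "continuous_on UNIV (u r)" if "r \<in> {0..T}" for r
    using Ck_continuous[OF C_time_Ck[OF velocity_C5 that], of "[]"] by simp
  obtain P where P: "\<And>j. has_partial j P (\<lambda>x. - (velocity_partial [] j T x - velocity_partial [] j s x + integral {s..T} (\<lambda>r. force j r x)))"
     "continuous_on UNIV P" "torus_periodic P"
    by (rule momentum[OF st]) (rule that)
  have "(LINT x:torus_cell|lborel. velocity_partial [] j s x) = (LINT x:torus_cell|lborel. velocity_partial [] j T x)" for j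
  proof -
    \<comment> \<open>The flux whose divergence is the force.\<close>
    define q where "q i r x = \<nu> * velocity_partial [i] j r x + velocity_partial [] i r x * velocity_partial [] j r x" for i r x
    define q' where "q' i r x = \<nu> * velocity_partial [i,i] j r x + (velocity_partial [i] i r x * velocity_partial [] j r x + velocity_partial [] i r x * velocity_partial [i] j r x)" for i r x
    have q: "jointly_continuous T (q i)" for i unfolding q_def
      by (intro jointly_continuous_add jointly_continuous_cmult jointly_continuous_mult velocity_partial_jc) auto
    have q': "jointly_continuous T (q' i)" for i unfolding q'_def
      by (intro jointly_continuous_add jointly_continuous_cmult jointly_continuous_mult velocity_partial_jc) auto
    have dq: "has_partial i (q i r) (q' i r)" if "r \<in> {0..T}" for i r
      unfolding q_def q'_def using that
      by (intro has_partial_add has_partial_cmult has_partial_mult velocity_partial_partial) auto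
    have Q0: "(LINT x:torus_cell|lborel. integral {s..T} (\<lambda>r. q' i r x)) = 0" for i
    proof (rule integral_cell_partial)
      show "has_partial i (\<lambda>x. integral {s..T} (\<lambda>r. q i r x)) (\<lambda>x. integral {s..T} (\<lambda>r. q' i r x))"
        by (rule partial_time_integral[OF q q' dq st])
      show "continuous_on UNIV (\<lambda>x. integral {s..T} (\<lambda>r. q i r x))" "continuous_on UNIV (\<lambda>x. integral {s..T} (\<lambda>r. q' i r x))"
        using continuous_time_integral[OF q] continuous_time_integral[OF q'] st by auto
      have "integral {s..T} (\<lambda>r. q i r (x + (2*pi) *\<^sub>R axis k 1)) = integral {s..T} (\<lambda>r. q i r x)" for x k
        using velocity_partial_periodic st by (intro integral_cong) (auto simp: q_def torus_periodic_def)
      then show "torus_periodic (\<lambda>x. integral {s..T} (\<lambda>r. q i r x))" by (simp add: torus_periodic_def)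
    qed
    have iq: "(\<lambda>r. q' i r x) integrable_on {s..T}" for i x
      using st by (auto intro!: integrable_continuous_interval continuous_on_subset[OF jointly_continuous_time[OF q']])
    have f: "integral {s..T} (\<lambda>r. force j r x) = integral {s..T} (\<lambda>r. q' 1 r x) + integral {s..T} (\<lambda>r. q' 2 r x)" for x
    proof -
      have "integral {s..T} (\<lambda>r. force j r x) = integral {s..T} (\<lambda>r. q' 1 r x + q' 2 r x)"
      proof (rule integral_cong)
        fix r assume "r \<in> {s..T}"
        then have "r \<in> {0..T}" using st by auto
        from divergence_zero[OF this, of x] have d: "velocity_partial [1] 1 r x = - velocity_partial [2] 2 r x" by simp
        show "force j r x = q' 1 r x + q' 2 r x"
          unfolding force_def q'_def d by (simp add: algebra_simps)
      qed
      then show ?thesis by (simp add: integral_add iq)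
    qed
    have cq: "continuous_on UNIV (\<lambda>x. integral {s..T} (\<lambda>r. q' i r x))" for i
      using continuous_time_integral[OF q'] st by auto
    have i: "set_integrable lborel torus_cell (velocity_partial [] j r)" if "r \<in> {0..T}" for r
      by (rule set_integrable_cell_continuous[OF c[OF _ that]]) simp
    note iq' = set_integrable_cell_continuous[OF cq]
    have cV: "continuous_on UNIV (\<lambda>x. - (velocity_partial [] j T x - velocity_partial [] j s x + integral {s..T} (\<lambda>r. force j r x)))"
      by (intro continuous_intros continuous_time_integral[OF force_jc] c s TT st) auto
    have "0 = (LINT x:torus_cell|lborel. - (velocity_partial [] j T x - velocity_partial [] j s x + integral {s..T} (\<lambda>r. force j r x)))"
      by (rule integral_cell_partial[OF P(1) P(2) cV P(3), symmetric])
    also have "\<dots> = - (LINT x:torus_cell|lborel. velocity_partial [] j T x - velocity_partial [] j s x + (integral {s..T} (\<lambda>r. q' 1 r x) + integral {s..T} (\<lambda>r. q' 2 r x)))"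
      unfolding f set_lebesgue_integral_def by (simp only: scaleR_minus_right Bochner_Integration.integral_minus)
    also have "(LINT x:torus_cell|lborel. velocity_partial [] j T x - velocity_partial [] j s x + (integral {s..T} (\<lambda>r. q' 1 r x) + integral {s..T} (\<lambda>r. q' 2 r x)))
        = (LINT x:torus_cell|lborel. velocity_partial [] j T x) - (LINT x:torus_cell|lborel. velocity_partial [] j s x)
         + ((LINT x:torus_cell|lborel. integral {s..T} (\<lambda>r. q' 1 r x)) + (LINT x:torus_cell|lborel. integral {s..T} (\<lambda>r. q' 2 r x)))"
      using set_integral_add(2)[OF set_integral_diff(1)[OF i[OF TT] i[OF s]] set_integral_add(1)[OF iq' iq']]
        set_integral_diff(2)[OF i[OF TT] i[OF s]] set_integral_add(2)[OF iq' iq'] by simp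
    finally show ?thesis by (simp add: Q0)
  qed
  moreover have "velocity_partial [] j r = (\<lambda>x. u r x $ j)" for j r by (simp add: velocity_partial_def)
  ultimately have "(LINT x:torus_cell|lborel. u s x $ j) = (LINT x:torus_cell|lborel. u T x $ j)" for j by simp
  then have "(LINT x:torus_cell|lborel. u s x) = (LINT x:torus_cell|lborel. u T x)"
    using set_integral_vec_nth(2)[OF set_integrable_cell_continuous[OF cu]] s TT by (simp add: vec_eq_iff)
  then show ?thesis using m final by simp
qed

text \<open>The defining property of the kernel applies since the velocity has mean zero at all times.\<close>

lemma biot_savart_law:
  assumes K: "biot_savart_kernel K" and m: "(LINT x:torus_cell|lborel. \<phi> x) = 0" and s: "s \<in> {0..T}"
  shows "u s x = torus_conv K (vort s) x"
proof -
  interpret biot_savart K by unfold_locales (rule K)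
  have "Ck_torus 1 (u s)" using C_time_periodic[OF velocity_C5 s] Ck_mono[OF C_time_Ck[OF velocity_C5 s], of 1] by (simp add: Ck_torus_def)
  from representation[OF this div0[OF s] mean_zero[OF m s]] show ?thesis by (simp add: curl_eq_vort[OF s])
qed

end

section \<open>Counting paths and their jump integrals\<close>


text \<open>A sample path of the clock. Its jumps may have any size, and the Euler scheme below multiplies the velocity by the
jump size accordingly.\<close>

locale counting_path =
  fixes n :: "real \<Rightarrow> nat"
  assumes mono: "mono_on {0..} n"
    and right_continuous: "\<And>t. t \<ge> 0 \<Longrightarrow> continuous (at_right t) (\<lambda>r. real (n r))"
begin

lemma n_mono: "0 \<le> a \<Longrightarrow> a \<le> b \<Longrightarrow> n a \<le> n b"
  using mono by (auto simp: mono_on_def)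

lemma constant_right:
  assumes "c \<ge> 0" shows "\<exists>d>0. \<forall>q. c \<le> q \<longrightarrow> q < c + d \<longrightarrow> n q = n c"
proof -
  have "((\<lambda>r. real (n r)) \<longlongrightarrow> real (n c)) (at_right c)"
    using right_continuous[OF assms] by (simp add: continuous_within)
  then have "\<forall>\<^sub>F r in at_right c. dist (real (n r)) (real (n c)) < 1" by (rule tendstoD) simp
  then have "\<forall>\<^sub>F r in at_right c. n r = n c" by (rule eventually_mono) (simp add: dist_real_def)
  then obtain b where b: "b > c" "\<And>r. c < r \<Longrightarrow> r < b \<Longrightarrow> n r = n c"
    unfolding eventually_at_right_field by blast
  then show ?thesis by (intro exI[of _ "b - c"]) (auto simp: le_less)
qed

text \<open>The values before \<open>c\<close> are bounded by \<open>n c\<close>, hence the largest of them is attained and kept from then on.\<close>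

lemma constant_left:
  assumes "c \<ge> 0" shows "\<exists>d>0. \<forall>p q. 0 \<le> p \<longrightarrow> c - d < p \<longrightarrow> p < c \<longrightarrow> 0 \<le> q \<longrightarrow> c - d < q \<longrightarrow> q < c \<longrightarrow> n p = n q"
proof (cases "c = 0")
  case False
  then have c: "c > 0" using assms by simp
  have fin: "finite (n ` {0..<c})"
    by (rule finite_subset[of _ "{..n c}"]) (auto intro: n_mono)
  have "Max (n ` {0..<c}) \<in> n ` {0..<c}" using c fin by (intro Max_in) auto
  then obtain q0 where q0: "q0 \<in> {0..<c}" "n q0 = Max (n ` {0..<c})" by auto
  have "n q = n q0" if "q0 < q" "q < c" for q
    using n_mono[of q0 q] Max_ge[OF fin, of "n q"] q0 that by auto
  then show ?thesis using q0(1) by (intro exI[of _ "c - q0"]) auto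
qed (auto intro: exI[of _ 1])

text \<open>The path is constant on both sides of every point; a Lebesgue number of the resulting open cover is a cell length
for which every cell contains at most one jump time.\<close>

lemma single_jump_cells:
  obtains d where "d > 0" "\<And>a b. 0 \<le> a \<Longrightarrow> a < b \<Longrightarrow> b \<le> T \<Longrightarrow> b - a < d \<Longrightarrow>
    \<exists>r\<in>{a<..b}. (\<forall>q\<in>{a..<r}. n q = n a) \<and> (\<forall>q\<in>{r..b}. n q = n b)"
proof -
  have "\<exists>d>0. (\<forall>q. c \<le> q \<longrightarrow> q < c + d \<longrightarrow> n q = n c) \<and> 
     (\<forall>p q. 0 \<le> p \<longrightarrow> c - d < p \<longrightarrow> p < c \<longrightarrow> 0 \<le> q \<longrightarrow> c - d < q \<longrightarrow> q < c \<longrightarrow> n p = n q)" if c: "c \<ge> 0" for c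
  proof -
    obtain d where d: "d > 0" "\<forall>q. c \<le> q \<longrightarrow> q < c + d \<longrightarrow> n q = n c" using constant_right[OF c] by blast
    obtain e where e: "e > 0" "\<forall>p q. 0 \<le> p \<longrightarrow> c - e < p \<longrightarrow> p < c \<longrightarrow> 0 \<le> q \<longrightarrow> c - e < q \<longrightarrow> q < c \<longrightarrow> n p = n q"
      using constant_left[OF c] by blast
    show ?thesis
    proof (intro exI[of _ "min d e"] conjI allI impI)
      fix q assume "c \<le> q" "q < c + min d e"
      then show "n q = n c" by (intro d(2)[rule_format]) auto
    next
      fix p q assume "0 \<le> p" "c - min d e < p" "p < c" "0 \<le> q" "c - min d e < q" "q < c"
      then show "n p = n q" using e(2)[rule_format, of p q] by simp
    qed (use d e in simp)
  qed
  then have "\<forall>c. \<exists>d. c \<ge> 0 \<longrightarrow> d > 0 \<and> (\<forall>q. c \<le> q \<longrightarrow> q < c + d \<longrightarrow> n q = n c) \<and> 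
     (\<forall>p q. 0 \<le> p \<longrightarrow> c - d < p \<longrightarrow> p < c \<longrightarrow> 0 \<le> q \<longrightarrow> c - d < q \<longrightarrow> q < c \<longrightarrow> n p = n q)"
    by blast
  from choice[OF this] obtain \<delta> where "\<forall>c. c \<ge> 0 \<longrightarrow> \<delta> c > 0 \<and> (\<forall>q. c \<le> q \<longrightarrow> q < c + \<delta> c \<longrightarrow> n q = n c) \<and> 
     (\<forall>p q. 0 \<le> p \<longrightarrow> c - \<delta> c < p \<longrightarrow> p < c \<longrightarrow> 0 \<le> q \<longrightarrow> c - \<delta> c < q \<longrightarrow> q < c \<longrightarrow> n p = n q)" ..
  then have \<delta>: "\<And>c. c \<ge> 0 \<Longrightarrow> \<delta> c > 0" "\<And>c q. c \<ge> 0 \<Longrightarrow> c \<le> q \<Longrightarrow> q < c + \<delta> c \<Longrightarrow> n q = n c"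
    "\<And>c p q. c \<ge> 0 \<Longrightarrow> 0 \<le> p \<Longrightarrow> c - \<delta> c < p \<Longrightarrow> p < c \<Longrightarrow> 0 \<le> q \<Longrightarrow> c - \<delta> c < q \<Longrightarrow> q < c \<Longrightarrow> n p = n q"
    by blast+
  obtain d where d: "d > 0" "\<And>x. x \<in> {0..T} \<Longrightarrow> \<exists>G\<in>(\<lambda>s. ball s (\<delta> s)) ` {0..T}. ball x d \<subseteq> G"
  proof (rule Heine_Borel_lemma[of "{0..T}" "(\<lambda>s. ball s (\<delta> s)) ` {0..T}"])
    show "{0..T} \<subseteq> \<Union> ((\<lambda>s. ball s (\<delta> s)) ` {0..T})"
    proof
      fix s assume "s \<in> {0..T}"
      then show "s \<in> \<Union> ((\<lambda>s. ball s (\<delta> s)) ` {0..T})" using \<delta>(1)[of s] by (intro UN_I[of s]) auto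
    qed
  qed auto
  show ?thesis
  proof (rule that[OF d(1)])
    fix a b assume ab: "0 \<le> a" "a < b" "b \<le> T" "b - a < d"
    then obtain c where c: "c \<in> {0..T}" "ball a d \<subseteq> ball c (\<delta> c)" using d(2)[of a] by auto
    have near: "c - \<delta> c < q \<and> q < c + \<delta> c" if "q \<in> {a..b}" for q
    proof -
      have "q \<in> ball a d" using that ab by (auto simp: dist_real_def)
      then have "q \<in> ball c (\<delta> c)" using c by blast
      then show ?thesis by (auto simp: dist_real_def)
    qed
    have c0: "c \<ge> 0" using c by simp
    consider "a < c" "c \<le> b" | "c \<le> a" | "b < c" by linarith
    then show "\<exists>r\<in>{a<..b}. (\<forall>q\<in>{a..<r}. n q = n a) \<and> (\<forall>q\<in>{r..b}. n q = n b)"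
    proof cases
      case 1
      show ?thesis
      proof (rule bexI[of _ c], intro conjI ballI)
        fix q assume "q \<in> {a..<c}"
        then show "n q = n a" using 1 ab near[of q] near[of a] by (intro \<delta>(3)[OF c0]) auto
      next
        fix q assume "q \<in> {c..b}"
        then have "n q = n c" "n b = n c" using 1 ab near[of q] near[of b] by (auto intro!: \<delta>(2)[OF c0])
        then show "n q = n b" by simp
      qed (use 1 in auto)
    next
      case 2
      have "n q = n c" if "q \<in> {a..b}" for q using 2 that near[OF that] by (intro \<delta>(2)[OF c0]) auto
      then have 1: "q \<in> {a..b} \<Longrightarrow> n q = n a" for q using ab by (metis atLeastAtMost_iff less_imp_le order_refl)
      show ?thesis
      proof (rule bexI[of _ b], intro conjI ballI)
        show "n q = n a" if "q \<in> {a..<b}" for q using 1[of q] that by simp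
        show "n q = n b" if "q \<in> {b..b}" for q using that by simp
      qed (use ab in auto)
    next
      case 3
      have "n q = n a" if "q \<in> {a..b}" for q 
        using 3 ab that near[OF that] near[of a] by (intro \<delta>(3)[OF c0]) auto
      then have 1: "q \<in> {a..b} \<Longrightarrow> n q = n a" for q by blast
      show ?thesis
      proof (rule bexI[of _ b], intro conjI ballI)
        show "n q = n a" if "q \<in> {a..<b}" for q using 1[of q] that by simp
        show "n q = n b" if "q \<in> {b..b}" for q using that by simp
      qed (use ab in auto)
    qed
  qed
qed

definition jump_measure :: "real measure" where
  "jump_measure = interval_measure (\<lambda>r. real (n (max 0 r)))"

lemma jump_measure_Ioc:
  assumes "0 \<le> a" "a \<le> b" shows "emeasure jump_measure {a<..b} = real (n b - n a)"
proof -
  have "continuous (at_right c) (\<lambda>r. real (n (max 0 r)))" for c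
  proof (cases "c \<ge> 0")
    case True
    have "((\<lambda>r. real (n r)) \<longlongrightarrow> real (n c)) (at_right c)"
      using right_continuous[OF True] by (simp add: continuous_within)
    moreover have "\<forall>\<^sub>F r in at_right c. real (n r) = real (n (max 0 r))"
      using eventually_at_right_less[of c] by eventually_elim (use True in \<open>auto simp: max_def\<close>)
    ultimately have "((\<lambda>r. real (n (max 0 r))) \<longlongrightarrow> real (n c)) (at_right c)" by (rule Lim_transform_eventually)
    then show ?thesis using True by (simp add: continuous_within)
  next
    case False
    have "\<forall>\<^sub>F r in at_right c. r < 0" using False by (intro eventually_at_right_field[THEN iffD2]) (auto intro: exI[of _ 0])
    then have "\<forall>\<^sub>F r in at_right c. real (n 0) = real (n (max 0 r))" by eventually_elim simp
    then have "((\<lambda>r. real (n (max 0 r))) \<longlongrightarrow> real (n 0)) (at_right c)"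
      by (rule Lim_transform_eventually[OF tendsto_const])
    then show ?thesis using False by (simp add: continuous_within)
  qed
  then have "emeasure jump_measure {a<..b} = real (n (max 0 b)) - real (n (max 0 a))"
    unfolding jump_measure_def using assms(2)
    by (intro emeasure_interval_measure_Ioc) (auto intro!: n_mono)
  then show ?thesis using assms n_mono[OF assms] by (simp add: of_nat_diff)
qed

lemma sets_jump_measure [simp, measurable_cong]: "sets jump_measure = sets borel"
  by (simp add: jump_measure_def)

lemma space_jump_measure [simp]: "space jump_measure = UNIV"
  by (simp add: jump_measure_def)

lemma AE_jump:
  assumes ab: "0 \<le> a" "r \<in> {a<..b}" and l: "\<forall>q\<in>{a..<r}. n q = n a" and rr: "\<forall>q\<in>{r..b}. n q = n b"
  shows "AE q in jump_measure. q \<in> {a<..b} \<longrightarrow> q = r"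
proof -
  have "{a<..r - (r - a) / real (Suc k)} \<in> null_sets jump_measure" for k
  proof -
    have "(r - a) / real (Suc k) \<le> (r - a) / 1" using ab by (intro divide_left_mono) auto
    then have le: "(r - a) / real (Suc k) \<le> r - a" "(r - a) / real (Suc k) > 0"
      using ab by auto
    then have "n (r - (r - a) / real (Suc k)) = n a" using l ab by (intro l[rule_format]) auto
    then show ?thesis using ab le by (simp add: null_sets_def jump_measure_Ioc)
  qed
  then have "(\<Union>k. {a<..r - (r - a) / real (Suc k)}) \<in> null_sets jump_measure" by (rule null_sets_UN)
  moreover have "n r = n b" using ab by (intro rr[rule_format]) auto
  then have "{r<..b} \<in> null_sets jump_measure" using ab by (simp add: null_sets_def jump_measure_Ioc)
  ultimately have "(\<Union>k. {a<..r - (r - a) / real (Suc k)}) \<union> {r<..b} \<in> null_sets jump_measure" by (rule null_sets.Un)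
  from AE_not_in[OF this] show ?thesis
  proof eventually_elim
    fix q assume q: "q \<notin> (\<Union>k. {a<..r - (r - a) / real (Suc k)}) \<union> {r<..b}"
    show "q \<in> {a<..b} \<longrightarrow> q = r"
    proof (intro impI, rule ccontr)
      assume "q \<in> {a<..b}" "q \<noteq> r"
      with q have "a < q" "q < r" by auto
      then have "(r - q) / (r - a) > 0" by simp
      then obtain k where "inverse (real (Suc k)) < (r - q) / (r - a)" using reals_Archimedean by blast
      then have "(r - a) / real (Suc k) < r - q" using \<open>a < q\<close> \<open>q < r\<close> by (simp add: field_simps)
      then have "q \<in> (\<Union>k. {a<..r - (r - a) / real (Suc k)})" using \<open>a < q\<close> by (intro UN_I[of k]) auto
      then show False using q by blast
    qed
  qed
qed

text \<open>The jump measure of the cell is concentrated at \<open>r\<close>. Measurability of the integrand has to be assumed, since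
the Bochner integral of a non-measurable function is zero by default.\<close>

lemma single_jump_integral:
  fixes f :: "real \<Rightarrow> real^2"
  assumes ab: "0 \<le> a" "r \<in> {a<..b}" and l: "\<forall>q\<in>{a..<r}. n q = n a" and rr: "\<forall>q\<in>{r..b}. n q = n b"
    and m: "(\<lambda>q. indicat_real {a<..b} q *\<^sub>R f q) \<in> borel_measurable borel"
  shows "(LINT q:{a<..b}|jump_measure. f q) = real (n b - n a) *\<^sub>R f r"
proof -
  have "(LINT q:{a<..b}|jump_measure. f q) = (LINT q|jump_measure. indicat_real {a<..b} q *\<^sub>R f r)"
    unfolding set_lebesgue_integral_def
  proof (rule integral_cong_AE)
    show "(\<lambda>q. indicat_real {a<..b} q *\<^sub>R f q) \<in> borel_measurable jump_measure"
      using m by (simp cong: measurable_cong_sets)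
    show "AE q in jump_measure. indicat_real {a<..b} q *\<^sub>R f q = indicat_real {a<..b} q *\<^sub>R f r"
      using AE_jump[OF ab l rr] by eventually_elim (auto simp: indicator_def)
  qed measurable
  also have "\<dots> = measure jump_measure {a<..b} *\<^sub>R f r"
    using ab by (subst integral_scaleR_left) (auto simp: jump_measure_Ioc)
  also have "measure jump_measure {a<..b} = real (n b - n a)"
    using ab by (simp add: measure_def jump_measure_Ioc)
  finally show ?thesis .
qed

lemma empty_integral:
  fixes f :: "real \<Rightarrow> real^2"
  assumes ab: "0 \<le> a" "a \<le> b" and l: "n b = n a"
  shows "(LINT q:{a<..b}|jump_measure. f q) = 0"
proof -
  have "{a<..b} \<in> null_sets jump_measure" using ab l by (simp add: null_sets_def jump_measure_Ioc)
  then have "AE q in jump_measure. indicat_real {a<..b} q *\<^sub>R f q = 0"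
    by (rule AE_not_in[THEN eventually_mono]) simp
  then show ?thesis unfolding set_lebesgue_integral_def by (rule integral_eq_zero_AE)
qed

end

text \<open>A right-continuous function is a pointwise limit of step functions, and its left limits are limits of its
values at earlier times.\<close>

lemma cadlag_left_limit_measurable:
  fixes X :: "real \<Rightarrow> real^2"
  assumes X: "cadlag_on s T X"
  shows "(\<lambda>r. indicat_real {s<..T} r *\<^sub>R Lim (at_left r) X) \<in> borel_measurable borel"
proof -
  define A where "A r = indicat_real {s..<T} r *\<^sub>R X r" for r
  have "(\<lambda>r. indicat_real {s..<T} r *\<^sub>R X (of_int (\<lfloor>real (Suc k) * r\<rfloor> + 1) / real (Suc k))) \<in> borel_measurable borel" for k
  proof -
    have "(\<lambda>r. (\<lambda>i. X (of_int (i + 1) / real (Suc k))) \<lfloor>real (Suc k) * r\<rfloor>) \<in> borel_measurable borel"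
      by (rule measurable_compose[of _ _ "count_space UNIV"]) auto
    then show ?thesis by (intro borel_measurable_scaleR) auto
  qed
  moreover have "(\<lambda>k. indicat_real {s..<T} r *\<^sub>R X (of_int (\<lfloor>real (Suc k) * r\<rfloor> + 1) / real (Suc k))) \<longlonglongrightarrow> A r" for r
  proof (cases "r \<in> {s..<T}")
    case True
    define a where "a k = of_int (\<lfloor>real (Suc k) * r\<rfloor> + 1) / real (Suc k)" for k
    have a: "r < a k" "a k \<le> r + inverse (real (Suc k))" for k
    proof -
      have "real (Suc k) * r < of_int (\<lfloor>real (Suc k) * r\<rfloor> + 1)" "of_int (\<lfloor>real (Suc k) * r\<rfloor> + 1) \<le> real (Suc k) * r + 1"
        by linarith+
      then have "r < a k" "a k \<le> (real (Suc k) * r + 1) / real (Suc k)"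
        unfolding a_def by (simp only: pos_less_divide_eq of_nat_0_less_iff zero_less_Suc mult.commute, intro divide_right_mono) auto
      then show "r < a k" "a k \<le> r + inverse (real (Suc k))"
        by (simp_all add: add_divide_distrib inverse_eq_divide)
    qed
    have "a \<longlonglongrightarrow> r"
    proof (rule real_tendsto_sandwich[of "\<lambda>_. r" _ _ "\<lambda>k. r + inverse (real (Suc k))"])
      show "(\<lambda>k. r + inverse (real (Suc k))) \<longlonglongrightarrow> r" using LIMSEQ_inverse_real_of_nat_add[of r] by simp
    qed (use a in \<open>auto intro: less_imp_le always_eventually\<close>)
    then have "filterlim a (at_right r) sequentially"
      using a by (auto simp: filterlim_at intro!: always_eventually)
    moreover have "(X \<longlongrightarrow> X r) (at_right r)" using X True by (auto simp: cadlag_on_def)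
    ultimately have "(\<lambda>k. X (a k)) \<longlonglongrightarrow> X r" by (rule filterlim_compose[rotated])
    then show ?thesis using True by (simp add: A_def a_def)
  qed (simp add: A_def)
  ultimately have A: "A \<in> borel_measurable borel" by (rule borel_measurable_LIMSEQ_metric)
  have "(\<lambda>r. indicat_real {s<..T} r *\<^sub>R A (r - inverse (real (Suc k)))) \<in> borel_measurable borel" for k
    by (intro borel_measurable_scaleR measurable_compose[OF _ A]) auto
  moreover have "(\<lambda>k. indicat_real {s<..T} r *\<^sub>R A (r - inverse (real (Suc k)))) \<longlonglongrightarrow> indicat_real {s<..T} r *\<^sub>R Lim (at_left r) X" for r
  proof (cases "r \<in> {s<..T}")
    case True
    then obtain l where l: "(X \<longlongrightarrow> l) (at_left r)" using X unfolding cadlag_on_def by blast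
    then have L: "Lim (at_left r) X = l" by (intro tendsto_Lim) auto
    have "\<forall>\<^sub>F q in at_left r. s < q \<and> q < r" 
      using True by (intro eventually_at_left_field[THEN iffD2] exI[of _ s]) auto
    then have "\<forall>\<^sub>F q in at_left r. X q = A q" by eventually_elim (use True in \<open>auto simp: A_def\<close>)
    with l have "(A \<longlongrightarrow> l) (at_left r)" by (rule Lim_transform_eventually)
    moreover have "filterlim (\<lambda>k. r - inverse (real (Suc k))) (at_left r) sequentially"
      using LIMSEQ_inverse_real_of_nat_add_minus[of r] by (auto simp: filterlim_at)
    ultimately have "(\<lambda>k. A (r - inverse (real (Suc k)))) \<longlonglongrightarrow> l" by (rule filterlim_compose)
    then show ?thesis using True by (simp add: L)
  qed simp
  ultimately show ?thesis by (rule borel_measurable_LIMSEQ_metric)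
qed

section \<open>Euler approximation of a single path\<close>


text \<open>The scheme reads the noise off the counts \<open>k\<close> at the grid points and the marks \<open>\<xi>\<close>, so the same recursion
serves a single path and a random vector of counts. In each step the velocity is multiplied by the number of jumps
in the cell.\<close>

primrec euler :: "real \<Rightarrow> real \<Rightarrow> (real \<Rightarrow> real^2 \<Rightarrow> real^2) \<Rightarrow> (nat \<Rightarrow> real) \<Rightarrow> real^2 \<Rightarrow>
    (nat \<Rightarrow> real^2) \<Rightarrow> (nat \<Rightarrow> nat) \<Rightarrow> nat \<Rightarrow> real^2" where
  "euler \<epsilon> \<sigma> v \<tau> x \<xi> k 0 = x"
| "euler \<epsilon> \<sigma> v \<tau> x \<xi> k (Suc i) = euler \<epsilon> \<sigma> v \<tau> x \<xi> k i
     + (\<epsilon> * real (k (Suc i) - k i)) *\<^sub>R v (\<tau> i) (euler \<epsilon> \<sigma> v \<tau> x \<xi> k i)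
     + \<sigma> *\<^sub>R (\<Sum>l\<in>{k i<..k (Suc i)}. \<xi> l)"

definition grid :: "real \<Rightarrow> real \<Rightarrow> nat \<Rightarrow> nat \<Rightarrow> real" where
  "grid s T m i = s + real i * ((T - s) / real m)"

lemma grid_0 [simp]: "grid s T m 0 = s"
  by (simp add: grid_def)

lemma grid_end: "m > 0 \<Longrightarrow> grid s T m m = T"
  by (simp add: grid_def)

lemma grid_Suc: "grid s T m (Suc i) = grid s T m i + (T - s) / real m"
  by (simp add: grid_def distrib_right add_divide_distrib)

lemma grid_strict: "s < T \<Longrightarrow> m > 0 \<Longrightarrow> i < j \<Longrightarrow> grid s T m i < grid s T m j"
  by (simp add: grid_def divide_strict_right_mono)

lemma grid_bounds: "s < T \<Longrightarrow> m > 0 \<Longrightarrow> i \<le> m \<Longrightarrow> s \<le> grid s T m i \<and> grid s T m i \<le> T"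
  using grid_strict[of s T m 0 i] grid_strict[of s T m i m] grid_end[of m s T] by (cases "i = 0"; cases "i = m") auto

locale path_solution = counting_path +
  fixes T s \<epsilon> \<sigma> :: real and v :: "real \<Rightarrow> real^2 \<Rightarrow> real^2" and X :: "real \<Rightarrow> real^2" and \<xi> :: "nat \<Rightarrow> real^2"
    and x :: "real^2" and B L :: real
  assumes st: "0 \<le> s" "s < T" and \<epsilon>: "\<epsilon> > 0"
    and v_cont: "jointly_continuous T v"
    and v_bound: "\<And>r y. r \<in> {0..T} \<Longrightarrow> norm (v r y) \<le> B"
    and v_lip: "\<And>r y z. r \<in> {0..T} \<Longrightarrow> norm (v r y - v r z) \<le> L * norm (y - z)"
    and X_cadlag: "cadlag_on s T X"
    and X_eq: "\<And>t. t \<in> {s..T} \<Longrightarrow> X t = x + \<epsilon> *\<^sub>R path_integral n s t (\<lambda>r. v r (Lim (at_left r) X))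
       + \<sigma> *\<^sub>R ((\<Sum>k\<in>{1..n t}. \<xi> k) - (\<Sum>k\<in>{1..n s}. \<xi> k))"
begin

definition speed :: "real \<Rightarrow> real^2" where
  "speed r = v r (Lim (at_left r) X)"

text \<open>The velocity is continuous in time and space jointly, and the left limits of a cadlag path are measurable. This
is what makes the path integral a genuine sum over jumps.\<close>

lemma speed_measurable: "(\<lambda>r. indicat_real {s<..T} r *\<^sub>R speed r) \<in> borel_measurable borel"
proof -
  have ve: "continuous_on UNIV (\<lambda>z. (\<lambda>(r, y). v r y) (max 0 (min T (fst z)), snd z))"
    by (rule continuous_on_compose2[OF v_cont[unfolded jointly_continuous_def]]) (use st in \<open>auto intro!: continuous_intros\<close>)
  have "(\<lambda>r. (\<lambda>z. (\<lambda>(r, y). v r y) (max 0 (min T (fst z)), snd z)) (r, indicat_real {s<..T} r *\<^sub>R Lim (at_left r) X)) \<in> borel_measurable borel"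
    by (rule borel_measurable_continuous_on[OF ve]) (intro borel_measurable_Pair cadlag_left_limit_measurable[OF X_cadlag]; simp)
  then have "(\<lambda>r. indicat_real {s<..T} r *\<^sub>R (\<lambda>z. (\<lambda>(r, y). v r y) (max 0 (min T (fst z)), snd z)) (r, indicat_real {s<..T} r *\<^sub>R Lim (at_left r) X)) \<in> borel_measurable borel"
    by (intro borel_measurable_scaleR) auto
  also have "(\<lambda>r. indicat_real {s<..T} r *\<^sub>R (\<lambda>z. (\<lambda>(r, y). v r y) (max 0 (min T (fst z)), snd z)) (r, indicat_real {s<..T} r *\<^sub>R Lim (at_left r) X)) = (\<lambda>r. indicat_real {s<..T} r *\<^sub>R speed r)"
    using st by (auto simp: fun_eq_iff speed_def indicator_def min_def max_def)
  finally show ?thesis .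
qed

lemma speed_measurable_sub:
  assumes "s \<le> a" "b \<le> T" shows "(\<lambda>r. indicat_real {a<..b} r *\<^sub>R speed r) \<in> borel_measurable borel"
proof -
  have "(\<lambda>r. indicat_real {a<..b} r *\<^sub>R (indicat_real {s<..T} r *\<^sub>R speed r)) \<in> borel_measurable borel"
    by (intro borel_measurable_scaleR speed_measurable) auto
  also have "(\<lambda>r. indicat_real {a<..b} r *\<^sub>R (indicat_real {s<..T} r *\<^sub>R speed r)) = (\<lambda>r. indicat_real {a<..b} r *\<^sub>R speed r)"
    using assms by (auto simp: indicator_def fun_eq_iff)
  finally show ?thesis .
qed

lemma speed_integrable:
  assumes "s \<le> a" "a \<le> b" "b \<le> T" shows "set_integrable jump_measure {a<..b} speed"
  unfolding set_integrable_def
proof (rule Bochner_Integration.integrable_bound)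
  show "integrable jump_measure (\<lambda>r. indicat_real {a<..b} r *\<^sub>R B)"
    using assms st by (intro integrable_scaleR_left integrable_real_indicator) (auto simp: jump_measure_Ioc)
  show "(\<lambda>r. indicat_real {a<..b} r *\<^sub>R speed r) \<in> borel_measurable jump_measure"
    using speed_measurable_sub[of a b] assms by (simp cong: measurable_cong_sets)
  show "AE r in jump_measure. norm (indicat_real {a<..b} r *\<^sub>R speed r) \<le> norm (indicat_real {a<..b} r *\<^sub>R B)"
    using assms st by (intro AE_I2) (auto simp: speed_def indicator_def intro!: order_trans[OF v_bound abs_ge_self])
qed

lemma X_start: "X s = x"
  using X_eq[of s] st by (simp add: path_integral_def set_lebesgue_integral_def)

lemma X_increment:
  assumes ab: "s \<le> a" "a \<le> b" "b \<le> T"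
  shows "X b = X a + \<epsilon> *\<^sub>R (LINT r:{a<..b}|jump_measure. speed r) + \<sigma> *\<^sub>R (\<Sum>k\<in>{n a<..n b}. \<xi> k)"
proof -
  have P: "path_integral n s t (\<lambda>r. v r (Lim (at_left r) X)) = (LINT r:{s<..t}|jump_measure. speed r)" for t
    by (simp add: path_integral_def jump_measure_def speed_def)
  have u: "{s<..b} = {s<..a} \<union> {a<..b}" using ab by auto
  have "(LINT r:{s<..b}|jump_measure. speed r) = (LINT r:{s<..a}|jump_measure. speed r) + (LINT r:{a<..b}|jump_measure. speed r)"
    unfolding u by (rule set_integral_Un) (use ab in \<open>auto intro!: speed_integrable\<close>)
  moreover have "(\<Sum>k\<in>{1..n b}. \<xi> k) = (\<Sum>k\<in>{1..n a}. \<xi> k) + (\<Sum>k\<in>{n a<..n b}. \<xi> k)"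
  proof -
    have "{1..n b} = {1..n a} \<union> {n a<..n b}" using n_mono[of a b] ab st by auto
    then show ?thesis by (simp only:) (subst sum.union_disjoint; auto)
  qed
  moreover have "a \<in> {s..T}" "b \<in> {s..T}" using ab by auto
  ultimately show ?thesis
    by (simp only: X_eq P) (simp add: scaleR_add_right algebra_simps)
qed

text \<open>Before the only possible jump in the cell the path rests, so the left limit at the jump time is the value at the left
end point.\<close>

lemma X_cell:
  assumes ab: "s \<le> a" "b \<le> T" "r \<in> {a<..b}" and l: "\<forall>q\<in>{a..<r}. n q = n a" and rr: "\<forall>q\<in>{r..b}. n q = n b"
  shows "X b = X a + (\<epsilon> * real (n b - n a)) *\<^sub>R v r (X a) + \<sigma> *\<^sub>R (\<Sum>k\<in>{n a<..n b}. \<xi> k)"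
proof -
  have Xq: "X q = X a" if "q \<in> {a..<r}" for q
  proof -
    have nq: "n q = n a" using l that by blast
    have "s \<le> a" "a \<le> q" "q \<le> T" "0 \<le> a" using ab st that by auto
    then show ?thesis using X_increment[of a q] empty_integral[of a q speed, OF _ _ nq] by (simp add: nq)
  qed
  have "\<forall>\<^sub>F q in at_left r. X a = X q"
    using ab(3) by (intro eventually_at_left_field[THEN iffD2] exI[of _ a] conjI allI impI Xq[symmetric]) auto
  then have "(X \<longlongrightarrow> X a) (at_left r)" by (rule Lim_transform_eventually[OF tendsto_const])
  then have L: "Lim (at_left r) X = X a" by (intro tendsto_Lim) auto
  have "(LINT q:{a<..b}|jump_measure. speed q) = real (n b - n a) *\<^sub>R speed r"
    by (rule single_jump_integral[OF _ ab(3) l rr speed_measurable_sub]) (use ab st in auto)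
  then show ?thesis using X_increment[of a b] ab by (simp add: speed_def L)
qed

text \<open>A discrete Gronwall estimate: errors grow only at jumps, by a factor \<open>1 + \<epsilon> L\<close> per jump, and each jump adds
at most the oscillation of the velocity over one cell.\<close>

lemma euler_error:
  assumes m: "m > 0" and L0: "L \<ge> 0"
    and cells: "\<And>i. i < m \<Longrightarrow> \<exists>r\<in>{grid s T m i<..grid s T m (Suc i)}. (\<forall>q\<in>{grid s T m i..<r}. n q = n (grid s T m i))
        \<and> (\<forall>q\<in>{r..grid s T m (Suc i)}. n q = n (grid s T m (Suc i)))"
    and \<eta>: "\<eta> \<ge> 0" "\<And>q r y. q \<in> {0..T} \<Longrightarrow> r \<in> {0..T} \<Longrightarrow> \<bar>q - r\<bar> \<le> (T - s) / real m \<Longrightarrow> norm (v q y - v r y) \<le> \<eta>"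
    and i: "i \<le> m"
  shows "norm (X (grid s T m i) - euler \<epsilon> \<sigma> v (grid s T m) x \<xi> (\<lambda>i. n (grid s T m i)) i)
     \<le> \<epsilon> * \<eta> * real (n (grid s T m i) - n s) * exp (\<epsilon> * L * real (n (grid s T m i) - n s))"
  using i
proof (induction i)
  case 0
  then show ?case by (simp add: X_start)
next
  case (Suc i)
  let ?t = "grid s T m" and ?Y = "euler \<epsilon> \<sigma> v (grid s T m) x \<xi> (\<lambda>i. n (grid s T m i))"
  obtain r where r: "r \<in> {?t i<..?t (Suc i)}" "\<forall>q\<in>{?t i..<r}. n q = n (?t i)" "\<forall>q\<in>{r..?t (Suc i)}. n q = n (?t (Suc i))"
    using cells[of i, OF Suc_le_lessD[OF Suc.prems]] by (elim bexE conjE)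
  have gb: "s \<le> ?t i" "?t i \<le> T" "s \<le> ?t (Suc i)" "?t (Suc i) \<le> T" 
    using grid_bounds[OF st(2) m, of i] grid_bounds[OF st(2) m, of "Suc i"] Suc.prems by auto
  define e where "e = norm (X (?t i) - ?Y i)"
  define N where "N = real (n (?t i) - n s)"
  define k where "k = real (n (?t (Suc i)) - n (?t i))"
  have mon: "n s \<le> n (?t i)" "n (?t i) \<le> n (?t (Suc i))" using gb st r(1) by (auto intro!: n_mono)
  have Nk: "real (n (?t (Suc i)) - n s) = N + k" unfolding N_def k_def using mon by (simp add: of_nat_diff)
  have N0: "N \<ge> 0" "k \<ge> 0" by (simp_all add: N_def k_def)
  have IH: "e \<le> \<epsilon> * \<eta> * N * exp (\<epsilon> * L * N)" using Suc by (simp add: e_def N_def)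
  have "X (?t (Suc i)) - ?Y (Suc i) = (X (?t i) - ?Y i) + (\<epsilon> * k) *\<^sub>R (v r (X (?t i)) - v (?t i) (?Y i))"
    using X_cell[OF gb(1) gb(4) r] by (simp add: k_def algebra_simps)
  then have "norm (X (?t (Suc i)) - ?Y (Suc i)) \<le> e + norm ((\<epsilon> * k) *\<^sub>R (v r (X (?t i)) - v (?t i) (?Y i)))"
    unfolding e_def by (simp only: norm_triangle_ineq)
  also have "norm ((\<epsilon> * k) *\<^sub>R (v r (X (?t i)) - v (?t i) (?Y i))) = \<epsilon> * k * norm (v r (X (?t i)) - v (?t i) (?Y i))"
    using \<epsilon> N0 by simp
  also have "norm (v r (X (?t i)) - v (?t i) (?Y i)) \<le> norm (v r (X (?t i)) - v (?t i) (X (?t i))) + norm (v (?t i) (X (?t i)) - v (?t i) (?Y i))"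
    using norm_triangle_ineq[of "v r (X (?t i)) - v (?t i) (X (?t i))" "v (?t i) (X (?t i)) - v (?t i) (?Y i)"] by simp
  also have "norm (v r (X (?t i)) - v (?t i) (X (?t i))) \<le> \<eta>"
    using r(1) gb st by (intro \<eta>(2)) (auto simp: grid_Suc)
  also have "norm (v (?t i) (X (?t i)) - v (?t i) (?Y i)) \<le> L * e"
    unfolding e_def using gb st by (intro v_lip) auto
  finally have "norm (X (?t (Suc i)) - ?Y (Suc i)) \<le> e + \<epsilon> * k * (\<eta> + L * e)"
    using \<epsilon> N0 by (simp add: mult_left_mono)
  also have "\<dots> = e * (1 + \<epsilon> * L * k) + \<epsilon> * k * \<eta>" by (simp add: algebra_simps)
  also have "\<dots> \<le> (\<epsilon> * \<eta> * N * exp (\<epsilon> * L * N)) * exp (\<epsilon> * L * k) + \<epsilon> * k * \<eta> * exp (\<epsilon> * L * (N + k))"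
  proof (rule add_mono)
    show "e * (1 + \<epsilon> * L * k) \<le> (\<epsilon> * \<eta> * N * exp (\<epsilon> * L * N)) * exp (\<epsilon> * L * k)"
      using \<epsilon> N0 L0 \<eta>(1) by (intro mult_mono IH exp_ge_add_one_self) auto
    have "\<epsilon> * k * \<eta> * 1 \<le> \<epsilon> * k * \<eta> * exp (\<epsilon> * L * (N + k))"
      using \<epsilon> N0 L0 \<eta>(1) by (intro mult_left_mono) auto
    then show "\<epsilon> * k * \<eta> \<le> \<epsilon> * k * \<eta> * exp (\<epsilon> * L * (N + k))" by simp
  qed
  also have "\<dots> = \<epsilon> * \<eta> * (N + k) * exp (\<epsilon> * L * (N + k))"
    by (simp add: algebra_simps exp_add)
  finally show ?case unfolding Nk .
qed

lemma euler_converges: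
  assumes unif: "\<And>\<eta>. \<eta> > 0 \<Longrightarrow> \<exists>d>0. \<forall>q\<in>{0..T}. \<forall>r\<in>{0..T}. \<bar>q - r\<bar> < d \<longrightarrow> (\<forall>y. norm (v q y - v r y) \<le> \<eta>)"
    and L0: "L \<ge> 0"
  shows "(\<lambda>m. euler \<epsilon> \<sigma> v (grid s T m) x \<xi> (\<lambda>i. n (grid s T m i)) m) \<longlonglongrightarrow> X T"
proof (rule LIMSEQ_I)
  fix e :: real assume e: "e > 0"
  define N where "N = real (n T - n s)"
  define \<eta> where "\<eta> = e / (2 * (\<epsilon> * (N + 1) * exp (\<epsilon> * L * N)))"
  have N0: "N \<ge> 0" by (simp add: N_def)
  have \<eta>: "\<eta> > 0" using e \<epsilon> N0 by (simp add: \<eta>_def add_nonneg_pos)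
  obtain d where d: "d > 0" "\<And>a b. 0 \<le> a \<Longrightarrow> a < b \<Longrightarrow> b \<le> T \<Longrightarrow> b - a < d \<Longrightarrow>
    \<exists>r\<in>{a<..b}. (\<forall>q\<in>{a..<r}. n q = n a) \<and> (\<forall>q\<in>{r..b}. n q = n b)"
    using single_jump_cells[of T] by blast
  obtain d' where d': "d' > 0" "\<forall>q\<in>{0..T}. \<forall>r\<in>{0..T}. \<bar>q - r\<bar> < d' \<longrightarrow> (\<forall>y. norm (v q y - v r y) \<le> \<eta>)"
    using unif[OF \<eta>] by blast
  define c where "c = min d d'"
  have c: "c > 0" "c \<le> d" "c \<le> d'" using d(1) d'(1) by (auto simp: c_def)
  obtain m0 :: nat where m0: "(T - s) / c < real m0" using reals_Archimedean2 by blast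
  have "norm (euler \<epsilon> \<sigma> v (grid s T m) x \<xi> (\<lambda>i. n (grid s T m i)) m - X T) < e" if "m \<ge> m0" for m
  proof -
    have "0 < (T - s) / c" using st c by simp
    then have m: "m > 0" "(T - s) / c < real m" using m0 that by auto
    then have "(T - s) / real m < c" using c(1) by (simp add: divide_less_eq mult.commute)
    then have h: "(T - s) / real m < d" "(T - s) / real m < d'" using c by auto
    have "norm (X (grid s T m m) - euler \<epsilon> \<sigma> v (grid s T m) x \<xi> (\<lambda>i. n (grid s T m i)) m)
       \<le> \<epsilon> * \<eta> * real (n (grid s T m m) - n s) * exp (\<epsilon> * L * real (n (grid s T m m) - n s))"
    proof (rule euler_error[OF m(1) L0])
      fix i assume "i < m"
      then show "\<exists>r\<in>{grid s T m i<..grid s T m (Suc i)}. (\<forall>q\<in>{grid s T m i..<r}. n q = n (grid s T m i))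
        \<and> (\<forall>q\<in>{r..grid s T m (Suc i)}. n q = n (grid s T m (Suc i)))"
        using grid_bounds[OF st(2) m(1), of i] grid_bounds[OF st(2) m(1), of "Suc i"] grid_strict[OF st(2) m(1), of i "Suc i"] st h
        by (intro d(2)) (auto simp: grid_Suc)
    qed (use \<eta> h d' in auto)
    then have "norm (X T - euler \<epsilon> \<sigma> v (grid s T m) x \<xi> (\<lambda>i. n (grid s T m i)) m) \<le> \<epsilon> * \<eta> * N * exp (\<epsilon> * L * N)"
      by (simp add: grid_end[OF m(1)] N_def)
    also have "\<dots> \<le> \<epsilon> * \<eta> * (N + 1) * exp (\<epsilon> * L * N)" using \<epsilon> \<eta> N0 by (intro mult_right_mono mult_left_mono) auto
    also have "\<dots> = \<eta> * (\<epsilon> * (N + 1) * exp (\<epsilon> * L * N))" by (simp only: mult_ac)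
    also have "\<dots> = e / 2"
    proof -
      have "\<epsilon> * (N + 1) * exp (\<epsilon> * L * N) \<noteq> 0" using \<epsilon> N0 by simp
      then show ?thesis unfolding \<eta>_def by simp
    qed
    also have "\<dots> < e" using e by simp
    finally show ?thesis by (simp add: norm_minus_commute)
  qed
  then show "\<exists>m0. \<forall>m\<ge>m0. norm (euler \<epsilon> \<sigma> v (grid s T m) x \<xi> (\<lambda>i. n (grid s T m i)) m - X T) < e" by blast
qed

end

section \<open>Independence and random marks\<close>


lemma (in prob_space) abs_expectation_le:
  fixes f :: "'a \<Rightarrow> real"
  assumes "\<And>\<omega>. \<bar>f \<omega>\<bar> \<le> C" shows "\<bar>expectation f\<bar> \<le> C"
proof (cases "integrable M f")
  case True
  have "\<bar>expectation f\<bar> \<le> expectation (\<lambda>\<omega>. \<bar>f \<omega>\<bar>)" using integral_norm_bound[of M f] by simp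
  also have "\<dots> \<le> expectation (\<lambda>\<omega>. C)" using assms True by (intro integral_mono) auto
  finally show ?thesis by (simp add: prob_space)
next
  case False
  then show ?thesis using assms[of undefined] by (simp add: not_integrable_integral_eq)
qed

text \<open>Independence of two random elements whose values may have different types, here mark sequences and count vectors.\<close>

definition (in prob_space) independent_elements :: "'s measure \<Rightarrow> ('a \<Rightarrow> 's) \<Rightarrow> 't measure \<Rightarrow> ('a \<Rightarrow> 't) \<Rightarrow> bool" where
  "independent_elements S X T Y \<longleftrightarrow> random_variable S X \<and> random_variable T Y \<and>
     (\<forall>A\<in>sets S. \<forall>B\<in>sets T. prob ((X -` A \<inter> space M) \<inter> (Y -` B \<inter> space M)) = prob (X -` A \<inter> space M) * prob (Y -` B \<inter> space M))"

lemma (in prob_space) independent_elements_compose: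
  assumes "independent_elements S X T Y" and f: "f \<in> measurable S S'" and g: "g \<in> measurable T T'"
  shows "independent_elements S' (\<lambda>\<omega>. f (X \<omega>)) T' (\<lambda>\<omega>. g (Y \<omega>))"
  unfolding independent_elements_def
proof (intro conjI ballI)
  have X: "random_variable S X" and Y: "random_variable T Y" 
    using assms(1) by (auto simp: independent_elements_def)
  show "random_variable S' (\<lambda>\<omega>. f (X \<omega>))" "random_variable T' (\<lambda>\<omega>. g (Y \<omega>))"
    using X Y f g by (auto intro: measurable_compose)
  fix A B assume "A \<in> sets S'" "B \<in> sets T'"
  then have AB: "f -` A \<inter> space S \<in> sets S" "g -` B \<inter> space T \<in> sets T" using f g by (auto intro: measurable_sets)
  have eqs: "(\<lambda>\<omega>. f (X \<omega>)) -` A \<inter> space M = X -` (f -` A \<inter> space S) \<inter> space M"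
    "(\<lambda>\<omega>. g (Y \<omega>)) -` B \<inter> space M = Y -` (g -` B \<inter> space T) \<inter> space M"
    using measurable_space[OF X] measurable_space[OF Y] by auto
  show "prob (((\<lambda>\<omega>. f (X \<omega>)) -` A \<inter> space M) \<inter> ((\<lambda>\<omega>. g (Y \<omega>)) -` B \<inter> space M)) = 
      prob ((\<lambda>\<omega>. f (X \<omega>)) -` A \<inter> space M) * prob ((\<lambda>\<omega>. g (Y \<omega>)) -` B \<inter> space M)"
    unfolding eqs using assms(1) AB unfolding independent_elements_def by blast
qed

text \<open>Fubini for independent random elements: the second one may be held fixed while averaging over the first.\<close>

lemma (in prob_space) freeze:
  fixes F :: "'s \<times> 't \<Rightarrow> real"
  assumes ind: "independent_elements S X T Y" and F [measurable]: "F \<in> borel_measurable (S \<Otimes>\<^sub>M T)" and C: "\<And>z. \<bar>F z\<bar> \<le> C"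
  shows "(\<integral>\<omega>. F (X \<omega>, Y \<omega>) \<partial>M) = (\<integral>\<omega>. (\<integral>\<omega>'. F (X \<omega>', Y \<omega>) \<partial>M) \<partial>M)"
proof -
  have [measurable]: "X \<in> measurable M S" "Y \<in> measurable M T"
    using ind by (auto simp: independent_elements_def)
  interpret P: prob_space "distr M S X" by (rule prob_space_distr) simp
  interpret Q: prob_space "distr M T Y" by (rule prob_space_distr) simp
  interpret PQ: pair_prob_space "distr M S X" "distr M T Y" ..
  have eq: "distr M S X \<Otimes>\<^sub>M distr M T Y = distr M (S \<Otimes>\<^sub>M T) (\<lambda>x. (X x, Y x))"
  proof (rule pair_measure_eqI)
    fix A B assume "A \<in> sets (distr M S X)" "B \<in> sets (distr M T Y)"
    then have AB [measurable]: "A \<in> sets S" "B \<in> sets T" by auto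
    have "(\<lambda>x. (X x, Y x)) -` (A \<times> B) \<inter> space M = (X -` A \<inter> space M) \<inter> (Y -` B \<inter> space M)" by auto
    then show "emeasure (distr M S X) A * emeasure (distr M T Y) B = emeasure (distr M (S \<Otimes>\<^sub>M T) (\<lambda>x. (X x, Y x))) (A \<times> B)"
      using ind AB by (simp add: emeasure_distr emeasure_eq_measure independent_elements_def ennreal_mult[symmetric])
  qed (simp_all add: P.sigma_finite_measure_axioms Q.sigma_finite_measure_axioms cong: sets_pair_measure_cong)
  have F': "F \<in> borel_measurable (distr M S X \<Otimes>\<^sub>M distr M T Y)" by simp
  have int: "integrable (distr M S X \<Otimes>\<^sub>M distr M T Y) (\<lambda>(x, y). F (x, y))"
    using F' C by (intro PQ.P.integrable_const_bound[where B=C]) auto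
  have "(\<integral>\<omega>. F (X \<omega>, Y \<omega>) \<partial>M) = (\<integral>z. F z \<partial>distr M (S \<Otimes>\<^sub>M T) (\<lambda>x. (X x, Y x)))"
    by (subst integral_distr) auto
  also have "\<dots> = (\<integral>z. F z \<partial>(distr M S X \<Otimes>\<^sub>M distr M T Y))" by (simp add: eq)
  also have "\<dots> = (\<integral>y. (\<integral>x. F (x, y) \<partial>distr M S X) \<partial>distr M T Y)"
    using PQ.integral_snd[OF int] by simp
  also have "\<dots> = (\<integral>\<omega>. (\<integral>x. F (x, Y \<omega>) \<partial>distr M S X) \<partial>M)"
    by (subst integral_distr) auto
  also have "\<dots> = (\<integral>\<omega>. (\<integral>\<omega>'. F (X \<omega>', Y \<omega>) \<partial>M) \<partial>M)"
  proof (intro Bochner_Integration.integral_cong refl integral_distr)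
    fix \<omega> assume "\<omega> \<in> space M"
    then have "Y \<omega> \<in> space T" by (rule measurable_space[OF \<open>Y \<in> measurable M T\<close>])
    then show "(\<lambda>x. F (x, Y \<omega>)) \<in> borel_measurable S" by measurable
  qed simp
  finally show ?thesis .
qed

definition unit_steps :: "(real^2) set" where
  "unit_steps = {axis 1 1, - axis 1 1, axis 2 1, - axis 2 1}"

lemma axis_distinct: "axis 1 1 \<noteq> (axis 2 1 :: real^2)" "axis 1 1 \<noteq> - (axis 1 1 :: real^2)"
    "axis 1 1 \<noteq> - (axis 2 1 :: real^2)" "axis 2 1 \<noteq> - (axis 2 1 :: real^2)" "axis 2 1 \<noteq> - (axis 1 1 :: real^2)"
  by (auto simp: vec_eq_iff axis_def forall_2)

lemma sum_unit_steps: "(\<Sum>z\<in>unit_steps. f z) = f (axis 1 1) + f (- axis 1 1) + f (axis 2 1) + (f (- axis 2 1) :: real)"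
  unfolding unit_steps_def using axis_distinct axis_distinct[symmetric] by (simp add: add_ac)

lemma card_unit_steps: "finite unit_steps" "card unit_steps = 4"
  unfolding unit_steps_def using axis_distinct axis_distinct[symmetric] by simp_all

definition partial_count :: "(nat \<Rightarrow> nat) \<Rightarrow> nat \<Rightarrow> nat" where
  "partial_count d i = (\<Sum>l\<le>i. d l)"

abbreviation mark_space :: "(nat \<Rightarrow> real^2) measure" where
  "mark_space \<equiv> PiM {1..} (\<lambda>_. borel)"

abbreviation count_history :: "nat \<Rightarrow> (nat \<Rightarrow> nat) measure" where
  "count_history j \<equiv> PiM {..j} (\<lambda>_. count_space UNIV)"

lemma partial_count_mono: "i \<le> j \<Longrightarrow> partial_count d i \<le> partial_count d j"
  unfolding partial_count_def by (rule sum_mono2) auto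

lemma partial_count_Suc: "partial_count d (Suc i) = partial_count d i + d (Suc i)"
  by (simp add: partial_count_def)

lemma partial_count_restrict: "i \<le> j \<Longrightarrow> partial_count (restrict d {..j}) i = partial_count d i"
  unfolding partial_count_def by (rule sum.cong) auto

lemma partial_count_measurable [measurable]:
  "i \<le> j \<Longrightarrow> (\<lambda>d. partial_count d i) \<in> measurable (count_history j) (count_space UNIV)"
proof (induction i)
  case 0
  then show ?case by (simp add: partial_count_def)
next
  case (Suc i)
  let ?P = "count_history j"
  have 1: "(\<lambda>d. partial_count d i) \<in> measurable ?P (count_space UNIV)" using Suc by simp
  have "(\<lambda>d. d (Suc i)) \<in> measurable ?P (count_space UNIV)"
    by (rule measurable_component_singleton) (use Suc.prems in simp)
  then have "(\<lambda>d. a + d (Suc i)) \<in> measurable ?P (count_space UNIV)" for a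
    by (rule measurable_compose) simp
  from measurable_compose_countable[OF this 1] show ?case unfolding partial_count_Suc .
qed

text \<open>The scheme up to step \<open>j\<close> sees only the first \<open>k j\<close> marks. This gives the independence of the next mark.\<close>

lemma euler_cong:
  assumes "\<And>l. l \<in> {1..k j} \<Longrightarrow> \<xi> l = \<xi>' l" "\<And>i. i \<le> j \<Longrightarrow> k i = k' i" "\<And>i. i \<le> j \<Longrightarrow> k i \<le> k j"
  shows "euler \<epsilon> \<sigma> v \<tau> x \<xi> k j = euler \<epsilon> \<sigma> v \<tau> x \<xi>' k' j"
proof -
  have "i \<le> j \<Longrightarrow> euler \<epsilon> \<sigma> v \<tau> x \<xi> k i = euler \<epsilon> \<sigma> v \<tau> x \<xi>' k' i" for i
  proof (induction i)
    case (Suc i)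
    have "(\<Sum>l\<in>{k i<..k (Suc i)}. \<xi> l) = (\<Sum>l\<in>{k i<..k (Suc i)}. \<xi>' l)"
      using assms(3)[OF Suc.prems] by (intro sum.cong refl assms(1)) auto
    then show ?case using Suc assms(2)[of i] assms(2)[of "Suc i"] by simp
  qed simp
  then show ?thesis by simp
qed

lemma euler_measurable_marks:
  assumes v: "\<And>i. i < j \<Longrightarrow> continuous_on UNIV (v (\<tau> i))" and I: "\<And>i. i \<le> j \<Longrightarrow> {1..k i} \<subseteq> I"
  shows "(\<lambda>\<xi>. euler \<epsilon> \<sigma> v \<tau> x \<xi> k j) \<in> borel_measurable (PiM I (\<lambda>_. borel))"
proof -
  have "i \<le> j \<Longrightarrow> (\<lambda>\<xi>. euler \<epsilon> \<sigma> v \<tau> x \<xi> k i) \<in> borel_measurable (PiM I (\<lambda>_. borel))" for i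
  proof (induction i)
    case (Suc i)
    have [measurable]: "v (\<tau> i) \<in> borel_measurable borel" using v[of i] Suc by (auto intro: borel_measurable_continuous_onI)
    have [measurable]: "(\<lambda>\<xi>. euler \<epsilon> \<sigma> v \<tau> x \<xi> k i) \<in> borel_measurable (PiM I (\<lambda>_. borel))" using Suc by simp
    have [measurable]: "(\<lambda>\<xi>. \<Sum>l\<in>{k i<..k (Suc i)}. \<xi> l :: real^2) \<in> borel_measurable (PiM I (\<lambda>_. borel))"
    proof (rule borel_measurable_sum)
      fix l assume "l \<in> {k i<..k (Suc i)}"
      then have "l \<in> I" using I[OF Suc.prems] by auto
      then show "(\<lambda>\<xi>. \<xi> l :: real^2) \<in> borel_measurable (PiM I (\<lambda>_. borel))" by (rule measurable_component_singleton)
    qed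
    show ?case unfolding euler.simps by measurable
  qed simp
  then show ?thesis by simp
qed

text \<open>The number of marks used is itself random; countably many values of the counts are treated one by one.\<close>

lemma euler_measurable:
  assumes v: "\<And>i. i < j \<Longrightarrow> continuous_on UNIV (v (\<tau> i))"
  shows "(\<lambda>z. euler \<epsilon> \<sigma> v \<tau> x (fst z) (partial_count (snd z)) j)
     \<in> borel_measurable (mark_space \<Otimes>\<^sub>M count_history j)"
proof -
  let ?P = "mark_space \<Otimes>\<^sub>M count_history j :: ((nat \<Rightarrow> real^2) \<times> (nat \<Rightarrow> nat)) measure"
  have "i \<le> j \<Longrightarrow> (\<lambda>z. euler \<epsilon> \<sigma> v \<tau> x (fst z) (partial_count (snd z)) i) \<in> borel_measurable ?P" for i
  proof (induction i)
    case (Suc i)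
    have [measurable]: "v (\<tau> i) \<in> borel_measurable borel" using v[of i] Suc by (auto intro: borel_measurable_continuous_onI)
    have [measurable]: "(\<lambda>z. euler \<epsilon> \<sigma> v \<tau> x (fst z) (partial_count (snd z)) i) \<in> borel_measurable ?P" using Suc by simp
    have k: "(\<lambda>z. partial_count (snd z) i) \<in> measurable ?P (count_space UNIV)" if "i \<le> j" for i
      by (rule measurable_compose[OF measurable_snd partial_count_measurable[OF that]])
    have [measurable]: "(\<lambda>z. partial_count (snd z) i) \<in> measurable ?P (count_space UNIV)"
      "(\<lambda>z. partial_count (snd z) (Suc i)) \<in> measurable ?P (count_space UNIV)"
      by (rule k, use Suc.prems in simp)+
    have s: "(\<lambda>z. \<Sum>l\<in>{a<..b}. fst z l) \<in> borel_measurable ?P" for a b :: nat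
      by (intro borel_measurable_sum measurable_compose[OF measurable_fst measurable_component_singleton]) auto
    have [measurable]: "(\<lambda>z. \<Sum>l\<in>{partial_count (snd z) i<..partial_count (snd z) (Suc i)}. fst z l) \<in> borel_measurable ?P"
      by (rule measurable_compose_countable[where g="\<lambda>z. partial_count (snd z) i", OF 
           measurable_compose_countable[where g="\<lambda>z. partial_count (snd z) (Suc i)", OF s]]) measurable
    show ?case unfolding euler.simps by measurable
  qed simp
  then show ?thesis by simp
qed

locale driving_noise = prob_space M for M :: "'w measure" +
  fixes rate :: real and N :: "real \<Rightarrow> 'w \<Rightarrow> nat" and \<xi> :: "nat \<Rightarrow> 'w \<Rightarrow> real^2"
  assumes rate: "rate > 0" and poisson: "poisson_process M rate N"
    and steps: "random_walk_steps M \<xi>" and independent: "steps_indep_of_process M \<xi> N"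
begin

lemma N_measurable [measurable]: "t \<ge> 0 \<Longrightarrow> N t \<in> measurable M (count_space UNIV)"
  using poisson by (simp add: poisson_process_def)

lemma \<xi>_indep: "indep_vars (\<lambda>_. borel) \<xi> {1..}"
  using steps by (simp add: random_walk_steps_def)

lemma \<xi>_measurable: "n \<ge> 1 \<Longrightarrow> \<xi> n \<in> borel_measurable M"
  using \<xi>_indep by (auto simp: indep_vars_def)

lemma step_prob: "n \<ge> 1 \<Longrightarrow> z \<in> unit_steps \<Longrightarrow> prob {\<omega> \<in> space M. \<xi> n \<omega> = z} = 1/4"
proof -
  assume n: "n \<ge> 1" and z: "z \<in> unit_steps"
  have "(\<forall>i. z $ i \<in> \<int>) \<and> norm z = 1" using z by (auto simp: unit_steps_def axis_def norm_axis_1[unfolded axis_def])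
  then show ?thesis using steps n by (simp add: random_walk_steps_def)
qed

text \<open>The four unit steps have total probability one.\<close>

lemma step_values: "n \<ge> 1 \<Longrightarrow> AE \<omega> in M. \<xi> n \<omega> \<in> unit_steps"
proof -
  assume n: "n \<ge> 1"
  note [measurable] = \<xi>_measurable[OF n]
  have "prob (\<Union>z\<in>unit_steps. {\<omega> \<in> space M. \<xi> n \<omega> = z}) = (\<Sum>z\<in>unit_steps. prob {\<omega> \<in> space M. \<xi> n \<omega> = z})"
    by (rule finite_measure_finite_Union) (auto simp: card_unit_steps disjoint_family_on_def)
  also have "\<dots> = 1" by (simp add: step_prob[OF n] card_unit_steps)
  also have "(\<Union>z\<in>unit_steps. {\<omega> \<in> space M. \<xi> n \<omega> = z}) = {\<omega> \<in> space M. \<xi> n \<omega> \<in> unit_steps}" by auto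
  finally have "prob {\<omega> \<in> space M. \<xi> n \<omega> \<in> unit_steps} = 1" .
  moreover have "{\<omega> \<in> space M. \<xi> n \<omega> \<in> unit_steps} \<in> events"
    unfolding unit_steps_def by measurable
  ultimately show ?thesis using AE_prob_1 by fastforce
qed

definition marks :: "'w \<Rightarrow> nat \<Rightarrow> real^2" where
  "marks \<omega> = (\<lambda>n\<in>{1..}. \<xi> n \<omega>)"

lemma marks_measurable: "random_variable mark_space marks"
  unfolding marks_def by (intro measurable_restrict \<xi>_measurable) auto

lemma marks_process_indep:
  "independent_elements mark_space marks (PiM {0..} (\<lambda>_. count_space UNIV)) (\<lambda>\<omega>. \<lambda>t\<in>{0..}. N t \<omega>)"
  unfolding independent_elements_def
proof (intro conjI marks_measurable ballI)
  show "random_variable (PiM {0..} (\<lambda>_. count_space UNIV)) (\<lambda>\<omega>. \<lambda>t\<in>{0..}. N t \<omega>)"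
    by (intro measurable_restrict N_measurable) auto
  fix A :: "(nat \<Rightarrow> real^2) set" and B :: "(real \<Rightarrow> nat) set"
  assume "A \<in> sets mark_space" "B \<in> sets (PiM {0..} (\<lambda>_. count_space UNIV))"
  then show "prob ((marks -` A \<inter> space M) \<inter> ((\<lambda>\<omega>. \<lambda>t\<in>{0..}. N t \<omega>) -` B \<inter> space M)) = 
    prob (marks -` A \<inter> space M) * prob ((\<lambda>\<omega>. \<lambda>t\<in>{0..}. N t \<omega>) -` B \<inter> space M)"
    using independent unfolding steps_indep_of_process_def marks_def
    by (intro indep_setD) (auto simp: in_vimage_algebra)
qed

end

section \<open>Increments of the clock on a grid\<close>


lemma (in prob_space) expectation_of_bool:
  "expectation (\<lambda>\<omega>. of_bool (P \<omega>) :: real) = prob {\<omega> \<in> space M. P \<omega>}"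
proof -
  have "expectation (\<lambda>\<omega>. of_bool (P \<omega>) :: real) = expectation (indicator {\<omega> \<in> space M. P \<omega>})"
    by (intro Bochner_Integration.integral_cong) (auto simp: indicator_def)
  also have "\<dots> = measure M ({\<omega> \<in> space M. P \<omega>} \<inter> space M)" by (rule Bochner_Integration.integral_indicator)
  also have "{\<omega> \<in> space M. P \<omega>} \<inter> space M = {\<omega> \<in> space M. P \<omega>}" by auto
  finally show ?thesis .
qed

text \<open>The first grid point is positive, so that time zero followed by the grid is strictly increasing, as the
independence of increments requires.\<close>

locale driving_noise_grid = driving_noise +
  fixes \<tau> :: "nat \<Rightarrow> real" and m :: nat
  assumes \<tau>0: "\<tau> 0 > 0" and \<tau>_Suc: "\<And>i. i < m \<Longrightarrow> \<tau> i < \<tau> (Suc i)"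
begin

definition obs_time :: "real list" where
  "obs_time = 0 # map \<tau> [0..<Suc m]"

lemma \<tau>_less: "i < j \<Longrightarrow> j \<le> m \<Longrightarrow> \<tau> i < \<tau> j"
proof (induction j)
  case (Suc j)
  then show ?case using \<tau>_Suc[of j] by (cases "i = j") auto
qed simp

lemma \<tau>_pos: "i \<le> m \<Longrightarrow> \<tau> i > 0"
  using \<tau>0 \<tau>_less[of 0 i] by (cases "i = 0") auto

lemma obs_time_0: "obs_time ! 0 = 0" and obs_time_Suc: "i \<le> m \<Longrightarrow> obs_time ! Suc i = \<tau> i" and obs_time_length: "length obs_time = Suc (Suc m)"
  by (simp_all add: obs_time_def nth_append del: upt_Suc)

lemma obs_time_sorted: "sorted_wrt (<) obs_time"
  unfolding obs_time_def sorted_wrt.simps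
proof
  show "\<forall>y\<in>set (map \<tau> [0..<Suc m]). 0 < y" using \<tau>_pos by auto
  show "sorted_wrt (<) (map \<tau> [0..<Suc m])"
    unfolding sorted_wrt_map by (rule sorted_wrt_mono_rel[OF _ sorted_wrt_upt]) (auto intro: \<tau>_less)
qed

text \<open>The increment of index \<open>0\<close> runs from time zero to the first grid point; it counts the marks already used
when the scheme starts.\<close>

definition increment :: "nat \<Rightarrow> 'a \<Rightarrow> nat" where
  "increment i \<omega> = N (obs_time ! Suc i) \<omega> - N (obs_time ! i) \<omega>"

lemma increment_indep: "indep_vars (\<lambda>_. count_space UNIV) increment {..m}"
proof -
  have "\<forall>t\<in>set obs_time. 0 \<le> t" using \<tau>_pos by (auto simp: obs_time_def intro: less_imp_le)
  then have "indep_vars (\<lambda>_. count_space UNIV) (\<lambda>i \<omega>. N (obs_time ! Suc i) \<omega> - N (obs_time ! i) \<omega>) {i. Suc i < length obs_time}"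
    using poisson obs_time_sorted unfolding poisson_process_def by blast
  also have "{i. Suc i < length obs_time} = {..m}" by (auto simp: obs_time_length)
  finally show ?thesis by (simp add: increment_def[abs_def])
qed

lemma increment_measurable [measurable]: "i \<le> m \<Longrightarrow> increment i \<in> measurable M (count_space UNIV)"
  using increment_indep by (auto simp: indep_vars_def)

definition history :: "nat \<Rightarrow> 'a \<Rightarrow> nat \<Rightarrow> nat" where
  "history j \<omega> = restrict (\<lambda>i. increment i \<omega>) {..j}"

lemma history_measurable: "j \<le> m \<Longrightarrow> history j \<in> measurable M (count_history j)"
  unfolding history_def by (intro measurable_restrict increment_measurable) auto

lemma marks_history_independent:
  assumes "j \<le> m"
  shows "independent_elements mark_space marks (count_history j) (history j)"
proof -
  have pos: "obs_time ! i \<ge> 0" if "i \<le> Suc m" for i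
    using that obs_time_0 obs_time_Suc \<tau>_pos by (cases i) (auto intro: less_imp_le)
  let ?g = "\<lambda>p :: real \<Rightarrow> nat. \<lambda>i\<in>{..j}. p (obs_time ! Suc i) - p (obs_time ! i)"
  have "?g \<in> measurable (PiM {0..} (\<lambda>_. count_space UNIV)) (count_history j)"
  proof (rule measurable_restrict)
    fix i assume "i \<in> {..j}"
    then have i: "obs_time ! Suc i \<in> {0..}" "obs_time ! i \<in> {0..}" using assms pos by auto
    let ?P = "PiM {0..} (\<lambda>_. count_space (UNIV :: nat set)) :: (real \<Rightarrow> nat) measure"
    have 1: "(\<lambda>p. p (obs_time ! Suc i)) \<in> measurable ?P (count_space UNIV)" "(\<lambda>p. p (obs_time ! i)) \<in> measurable ?P (count_space UNIV)"
      by (rule measurable_component_singleton, fact i)+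
    have "(\<lambda>p. p (obs_time ! Suc i) - a) \<in> measurable ?P (count_space UNIV)" for a
      by (rule measurable_compose[OF 1(1)]) simp
    from measurable_compose_countable[OF this 1(2)]
    show "(\<lambda>p. p (obs_time ! Suc i) - p (obs_time ! i)) \<in> measurable ?P (count_space UNIV)" .
  qed
  from independent_elements_compose[OF marks_process_indep measurable_ident this]
  have "independent_elements mark_space marks (count_history j) (\<lambda>\<omega>. ?g (\<lambda>t\<in>{0..}. N t \<omega>))"
    by (simp add: id_def)
  also have "(\<lambda>\<omega>. ?g (\<lambda>t\<in>{0..}. N t \<omega>)) = history j"
    using pos assms by (auto simp: history_def increment_def fun_eq_iff restrict_def)
  finally show ?thesis .
qed

lemma history_increment_indep:
  assumes "j < m"
  shows "indep_var (count_history j) (history j) (PiM {Suc j} (\<lambda>_. count_space UNIV)) (\<lambda>\<omega>. restrict (\<lambda>i. increment i \<omega>) {Suc j})"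
  unfolding history_def[abs_def] using assms by (intro indep_var_restrict[OF increment_indep]) auto

text \<open>The next increment is independent of the past counts and of all marks. The marks are frozen first, which leaves
two functions of the count process.\<close>

lemma expectation_increment:
  fixes h :: "(nat \<Rightarrow> real^2) \<times> (nat \<Rightarrow> nat) \<Rightarrow> real"
  assumes j: "j < m" and h [measurable]: "h \<in> borel_measurable (mark_space \<Otimes>\<^sub>M count_history j)"
    and C: "\<And>z. \<bar>h z\<bar> \<le> C"
  shows "expectation (\<lambda>\<omega>. of_bool (increment (Suc j) \<omega> = d) * h (marks \<omega>, history j \<omega>)) 
     = prob {\<omega> \<in> space M. increment (Suc j) \<omega> = d} * expectation (\<lambda>\<omega>. h (marks \<omega>, history j \<omega>))"
proof -
  let ?X = "mark_space :: (nat \<Rightarrow> real^2) measure" 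
  let ?Y = "\<lambda>j. count_history j :: (nat \<Rightarrow> nat) measure"
  note [measurable] = marks_measurable
  have [measurable]: "history j \<in> measurable M (?Y j)" "increment (Suc j) \<in> measurable M (count_space UNIV)"
    using j history_measurable increment_measurable by auto
  define H where "H r = expectation (\<lambda>\<omega>. h (marks \<omega>, r))" for r
  have H [measurable]: "H \<in> borel_measurable (?Y j)"
    unfolding H_def by measurable
  have HC: "\<bar>H r\<bar> \<le> C" for r
    unfolding H_def by (rule abs_expectation_le[OF C])
  define F where "F z = of_bool (snd z (Suc j) = d) * h (fst z, restrict (snd z) {..j})" for z
  have r: "restrict (history (Suc j) \<omega>) {..j} = history j \<omega>" "history (Suc j) \<omega> (Suc j) = increment (Suc j) \<omega>" for \<omega>
    by (auto simp: history_def fun_eq_iff restrict_def)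
  have [measurable]: "(\<lambda>r. restrict r {..j}) \<in> measurable (?Y (Suc j)) (?Y j)"
    by (rule measurable_restrict_subset) auto
  have [measurable]: "(\<lambda>r. r (Suc j)) \<in> measurable (?Y (Suc j)) (count_space UNIV)"
    by (rule measurable_component_singleton) auto
  have F: "F \<in> borel_measurable (?X \<Otimes>\<^sub>M ?Y (Suc j))" unfolding F_def by measurable
  have FC: "\<bar>F z\<bar> \<le> C" for z using C[of "(fst z, restrict (snd z) {..j})"] by (auto simp: F_def)
  have "expectation (\<lambda>\<omega>. of_bool (increment (Suc j) \<omega> = d) * h (marks \<omega>, history j \<omega>)) = expectation (\<lambda>\<omega>. F (marks \<omega>, history (Suc j) \<omega>))"
    by (simp add: F_def r)
  also have "\<dots> = expectation (\<lambda>\<omega>. of_bool (increment (Suc j) \<omega> = d) * H (history j \<omega>))"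
    using freeze[OF marks_history_independent F FC] j by (simp add: F_def r H_def)
  also have "\<dots> = expectation (\<lambda>\<omega>. H (history j \<omega>) * of_bool (increment (Suc j) \<omega> = d))" by (simp only: mult.commute)
  also have "\<dots> = expectation (\<lambda>\<omega>. H (history j \<omega>)) * expectation (\<lambda>\<omega>. of_bool (increment (Suc j) \<omega> = d) :: real)"
  proof (rule indep_var_lebesgue_integral)
    have "indep_var borel (H \<circ> history j) borel ((\<lambda>f. of_bool (f (Suc j) = d)) \<circ> (\<lambda>\<omega>. restrict (\<lambda>i. increment i \<omega>) {Suc j}))"
    proof (rule indep_var_compose[OF history_increment_indep[OF j] H])
      have [measurable]: "(\<lambda>f. f (Suc j)) \<in> measurable (PiM {Suc j} (\<lambda>_. count_space (UNIV :: nat set))) (count_space UNIV)"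
        by (rule measurable_component_singleton) auto
      show "(\<lambda>f. of_bool (f (Suc j) = d)) \<in> borel_measurable (PiM {Suc j} (\<lambda>_. count_space (UNIV :: nat set)))"
        by measurable
    qed
    then show "indep_var borel (\<lambda>\<omega>. H (history j \<omega>)) borel (\<lambda>\<omega>. of_bool (increment (Suc j) \<omega> = d))"
      by (simp add: comp_def)
    show "integrable M (\<lambda>\<omega>. of_bool (increment (Suc j) \<omega> = d) :: real)" by (rule integrable_const_bound[where B=1]) auto
    show "integrable M (\<lambda>\<omega>. H (history j \<omega>))" using HC by (intro integrable_const_bound[where B=C]) auto
  qed
  also have "expectation (\<lambda>\<omega>. H (history j \<omega>)) = expectation (\<lambda>\<omega>. h (marks \<omega>, history j \<omega>))"
    using freeze[OF marks_history_independent h C] j by (simp add: H_def)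
  finally show ?thesis by (simp only: mult.commute expectation_of_bool)
qed

text \<open>Splitting according to the four values of the mark \<open>q\<close>, each event being independent of the earlier marks.\<close>

lemma mark_expectation:
  fixes h :: "real^2 \<Rightarrow> real^2 \<Rightarrow> real"
  assumes Y: "Y \<in> borel_measurable (PiM {1..<q} (\<lambda>_. borel))" and q: "q \<ge> 1"
    and h [measurable]: "(\<lambda>z. h (fst z) (snd z)) \<in> borel_measurable borel" and C: "\<And>y z. \<bar>h y z\<bar> \<le> C"
  shows "expectation (\<lambda>\<omega>. h (Y (restrict (\<lambda>i. \<xi> i \<omega>) {1..<q})) (\<xi> q \<omega>)) = 
    expectation (\<lambda>\<omega>. (\<Sum>z\<in>unit_steps. h (Y (restrict (\<lambda>i. \<xi> i \<omega>) {1..<q})) z) / 4)"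
proof -
  define V where "V \<omega> = Y (restrict (\<lambda>i. \<xi> i \<omega>) {1..<q})" for \<omega>
  note [measurable] = \<xi>_measurable[OF q]
  have ind: "indep_var (PiM {1..<q} (\<lambda>_. borel)) (\<lambda>\<omega>. restrict (\<lambda>i. \<xi> i \<omega>) {1..<q}) (PiM {q} (\<lambda>_. borel)) (\<lambda>\<omega>. restrict (\<lambda>i. \<xi> i \<omega>) {q})"
    using q by (intro indep_var_restrict[OF \<xi>_indep]) auto
  have V [measurable]: "V \<in> borel_measurable M"
    unfolding V_def using indep_var_rv1[OF ind] Y by (rule measurable_compose)
  have hz [measurable]: "(\<lambda>y. h y z) \<in> borel_measurable borel" for z
    using measurable_compose[of "\<lambda>y. (y, z)" borel borel, OF _ h] by (simp add: borel_measurable_Pair)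
  have hV [measurable]: "(\<lambda>\<omega>. h (V \<omega>) z) \<in> borel_measurable M" for z
    by (rule measurable_compose[OF V hz])
  have int: "integrable M (\<lambda>\<omega>. h (V \<omega>) z)" for z using C by (intro integrable_const_bound[where B=C]) auto
  have prod: "expectation (\<lambda>\<omega>. h (V \<omega>) z * of_bool (\<xi> q \<omega> = z)) = expectation (\<lambda>\<omega>. h (V \<omega>) z) / 4"
    "integrable M (\<lambda>\<omega>. h (V \<omega>) z * of_bool (\<xi> q \<omega> = z))" if z: "z \<in> unit_steps" for z
  proof -
    have "indep_var borel ((\<lambda>f. h (Y f) z) \<circ> (\<lambda>\<omega>. restrict (\<lambda>i. \<xi> i \<omega>) {1..<q})) borel ((\<lambda>f. of_bool (f q = z) :: real) \<circ> (\<lambda>\<omega>. restrict (\<lambda>i. \<xi> i \<omega>) {q}))"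
    proof (rule indep_var_compose[OF ind])
      show "(\<lambda>f. h (Y f) z) \<in> borel_measurable (PiM {1..<q} (\<lambda>_. borel))" by (rule measurable_compose[OF Y hz])
      have [measurable]: "(\<lambda>f. f q) \<in> borel_measurable (PiM {q} (\<lambda>_. borel :: (real^2) measure))" by (rule measurable_component_singleton) simp
      show "(\<lambda>f. of_bool (f q = z) :: real) \<in> borel_measurable (PiM {q} (\<lambda>_. borel))" by measurable
    qed
    then have "indep_var borel (\<lambda>\<omega>. h (V \<omega>) z) borel (\<lambda>\<omega>. of_bool (\<xi> q \<omega> = z) :: real)"
      by (simp add: comp_def V_def)
    moreover have "integrable M (\<lambda>\<omega>. of_bool (\<xi> q \<omega> = z) :: real)" by (rule integrable_const_bound[where B=1]) auto
    moreover have "expectation (\<lambda>\<omega>. of_bool (\<xi> q \<omega> = z) :: real) = 1 / 4"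
      using step_prob[OF q z] by (simp add: expectation_of_bool)
    ultimately show "expectation (\<lambda>\<omega>. h (V \<omega>) z * of_bool (\<xi> q \<omega> = z)) = expectation (\<lambda>\<omega>. h (V \<omega>) z) / 4"
      "integrable M (\<lambda>\<omega>. h (V \<omega>) z * of_bool (\<xi> q \<omega> = z))"
      using int[of z] by (simp_all add: indep_var_lebesgue_integral indep_var_integrable)
  qed
  have hq [measurable]: "(\<lambda>\<omega>. h (V \<omega>) (\<xi> q \<omega>)) \<in> borel_measurable M"
    using measurable_compose[of "\<lambda>\<omega>. (V \<omega>, \<xi> q \<omega>)" M borel, OF _ h] by (simp add: borel_measurable_Pair)
  have "expectation (\<lambda>\<omega>. h (V \<omega>) (\<xi> q \<omega>)) = expectation (\<lambda>\<omega>. \<Sum>z\<in>unit_steps. h (V \<omega>) z * of_bool (\<xi> q \<omega> = z))"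
  proof (rule integral_cong_AE)
    show "AE \<omega> in M. h (V \<omega>) (\<xi> q \<omega>) = (\<Sum>z\<in>unit_steps. h (V \<omega>) z * of_bool (\<xi> q \<omega> = z))"
      using step_values[OF q]
    proof eventually_elim
      fix \<omega> assume "\<xi> q \<omega> \<in> unit_steps"
      then have "(\<Sum>z\<in>unit_steps. h (V \<omega>) z * of_bool (\<xi> q \<omega> = z)) = (\<Sum>z\<in>{\<xi> q \<omega>}. h (V \<omega>) z * of_bool (\<xi> q \<omega> = z))"
        by (intro sum.mono_neutral_right) (auto simp: card_unit_steps)
      then show "h (V \<omega>) (\<xi> q \<omega>) = (\<Sum>z\<in>unit_steps. h (V \<omega>) z * of_bool (\<xi> q \<omega> = z))" by simp
    qed
  qed measurable
  also have "\<dots> = (\<Sum>z\<in>unit_steps. expectation (\<lambda>\<omega>. h (V \<omega>) z) / 4)"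
    by (subst Bochner_Integration.integral_sum, erule prod(2), rule sum.cong[OF refl], erule prod(1))
  also have "\<dots> = expectation (\<lambda>\<omega>. (\<Sum>z\<in>unit_steps. h (V \<omega>) z) / 4)"
    using int by (simp add: Bochner_Integration.integral_sum sum_divide_distrib)
  finally show ?thesis unfolding V_def .
qed

end

section \<open>One step of the Euler chain\<close>


text \<open>With \<open>h\<close> the expected number of jumps in a cell, these compare the probabilities of no jump, one jump and several
jumps with \<open>1 - h\<close>, \<open>h\<close> and \<open>0\<close>.\<close>

lemma poisson_estimates:
  fixes h :: real
  assumes "h \<ge> 0"
  shows "\<bar>exp (- h) - 1 + h\<bar> \<le> h\<^sup>2" "\<bar>h * exp (- h) - h\<bar> \<le> h\<^sup>2" "1 - exp (- h) - h * exp (- h) \<le> h\<^sup>2"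
proof -
  have 1: "exp (- h) \<ge> 1 - h" using exp_ge_add_one_self[of "- h"] by simp
  have 2: "exp (- h) * (1 + h) \<le> 1"
  proof -
    have "exp (- h) * (1 + h) \<le> exp (- h) * exp h" using exp_ge_add_one_self[of h] by (intro mult_left_mono) auto
    then show ?thesis by (simp add: exp_minus)
  qed
  have 3: "h * exp (- h) \<ge> h * (1 - h)" using 1 assms by (intro mult_left_mono) auto
  have 4: "exp (- h) \<le> 1" using assms by simp
  have 5: "h * exp (- h) \<le> h * 1" using 4 assms by (intro mult_left_mono) auto
  show "\<bar>exp (- h) - 1 + h\<bar> \<le> h\<^sup>2"
    using 1 2 3 by (simp add: abs_le_iff power2_eq_square algebra_simps)
  show "\<bar>h * exp (- h) - h\<bar> \<le> h\<^sup>2"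
    using 3 5 by (simp add: abs_le_iff power2_eq_square algebra_simps)
  show "1 - exp (- h) - h * exp (- h) \<le> h\<^sup>2"
    using 1 2 3 by (simp add: power2_eq_square algebra_simps)
qed

context driving_noise_grid
begin

lemma increment_prob:
  assumes "j < m"
  shows "prob {\<omega> \<in> space M. increment (Suc j) \<omega> = d} = (rate * (\<tau> (Suc j) - \<tau> j)) ^ d / fact d * exp (- (rate * (\<tau> (Suc j) - \<tau> j)))"
proof -
  have t: "\<tau> j > 0" "\<tau> j < \<tau> (Suc j)" using assms \<tau>_pos \<tau>_Suc by auto
  have [measurable]: "increment (Suc j) \<in> measurable M (count_space UNIV)" using assms by (intro increment_measurable) auto
  have "distr M (count_space UNIV) (\<lambda>\<omega>. N (\<tau> (Suc j)) \<omega> - N (\<tau> j) \<omega>) = measure_pmf (poisson_pmf (rate * (\<tau> (Suc j) - \<tau> j)))"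
    using poisson t unfolding poisson_process_def by (auto simp: less_imp_le)
  also have "(\<lambda>\<omega>. N (\<tau> (Suc j)) \<omega> - N (\<tau> j) \<omega>) = increment (Suc j)"
    using assms obs_time_Suc[of j] obs_time_Suc[of "Suc j"] by (simp add: increment_def[abs_def])
  finally have "measure (distr M (count_space UNIV) (increment (Suc j))) {d} = pmf (poisson_pmf (rate * (\<tau> (Suc j) - \<tau> j))) d"
    by (simp add: pmf.rep_eq)
  also have "measure (distr M (count_space UNIV) (increment (Suc j))) {d} = prob {\<omega> \<in> space M. increment (Suc j) \<omega> = d}"
    by (subst measure_distr) (auto intro!: arg_cong[where f=prob])
  finally show ?thesis using rate t by simp
qed

context
  fixes \<epsilon> \<sigma> :: real and v :: "real \<Rightarrow> real^2 \<Rightarrow> real^2" and x :: "real^2"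
  assumes v: "\<And>i. i < m \<Longrightarrow> continuous_on UNIV (v (\<tau> i))"
begin

text \<open>The chain as a function of marks and count history, the form in which measurability and freezing apply.\<close>

definition Y :: "nat \<Rightarrow> (nat \<Rightarrow> real^2) \<times> (nat \<Rightarrow> nat) \<Rightarrow> real^2" where
  "Y j z = euler \<epsilon> \<sigma> v \<tau> x (fst z) (partial_count (snd z)) j"

definition chain :: "nat \<Rightarrow> 'a \<Rightarrow> real^2" where
  "chain j \<omega> = euler \<epsilon> \<sigma> v \<tau> x (\<lambda>n. \<xi> n \<omega>) (partial_count (\<lambda>i. increment i \<omega>)) j"

lemma Y_measurable: "j \<le> m \<Longrightarrow> Y j \<in> borel_measurable (mark_space \<Otimes>\<^sub>M count_history j)"
  unfolding Y_def[abs_def] by (rule euler_measurable) (use v in auto)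

lemma chain_eq: "chain j \<omega> = Y j (marks \<omega>, history j \<omega>)"
  unfolding chain_def Y_def fst_conv snd_conv
  by (rule euler_cong) (auto simp: marks_def history_def partial_count_restrict intro: partial_count_mono)

lemma chain_measurable:
  assumes "j \<le> m" shows "chain j \<in> borel_measurable M"
proof -
  have "(\<lambda>\<omega>. (marks \<omega>, history j \<omega>)) \<in> measurable M (mark_space \<Otimes>\<^sub>M count_history j)"
    by (intro measurable_Pair marks_measurable history_measurable assms)
  from measurable_compose[OF this Y_measurable[OF assms]] show ?thesis unfolding chain_eq[abs_def] .
qed

text \<open>The first mark not used up to grid point \<open>j\<close>; its index is random.\<close>

definition next_mark :: "nat \<Rightarrow> 'a \<Rightarrow> real^2" where
  "next_mark j \<omega> = \<xi> (Suc (partial_count (\<lambda>i. increment i \<omega>) j)) \<omega>"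

definition jump :: "nat \<Rightarrow> real^2 \<Rightarrow> real^2 \<Rightarrow> real^2" where
  "jump j y z = y + \<epsilon> *\<^sub>R v (\<tau> j) y + \<sigma> *\<^sub>R z"

lemma chain_Suc_0: "increment (Suc j) \<omega> = 0 \<Longrightarrow> chain (Suc j) \<omega> = chain j \<omega>"
  by (simp add: chain_def partial_count_Suc)

lemma chain_Suc_1: "increment (Suc j) \<omega> = 1 \<Longrightarrow> chain (Suc j) \<omega> = jump j (chain j \<omega>) (next_mark j \<omega>)"
proof -
  assume d: "increment (Suc j) \<omega> = 1"
  have "{k<..Suc k} = {Suc k}" for k by auto
  then show ?thesis by (simp add: chain_def partial_count_Suc d jump_def next_mark_def)
qed

lemma jump_measurable: "j < m \<Longrightarrow> (\<lambda>p. jump j (fst p) (snd p)) \<in> borel_measurable borel"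
  unfolding jump_def using v[of j]
  by (intro borel_measurable_continuous_onI continuous_intros continuous_on_compose2[OF v[of j]]) auto

lemma next_mark_history: "next_mark j \<omega> = marks \<omega> (Suc (partial_count (history j \<omega>) j))"
  by (simp add: next_mark_def marks_def history_def partial_count_restrict)

lemma next_mark_pair_measurable:
  assumes j: "j \<le> m"
  shows "(\<lambda>z. fst z (Suc (partial_count (snd z) j))) \<in> borel_measurable (mark_space \<Otimes>\<^sub>M count_history j)"
proof -
  have "(\<lambda>z. fst z (Suc a)) \<in> borel_measurable (mark_space \<Otimes>\<^sub>M count_history j)" for a
    by (rule measurable_compose[OF measurable_fst measurable_component_singleton]) simp
  from measurable_compose_countable[OF this measurable_compose[OF measurable_snd partial_count_measurable[OF order_refl]]]
  show ?thesis .
qed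

text \<open>Given the counts, the index of the next mark is fixed and that mark is independent of the chain, which depends
on earlier marks only.\<close>

lemma next_mark_uniform:
  fixes g :: "real^2 \<Rightarrow> real"
  assumes j: "j < m" and g: "g \<in> borel_measurable borel" and C: "\<And>y. \<bar>g y\<bar> \<le> C"
  shows "expectation (\<lambda>\<omega>. g (jump j (chain j \<omega>) (next_mark j \<omega>))) = expectation (\<lambda>\<omega>. (\<Sum>z\<in>unit_steps. g (jump j (chain j \<omega>) z)) / 4)"
proof -
  let ?P = "mark_space \<Otimes>\<^sub>M count_history j"
  have jm: "j \<le> m" using j by simp
  have h: "(\<lambda>p. g (jump j (fst p) (snd p))) \<in> borel_measurable borel"
    by (rule measurable_compose[OF jump_measurable[OF j] g])
  define F where "F z = g (jump j (Y j z) (fst z (Suc (partial_count (snd z) j))))" for z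
  define G where "G z = (\<Sum>e\<in>unit_steps. g (jump j (Y j z) e)) / 4" for z
  have he: "(\<lambda>y. g (jump j y e)) \<in> borel_measurable borel" for e
    using measurable_compose[of "\<lambda>y. (y, e)" borel borel, OF _ h] by (simp add: borel_measurable_Pair)
  have F: "F \<in> borel_measurable ?P"
    unfolding F_def using measurable_compose[OF borel_measurable_Pair[OF Y_measurable[OF jm] next_mark_pair_measurable[OF jm]] h] by simp
  have G: "G \<in> borel_measurable ?P"
    unfolding G_def by (intro borel_measurable_divide borel_measurable_sum measurable_compose[OF Y_measurable[OF jm] he] borel_measurable_const)
  have GC: "\<bar>G z\<bar> \<le> C" for z
  proof -
    have "\<bar>\<Sum>e\<in>unit_steps. g (jump j (Y j z) e)\<bar> \<le> (\<Sum>e\<in>unit_steps. C)"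
      by (rule order_trans[OF sum_abs]) (intro sum_mono C)
    then show ?thesis by (simp add: G_def card_unit_steps)
  qed
  have eq: "expectation (\<lambda>\<omega>'. F (marks \<omega>', r)) = expectation (\<lambda>\<omega>'. G (marks \<omega>', r))" for r
  proof -
    define q where "q = Suc (partial_count r j)"
    define V where "V f = euler \<epsilon> \<sigma> v \<tau> x f (partial_count r) j" for f
    have "expectation (\<lambda>\<omega>. g (jump j (V (restrict (\<lambda>i. \<xi> i \<omega>) {1..<q})) (\<xi> q \<omega>))) =
      expectation (\<lambda>\<omega>. (\<Sum>z\<in>unit_steps. g (jump j (V (restrict (\<lambda>i. \<xi> i \<omega>) {1..<q})) z)) / 4)"
    proof (rule mark_expectation[where h="\<lambda>y z. g (jump j y z)" and C=C])
      show "V \<in> borel_measurable (PiM {1..<q} (\<lambda>_. borel))"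
        unfolding V_def[abs_def]
      proof (rule euler_measurable_marks)
        show "continuous_on UNIV (v (\<tau> i))" if "i < j" for i using v that j by simp
        show "{1..partial_count r i} \<subseteq> {1..<q}" if "i \<le> j" for i
          using partial_count_mono[OF that, of r] by (auto simp: q_def)
      qed
    qed (auto simp: q_def C h)
    moreover have "V (restrict (\<lambda>i. \<xi> i \<omega>) {1..<q}) = Y j (marks \<omega>, r)" for \<omega>
      unfolding V_def Y_def fst_conv snd_conv
      by (rule euler_cong) (auto simp: q_def marks_def intro: partial_count_mono)
    moreover have "\<xi> q \<omega> = marks \<omega> (Suc (partial_count r j))" for \<omega> by (simp add: marks_def q_def)
    ultimately show ?thesis by (simp add: F_def G_def)
  qed
  have "expectation (\<lambda>\<omega>. g (jump j (chain j \<omega>) (next_mark j \<omega>))) = expectation (\<lambda>\<omega>. F (marks \<omega>, history j \<omega>))"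
    by (simp add: F_def chain_eq next_mark_history)
  also have "\<dots> = expectation (\<lambda>\<omega>. G (marks \<omega>, history j \<omega>))"
    using freeze[OF marks_history_independent[OF jm] F, of C] freeze[OF marks_history_independent[OF jm] G GC] C
    by (simp add: eq) (simp add: F_def)
  finally show ?thesis by (simp add: G_def chain_eq)
qed

text \<open>Up to an error quadratic in the expected number of jumps, one step of the chain applies the generator of the
jump process with uniform steps.\<close>

lemma one_step:
  fixes g :: "real^2 \<Rightarrow> real"
  assumes j: "j < m" and g: "g \<in> borel_measurable borel" and C: "\<And>y. \<bar>g y\<bar> \<le> C"
  defines "h \<equiv> rate * (\<tau> (Suc j) - \<tau> j)"
  shows "\<bar>expectation (\<lambda>\<omega>. g (chain (Suc j) \<omega>)) - expectation (\<lambda>\<omega>. g (chain j \<omega>))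
     - h * (expectation (\<lambda>\<omega>. (\<Sum>z\<in>unit_steps. g (jump j (chain j \<omega>) z)) / 4) - expectation (\<lambda>\<omega>. g (chain j \<omega>)))\<bar> \<le> 3 * C * h\<^sup>2"
proof -
  have jm: "j \<le> m" "Suc j \<le> m" using j by auto
  let ?P = "mark_space \<Otimes>\<^sub>M count_history j"
  have hh: "h \<ge> 0" unfolding h_def using rate \<tau>_Suc[OF j] by simp
  have [measurable]: "increment (Suc j) \<in> measurable M (count_space UNIV)" by (rule increment_measurable[OF jm(2)])
  have hg: "(\<lambda>p. g (jump j (fst p) (snd p))) \<in> borel_measurable borel"
    by (rule measurable_compose[OF jump_measurable[OF j] g])
  define a where "a \<omega> = g (chain j \<omega>)" for \<omega>
  define b where "b \<omega> = g (jump j (chain j \<omega>) (next_mark j \<omega>))" for \<omega>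
  define c where "c \<omega> = g (chain (Suc j) \<omega>)" for \<omega>
  have a1: "(\<lambda>z. g (Y j z)) \<in> borel_measurable ?P" by (rule measurable_compose[OF Y_measurable[OF jm(1)] g])
  have b1: "(\<lambda>z. g (jump j (Y j z) (fst z (Suc (partial_count (snd z) j))))) \<in> borel_measurable ?P"
    using measurable_compose[OF borel_measurable_Pair[OF Y_measurable[OF jm(1)] next_mark_pair_measurable[OF jm(1)]] hg] by simp
  have mh: "(\<lambda>\<omega>. (marks \<omega>, history j \<omega>)) \<in> measurable M ?P"
    by (intro measurable_Pair marks_measurable history_measurable jm)
  have aeq: "a \<omega> = g (Y j (marks \<omega>, history j \<omega>))" for \<omega> by (simp add: a_def chain_eq)
  have beq: "b \<omega> = (\<lambda>z. g (jump j (Y j z) (fst z (Suc (partial_count (snd z) j))))) (marks \<omega>, history j \<omega>)" for \<omega>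
    by (simp add: b_def chain_eq next_mark_history)
  have [measurable]: "a \<in> borel_measurable M" unfolding aeq[abs_def] by (rule measurable_compose[OF mh a1])
  have [measurable]: "b \<in> borel_measurable M" unfolding beq[abs_def] by (rule measurable_compose[OF mh b1])
  have [measurable]: "c \<in> borel_measurable M" unfolding c_def[abs_def] by (rule measurable_compose[OF chain_measurable[OF jm(2)] g])
  have bd: "\<bar>a \<omega>\<bar> \<le> C" "\<bar>b \<omega>\<bar> \<le> C" "\<bar>c \<omega>\<bar> \<le> C" for \<omega> using C by (auto simp: a_def b_def c_def)
  have C0: "C \<ge> 0" using C[of 0] by linarith
  have int: "integrable M f" if "f \<in> borel_measurable M" "\<And>\<omega>. \<bar>f \<omega>\<bar> \<le> C" for f :: "'a \<Rightarrow> real"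
    using that by (intro integrable_const_bound[where B=C]) auto
  define p where "p d = prob {\<omega> \<in> space M. increment (Suc j) \<omega> = d}" for d
  have p0: "p 0 = exp (- h)" and p1: "p 1 = h * exp (- h)" unfolding p_def increment_prob[OF j] h_def by auto
  have A: "expectation (\<lambda>\<omega>. of_bool (increment (Suc j) \<omega> = d) * a \<omega>) = p d * expectation a" for d
    unfolding aeq[abs_def] p_def by (rule expectation_increment[OF j a1 C])
  have B: "expectation (\<lambda>\<omega>. of_bool (increment (Suc j) \<omega> = d) * b \<omega>) = p d * expectation b" for d
    unfolding beq[abs_def] p_def by (rule expectation_increment[OF j b1 C])
  define R where "R \<omega> = of_bool (increment (Suc j) \<omega> \<noteq> 0 \<and> increment (Suc j) \<omega> \<noteq> 1) * c \<omega>" for \<omega>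
  have [measurable]: "R \<in> borel_measurable M" unfolding R_def by measurable
  \<comment> \<open>No jump, exactly one jump, and the rest.\<close>
  have "c \<omega> = of_bool (increment (Suc j) \<omega> = 0) * a \<omega> + of_bool (increment (Suc j) \<omega> = 1) * b \<omega> + R \<omega>" for \<omega>
    using chain_Suc_0[of j \<omega>] chain_Suc_1[of j \<omega>] by (auto simp: a_def b_def c_def R_def)
  then have "c = (\<lambda>\<omega>. of_bool (increment (Suc j) \<omega> = 0) * a \<omega> + of_bool (increment (Suc j) \<omega> = 1) * b \<omega> + R \<omega>)"
    by (rule ext)
  then have "expectation c = expectation (\<lambda>\<omega>. of_bool (increment (Suc j) \<omega> = 0) * a \<omega> + of_bool (increment (Suc j) \<omega> = 1) * b \<omega> + R \<omega>)"
    by (rule arg_cong)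
  also have "\<dots> = expectation (\<lambda>\<omega>. of_bool (increment (Suc j) \<omega> = 0) * a \<omega>) + expectation (\<lambda>\<omega>. of_bool (increment (Suc j) \<omega> = 1) * b \<omega>) + expectation R"
  proof -
    have "integrable M (\<lambda>\<omega>. of_bool (increment (Suc j) \<omega> = 0) * a \<omega>)" "integrable M (\<lambda>\<omega>. of_bool (increment (Suc j) \<omega> = 1) * b \<omega>)" "integrable M R"
      using bd C0 by (auto intro!: int simp: R_def)
    then show ?thesis by simp
  qed
  finally have c: "expectation c = exp (- h) * expectation a + h * exp (- h) * expectation b + expectation R"
    unfolding A B p0 p1 .
  have R: "\<bar>expectation R\<bar> \<le> C * h\<^sup>2"
  proof -
    have "\<bar>expectation R\<bar> \<le> expectation (\<lambda>\<omega>. \<bar>R \<omega>\<bar>)" using integral_norm_bound[of M R] by simp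
    also have "\<dots> \<le> expectation (\<lambda>\<omega>. C * (1 - of_bool (increment (Suc j) \<omega> = 0) - of_bool (increment (Suc j) \<omega> = 1)))"
    proof (rule integral_mono)
      show "integrable M (\<lambda>\<omega>. \<bar>R \<omega>\<bar>)" using bd C0 by (intro int) (auto simp: R_def)
      show "integrable M (\<lambda>\<omega>. C * (1 - of_bool (increment (Suc j) \<omega> = 0) - of_bool (increment (Suc j) \<omega> = 1)))" 
        using C0 by (intro int) (auto)
    qed (use bd C0 in \<open>auto simp: R_def\<close>)
    also have "\<dots> = C * (1 - p 0 - p 1)"
    proof -
      have i: "integrable M (\<lambda>\<omega>. of_bool (increment (Suc j) \<omega> = d) :: real)" for d by (rule integrable_const_bound[where B=1]) auto
      have "expectation (\<lambda>\<omega>. 1 - of_bool (increment (Suc j) \<omega> = 0) - of_bool (increment (Suc j) \<omega> = 1) :: real) = 1 - p 0 - p 1"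
        using i[of 0] i[of 1] unfolding p_def expectation_of_bool[symmetric] by (simp add: prob_space)
      then show ?thesis by simp
    qed
    also have "\<dots> \<le> C * h\<^sup>2" using poisson_estimates(3)[OF hh] C0 unfolding p0 p1 by (intro mult_left_mono)
    finally show ?thesis .
  qed
  have "\<bar>expectation c - expectation a - h * (expectation b - expectation a)\<bar> =
     \<bar>(exp (- h) - 1 + h) * expectation a + (h * exp (- h) - h) * expectation b + expectation R\<bar>"
    unfolding c by (simp add: algebra_simps)
  also have "\<dots> \<le> \<bar>exp (- h) - 1 + h\<bar> * \<bar>expectation a\<bar> + \<bar>h * exp (- h) - h\<bar> * \<bar>expectation b\<bar> + \<bar>expectation R\<bar>"
    unfolding abs_mult[symmetric] by linarith
  also have "\<dots> \<le> h\<^sup>2 * C + h\<^sup>2 * C + C * h\<^sup>2"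
    using poisson_estimates(1,2)[OF hh] abs_expectation_le[of a C] abs_expectation_le[of b C] bd R by (intro add_mono mult_mono) auto
  finally have "\<bar>expectation c - expectation a - h * (expectation b - expectation a)\<bar> \<le> 3 * C * h\<^sup>2" by simp
  moreover have "expectation b = expectation (\<lambda>\<omega>. (\<Sum>z\<in>unit_steps. g (jump j (chain j \<omega>) z)) / 4)"
    unfolding b_def by (rule next_mark_uniform[OF j g C])
  ultimately show ?thesis unfolding a_def c_def by simp
qed

end

end

section \<open>Consistency of the generator\<close>


lemma jointly_continuous_uniform_in_time:
  fixes f :: "real \<Rightarrow> real^2 \<Rightarrow> 'b::metric_space"
  assumes f: "jointly_continuous T f" and per: "\<And>s. s \<in> {0..T} \<Longrightarrow> torus_periodic (f s)" and e: "e > 0"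
  obtains d where "d > 0" "\<And>r s x. r \<in> {0..T} \<Longrightarrow> s \<in> {0..T} \<Longrightarrow> \<bar>r - s\<bar> < d \<Longrightarrow> dist (f r x) (f s x) < e"
proof -
  have "uniformly_continuous_on ({0..T} \<times> torus_cell) (\<lambda>(r, x). f r x)"
    by (rule compact_uniformly_continuous)
       (auto intro!: compact_Times continuous_on_subset[OF f[unfolded jointly_continuous_def]] simp: torus_cell_def)
  then obtain d where d: "d > 0" "\<And>z z'. z \<in> {0..T} \<times> torus_cell \<Longrightarrow> z' \<in> {0..T} \<times> torus_cell \<Longrightarrow> dist z' z < d \<Longrightarrow>
      dist ((\<lambda>(r, x). f r x) z') ((\<lambda>(r, x). f r x) z) < e"
    unfolding uniformly_continuous_on_def using e by metis
  show ?thesis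
  proof (rule that[OF d(1)])
    fix r s x assume rs: "r \<in> {0..T}" "s \<in> {0..T}" "\<bar>r - s\<bar> < d"
    obtain y where y: "y \<in> torus_cell" "\<And>g :: real^2 \<Rightarrow> 'b. torus_periodic g \<Longrightarrow> g x = g y"
      using periodic_representative[of x] by blast
    have "dist (f r y) (f s y) < e"
      using d(2)[of "(s, y)" "(r, y)"] rs y(1) by (auto simp: dist_Pair_Pair dist_real_def)
    then show "dist (f r x) (f s x) < e" using y(2)[OF per] rs by simp
  qed
qed

lemma vec_axis_expansion: "a = (a $ 1) *\<^sub>R axis 1 1 + (a $ 2) *\<^sub>R (axis 2 1 :: real^2)"
  by (simp add: vec_eq_iff forall_2 axis_def)

lemma gradient_lipschitz:
  fixes f :: "real^2 \<Rightarrow> real"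
  assumes d: "\<And>i. has_partial i f (f' i)" and B: "\<And>i y. \<bar>f' i y\<bar> \<le> B"
  shows "\<bar>f (y + a) - f y\<bar> \<le> B * (\<bar>a $ 1\<bar> + \<bar>a $ 2\<bar>)"
proof -
  have "y + a = (y + (a $ 1) *\<^sub>R axis 1 1) + (a $ 2) *\<^sub>R axis 2 1" using vec_axis_expansion[of a] by (simp add: add.assoc)
  then have "f (y + a) - f y = (f ((y + (a $ 1) *\<^sub>R axis 1 1) + (a $ 2) *\<^sub>R axis 2 1) - f (y + (a $ 1) *\<^sub>R axis 1 1)) + (f (y + (a $ 1) *\<^sub>R axis 1 1) - f y)"
    by (simp only:)
  also have "\<bar>\<dots>\<bar> \<le> B * \<bar>a $ 2\<bar> + B * \<bar>a $ 1\<bar>"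
    using axis_lipschitz[OF d[of 2] B, where x="y + (a $ 1) *\<^sub>R axis 1 1" and h="a $ 2"]
      axis_lipschitz[OF d[of 1] B, where x=y and h="a $ 1"] by linarith
  finally show ?thesis by (simp add: distrib_left)
qed

text \<open>The noise is expanded first, around the point already moved by the drift: the symmetric second differences give
\<open>(\<sigma>\<^sup>2 / 4) \<Delta> g = \<epsilon> \<nu> \<Delta> g\<close> up to fourth order, and \<open>\<sigma>\<^sup>4\<close> is of order \<open>\<epsilon>\<^sup>2\<close>. The drift is then
expanded one axis at a time.\<close>

lemma generator_estimate:
  fixes g :: "real^2 \<Rightarrow> real" and b :: "real^2"
  assumes g: "Ck 4 g" and B: "\<And>ds y. length ds \<le> 4 \<Longrightarrow> \<bar>partials ds g y\<bar> \<le> B"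
    and V: "norm b \<le> V" and \<epsilon>: "\<epsilon> > 0" and \<nu>: "\<nu> \<ge> 0"
  shows "\<bar>(\<Sum>z\<in>unit_steps. g (y + \<epsilon> *\<^sub>R b + sqrt (\<epsilon> * (4 * \<nu>)) *\<^sub>R z)) / 4 - g y
     - \<epsilon> * (b $ 1 * partials [1] g y + b $ 2 * partials [2] g y + \<nu> * (partials [1,1] g y + partials [2,2] g y))\<bar>
     \<le> B * (8 * \<nu>\<^sup>2 + 3 * V\<^sup>2 + 4 * \<nu> * V) * \<epsilon>\<^sup>2"
proof -
  define \<sigma> where "\<sigma> = sqrt (\<epsilon> * (4 * \<nu>))"
  define P where "P ds = partials ds g" for ds
  have dP: "has_partial i (P ds) (P (i # ds))" if "length ds < 4" for ds i
    unfolding P_def by (rule Ck_has_partial[OF g that])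
  have BP: "\<bar>P ds y\<bar> \<le> B" if "length ds \<le> 4" for ds y using B[OF that] by (simp add: P_def)
  have P0: "P [] = g" by (simp add: P_def)
  have dP0: "has_partial i g (P [i])" for i using dP[of "[]" i] by (simp add: P0)
  have B0: "B \<ge> 0" using BP[of "[]" y] by simp
  have s2: "\<sigma>\<^sup>2 = 4 * \<nu> * \<epsilon>" using \<epsilon> \<nu> by (simp add: \<sigma>_def)
  have s4: "\<sigma>^4 = 16 * \<nu>\<^sup>2 * \<epsilon>\<^sup>2"
  proof -
    have "\<sigma>^4 = (\<sigma>\<^sup>2)\<^sup>2" by simp
    then show ?thesis unfolding s2 by (simp add: power_mult_distrib)
  qed
  have V0: "V \<ge> 0" using V norm_ge_zero[of b] by linarith
  have bV: "\<bar>b $ i\<bar> \<le> V" for i using V component_le_norm_cart[of b i] by linarith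
  \<comment> \<open>The drift is split into a step along the first axis and a step along the second.\<close>
  define y1 where "y1 = y + (\<epsilon> * b $ 1) *\<^sub>R axis 1 1"
  define y2 where "y2 = y + \<epsilon> *\<^sub>R b"
  have y2: "y2 = y1 + (\<epsilon> * b $ 2) *\<^sub>R axis 2 1"
    by (simp add: y1_def y2_def vec_eq_iff forall_2 axis_def)
  have sym: "\<bar>g (y2 + \<sigma> *\<^sub>R axis i 1) + g (y2 - \<sigma> *\<^sub>R axis i 1) - 2 * g y2 - \<sigma>\<^sup>2 * P [i,i] y2\<bar> \<le> B * \<sigma>^4" for i
    using axis_taylor_sym[of i "P []" "P [i]" "P [i,i]" "P [i,i,i]" "P [i,i,i,i]" B y2 \<sigma>] dP dP0 BP by (simp add: P0)
  define S where "S = (\<Sum>z\<in>unit_steps. g (y2 + \<sigma> *\<^sub>R z))"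
  have "S = (g (y2 + \<sigma> *\<^sub>R axis 1 1) + g (y2 - \<sigma> *\<^sub>R axis 1 1)) + (g (y2 + \<sigma> *\<^sub>R axis 2 1) + g (y2 - \<sigma> *\<^sub>R axis 2 1))"
    by (simp add: S_def sum_unit_steps)
  then have "\<bar>S / 4 - g y2 - \<sigma>\<^sup>2 / 4 * (P [1,1] y2 + P [2,2] y2)\<bar> \<le> B * \<sigma>^4 / 2"
    using sym[of 1] sym[of 2] by (simp add: abs_le_iff field_simps)
  then have e1: "\<bar>S / 4 - g y2 - \<nu> * \<epsilon> * (P [1,1] y2 + P [2,2] y2)\<bar> \<le> 8 * B * \<nu>\<^sup>2 * \<epsilon>\<^sup>2"
    by (simp add: s2 s4 mult_ac)
  have sq: "B * (\<epsilon> * b $ i)\<^sup>2 \<le> B * V\<^sup>2 * \<epsilon>\<^sup>2" for i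
  proof -
    have "(b $ i)\<^sup>2 \<le> V\<^sup>2" using bV[of i] by (simp add: abs_le_square_iff[symmetric] V0)
    then have "B * ((b $ i)\<^sup>2 * \<epsilon>\<^sup>2) \<le> B * (V\<^sup>2 * \<epsilon>\<^sup>2)" using B0 by (intro mult_left_mono mult_right_mono) auto
    then show ?thesis by (simp add: power_mult_distrib mult_ac)
  qed
  have e2: "\<bar>g y1 - g y - \<epsilon> * b $ 1 * P [1] y\<bar> \<le> B * V\<^sup>2 * \<epsilon>\<^sup>2"
    using axis_taylor1[of 1 "P []" "P [1]" "P [1,1]" B y "\<epsilon> * b $ 1"] dP dP0 BP sq[of 1] by (simp add: P0 y1_def)
  have e3: "\<bar>g y2 - g y1 - \<epsilon> * b $ 2 * P [2] y1\<bar> \<le> B * V\<^sup>2 * \<epsilon>\<^sup>2"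
    using axis_taylor1[of 2 "P []" "P [2]" "P [2,2]" B y1 "\<epsilon> * b $ 2"] dP dP0 BP sq[of 2] by (simp add: P0 y2)
  have eb: "\<bar>\<epsilon> * b $ i\<bar> \<le> \<epsilon> * V" for i using bV[of i] \<epsilon> by (simp add: abs_mult)
  have "\<bar>P [2] y1 - P [2] y\<bar> \<le> B * \<bar>\<epsilon> * b $ 1\<bar>"
    unfolding y1_def by (rule axis_lipschitz[OF dP[of "[2]" 1] BP]) auto
  also have "\<dots> \<le> B * (\<epsilon> * V)" by (rule mult_left_mono[OF eb B0])
  finally have "\<bar>\<epsilon> * b $ 2\<bar> * \<bar>P [2] y1 - P [2] y\<bar> \<le> (\<epsilon> * V) * (B * (\<epsilon> * V))"
    using eb[of 2] \<epsilon> V0 by (intro mult_mono) auto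
  then have e4: "\<bar>\<epsilon> * b $ 2 * P [2] y1 - \<epsilon> * b $ 2 * P [2] y\<bar> \<le> B * V\<^sup>2 * \<epsilon>\<^sup>2"
    by (simp add: abs_mult[symmetric] right_diff_distrib[symmetric] power2_eq_square mult_ac del: right_diff_distrib)
  have e5: "\<bar>P [i,i] y2 - P [i,i] y\<bar> \<le> 2 * B * V * \<epsilon>" for i
  proof -
    have "\<bar>P [i,i] (y + \<epsilon> *\<^sub>R b) - P [i,i] y\<bar> \<le> B * (\<bar>(\<epsilon> *\<^sub>R b) $ 1\<bar> + \<bar>(\<epsilon> *\<^sub>R b) $ 2\<bar>)"
      by (rule gradient_lipschitz[where f'="\<lambda>k. P [k,i,i]"]) (auto intro!: dP BP)
    also have "\<dots> \<le> B * (\<epsilon> * V + \<epsilon> * V)"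
      using eb[of 1] eb[of 2] B0 by (intro mult_left_mono add_mono) auto
    finally show ?thesis by (simp add: y2_def algebra_simps)
  qed
  have "\<bar>(P [1,1] y2 + P [2,2] y2) - (P [1,1] y + P [2,2] y)\<bar> \<le> 4 * B * V * \<epsilon>"
    using e5[of 1] e5[of 2] by linarith
  then have "(\<nu> * \<epsilon>) * \<bar>(P [1,1] y2 + P [2,2] y2) - (P [1,1] y + P [2,2] y)\<bar> \<le> (\<nu> * \<epsilon>) * (4 * B * V * \<epsilon>)"
    using \<nu> \<epsilon> by (intro mult_left_mono) auto
  also have "(\<nu> * \<epsilon>) * \<bar>(P [1,1] y2 + P [2,2] y2) - (P [1,1] y + P [2,2] y)\<bar> = 
      \<bar>\<nu> * \<epsilon> * (P [1,1] y2 + P [2,2] y2) - \<nu> * \<epsilon> * (P [1,1] y + P [2,2] y)\<bar>"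
    using \<nu> \<epsilon> by (simp add: abs_mult right_diff_distrib[symmetric] del: right_diff_distrib)
  finally have e6: "\<bar>\<nu> * \<epsilon> * (P [1,1] y2 + P [2,2] y2) - \<nu> * \<epsilon> * (P [1,1] y + P [2,2] y)\<bar> \<le> 4 * B * \<nu> * V * \<epsilon>\<^sup>2"
    by (simp add: power2_eq_square mult_ac)
  have "\<bar>S / 4 - g y - \<epsilon> * (b $ 1 * P [1] y + b $ 2 * P [2] y + \<nu> * (P [1,1] y + P [2,2] y))\<bar>
     \<le> 8 * B * \<nu>\<^sup>2 * \<epsilon>\<^sup>2 + 3 * (B * V\<^sup>2 * \<epsilon>\<^sup>2) + 4 * B * \<nu> * V * \<epsilon>\<^sup>2"
  proof -
    have "\<epsilon> * (b $ 1 * P [1] y + b $ 2 * P [2] y + \<nu> * (P [1,1] y + P [2,2] y)) =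
       \<epsilon> * b $ 1 * P [1] y + \<epsilon> * b $ 2 * P [2] y + \<nu> * \<epsilon> * (P [1,1] y + P [2,2] y)" by (simp add: algebra_simps)
    then show ?thesis using e1 e2 e3 e4 e6 by linarith
  qed
  also have "\<dots> = B * (8 * \<nu>\<^sup>2 + 3 * V\<^sup>2 + 4 * \<nu> * V) * \<epsilon>\<^sup>2" by (simp add: algebra_simps)
  finally show ?thesis by (simp add: S_def y2_def \<sigma>_def P_def)
qed

section \<open>The particle system for a fixed noise intensity\<close>


text \<open>The parameter \<open>\<epsilon>\<close> is fixed here. The constant \<open>B\<close> concerns the limiting vorticity alone, so the constants \<open>V\<close>,
\<open>consistency\<close> and \<open>growth\<close> below, built from \<open>B\<close>, \<open>\<nu>\<close> and the kernel, do not depend on \<open>\<epsilon>\<close>.\<close>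

locale particle_approximation =
  navier_stokes T \<nu> \<phi> u + biot_savart K + driving_noise M "1 / \<epsilon>" N \<xi>
  for T \<nu> :: real and \<phi> :: "real^2 \<Rightarrow> real^2" and u :: "real \<Rightarrow> real^2 \<Rightarrow> real^2" and K :: "real^2 \<Rightarrow> real^2"
    and M :: "'w measure" and \<epsilon> :: real and N :: "real \<Rightarrow> 'w \<Rightarrow> nat" and \<xi> :: "nat \<Rightarrow> 'w \<Rightarrow> real^2" +
  fixes X :: "real \<Rightarrow> real \<Rightarrow> real^2 \<Rightarrow> 'w \<Rightarrow> real^2" and w :: "real \<Rightarrow> real^2 \<Rightarrow> real" and v :: "real \<Rightarrow> real^2 \<Rightarrow> real^2"
    and B :: real
  assumes \<epsilon>: "\<epsilon> > 0" and \<nu>: "\<nu> \<ge> 0"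
    and system: "particle_system (4 * \<nu>) T K (curl \<phi>) M N \<xi> \<epsilon> X w v"
    and mean: "(LINT x:torus_cell|lborel. \<phi> x) = 0"
    and vort_bound: "\<And>ds s x. length ds \<le> 4 \<Longrightarrow> s \<in> {0..T} \<Longrightarrow> \<bar>partials ds (vort s) x\<bar> \<le> B"
begin

abbreviation \<sigma> :: real where
  "\<sigma> \<equiv> sqrt (\<epsilon> * (4 * \<nu>))"

abbreviation path_euler :: "real \<Rightarrow> nat \<Rightarrow> real^2 \<Rightarrow> 'w \<Rightarrow> real^2" where
  "path_euler s m x \<omega> \<equiv> euler \<epsilon> \<sigma> v (grid s T m) x (\<lambda>k. \<xi> k \<omega>) (\<lambda>i. N (grid s T m i) \<omega>) m"

lemma T_in: "T \<in> {0..T}"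
  using T by simp

lemma curl_final: "curl \<phi> = vort T"
  using curl_eq_vort[OF T_in] final by simp

lemma vort_le: "s \<in> {0..T} \<Longrightarrow> \<bar>vort s x\<bar> \<le> B"
  using vort_bound[of "[]" s x] by simp

lemma B_nonneg: "B \<ge> 0"
  using vort_le[OF T_in, of 0] by linarith

lemma vort_continuous: "s \<in> {0..T} \<Longrightarrow> continuous_on UNIV (vort s)"
  using Ck_continuous[OF C_time_Ck[OF vort_C4], of s "[]"] by simp

lemma vort_measurable: "s \<in> {0..T} \<Longrightarrow> vort s \<in> borel_measurable borel"
  by (rule borel_measurable_continuous_onI[OF vort_continuous])

lemma w_C1: "C_time_Ck_torus T 1 w"
  using system by (simp add: particle_system_def)

lemma w_expectation: "s \<in> {0..T} \<Longrightarrow> w s x = expectation (\<lambda>\<omega>. vort T (X s T x \<omega>))"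
  using system by (simp add: particle_system_def curl_final)

lemma v_conv: "s \<in> {0..T} \<Longrightarrow> v s x = torus_conv K (w s) x"
  using system by (simp add: particle_system_def)

lemma w_bound: "s \<in> {0..T} \<Longrightarrow> \<bar>w s x\<bar> \<le> B"
  unfolding w_expectation by (rule abs_expectation_le[OF vort_le[OF T_in]])

lemma w_continuous: "s \<in> {0..T} \<Longrightarrow> continuous_on UNIV (w s)"
  using Ck_continuous[OF C_time_Ck[OF w_C1], of s "[]"] by simp

lemma w_measurable: "s \<in> {0..T} \<Longrightarrow> w s \<in> borel_measurable borel"
  by (rule borel_measurable_continuous_onI[OF w_continuous])

text \<open>A speed bound for the particle system that does not depend on \<open>\<epsilon>\<close>, from the maximum principle \<open>w_bound\<close>.\<close>

definition V :: real where "V = B * kernel_mass"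

lemma V_nonneg: "V \<ge> 0"
  using B_nonneg kernel_mass_nonneg by (simp add: V_def)

lemma v_bound: "s \<in> {0..T} \<Longrightarrow> norm (v s y) \<le> V"
  unfolding v_conv V_def by (rule conv_bound[OF w_measurable w_bound])

text \<open>This Lipschitz constant may depend on \<open>\<epsilon>\<close>; it enters only the convergence of the Euler scheme for fixed \<open>\<epsilon>\<close>.\<close>

lemma v_lipschitz:
  obtains L where "L \<ge> 0" "\<And>s y z. s \<in> {0..T} \<Longrightarrow> norm (v s y - v s z) \<le> L * norm (y - z)"
proof -
  obtain B' where B': "B' > 0" "\<And>ds s x. length ds \<le> 1 \<Longrightarrow> s \<in> {0..T} \<Longrightarrow> norm (partials ds (w s) x) \<le> B'"
    using C_time_bounded[OF w_C1] by blast
  have wL: "\<bar>w s (y + a) - w s y\<bar> \<le> (2 * B') * norm a" if s: "s \<in> {0..T}" for s y a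
  proof -
    have "\<bar>w s (y + a) - w s y\<bar> \<le> B' * (\<bar>a $ 1\<bar> + \<bar>a $ 2\<bar>)"
    proof (rule gradient_lipschitz)
      show "has_partial i (w s) (partial i (w s))" for i
        using Ck_has_partial[OF C_time_Ck[OF w_C1 s], of "[]" i] by simp
      show "\<bar>partial i (w s) y\<bar> \<le> B'" for i y using B'(2)[of "[i]" s y] s by simp
    qed
    also have "\<dots> \<le> B' * (norm a + norm a)"
      using B'(1) by (intro mult_left_mono add_mono component_le_norm_cart) auto
    finally show ?thesis by simp
  qed
  show ?thesis
  proof (rule that)
    show "2 * B' * kernel_mass \<ge> 0" using B'(1) kernel_mass_nonneg by simp
    fix s y z assume s: "s \<in> {0..T}"
    show "norm (v s y - v s z) \<le> 2 * B' * kernel_mass * norm (y - z)"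
      unfolding v_conv[OF s]
      by (rule conv_lipschitz[OF w_measurable[OF s] w_bound[OF s] C_time_periodic[OF w_C1 s] wL[OF s]])
  qed
qed

lemma v_uniform_in_time:
  assumes "\<eta> > 0"
  shows "\<exists>d>0. \<forall>q\<in>{0..T}. \<forall>r\<in>{0..T}. \<bar>q - r\<bar> < d \<longrightarrow> (\<forall>y. norm (v q y - v r y) \<le> \<eta>)"
proof -
  define c where "c = \<eta> / (kernel_mass + 1)"
  have km: "kernel_mass + 1 > 0" using kernel_mass_nonneg by simp
  have c: "c > 0" using assms km by (simp add: c_def)
  have jw: "jointly_continuous T w" using C_time_jointly_continuous[OF w_C1, of "[]"] by simp
  obtain d where d: "d > 0" "\<And>r s x. r \<in> {0..T} \<Longrightarrow> s \<in> {0..T} \<Longrightarrow> \<bar>r - s\<bar> < d \<Longrightarrow> dist (w r x) (w s x) < c"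
    using jointly_continuous_uniform_in_time[OF jw C_time_periodic[OF w_C1] c] by blast
  have "norm (v q y - v r y) \<le> \<eta>" if qr: "q \<in> {0..T}" "r \<in> {0..T}" "\<bar>q - r\<bar> < d" for q r y
  proof -
    have "norm (v q y - v r y) \<le> c * kernel_mass"
      unfolding v_conv[OF qr(1)] v_conv[OF qr(2)]
      by (rule conv_diff_bound[OF w_measurable[OF qr(1)] w_bound[OF qr(1)] w_measurable[OF qr(2)] w_bound[OF qr(2)]])
         (use d(2)[OF qr] in \<open>auto simp: dist_real_def intro: less_imp_le\<close>)
    also have "\<dots> \<le> c * (kernel_mass + 1)" using c by (intro mult_left_mono) auto
    also have "\<dots> = \<eta>" using km by (simp add: c_def)
    finally show ?thesis .
  qed
  then show ?thesis using d(1) by blast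
qed

lemma v_continuous: "s \<in> {0..T} \<Longrightarrow> continuous_on UNIV (v s)"
proof -
  assume s: "s \<in> {0..T}"
  obtain L where L: "L \<ge> 0" "\<And>s y z. s \<in> {0..T} \<Longrightarrow> norm (v s y - v s z) \<le> L * norm (y - z)"
    using v_lipschitz by blast
  have "L-lipschitz_on UNIV (v s)" using L s by (intro lipschitz_onI) (auto simp: dist_norm)
  then show ?thesis by (rule lipschitz_on_continuous_on)
qed

lemma v_jointly_continuous: "jointly_continuous T v"
proof (rule jointly_continuousI[OF _ v_continuous])
  fix s assume s: "s \<in> {0..T}"
  show "uniform_limit UNIV v (v s) (at s within {0..T})"
  proof (rule uniform_limitI)
    fix e :: real assume "e > 0"
    then have "e / 2 > 0" by simp
    from v_uniform_in_time[OF this] obtain d where d: "d > 0" "\<forall>q\<in>{0..T}. \<forall>r\<in>{0..T}. \<bar>q - r\<bar> < d \<longrightarrow> (\<forall>y. norm (v q y - v r y) \<le> e / 2)"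
      by blast
    have "dist (v r y) (v s y) < e" if "r \<in> {0..T}" "dist r s < d" for r y
    proof -
      have "norm (v r y - v s y) \<le> e / 2" using d(2) that s by (simp add: dist_real_def)
      then show ?thesis using \<open>e > 0\<close> by (simp add: dist_norm)
    qed
    then show "\<forall>\<^sub>F r in at s within {0..T}. \<forall>y\<in>UNIV. dist (v r y) (v s y) < e"
      unfolding eventually_at using d(1) by (intro exI[of _ d]) auto
  qed
qed

text \<open>Both velocities are convolutions with the same integrable kernel.\<close>

lemma velocity_error:
  assumes s: "s \<in> {0..T}" and c: "\<And>x. \<bar>w s x - vort s x\<bar> \<le> c"
  shows "norm (v s x - u s x) \<le> c * kernel_mass"
  unfolding v_conv[OF s] biot_savart_law[OF kernel mean s]
  by (rule conv_diff_bound[OF w_measurable[OF s] w_bound[OF s] vort_measurable[OF s] vort_le[OF s] c])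

lemma AE_paths: "AE \<omega> in M. N 0 \<omega> = 0 \<and> counting_path (\<lambda>t. N t \<omega>)"
proof -
  have "AE \<omega> in M. N 0 \<omega> = 0 \<and> mono_on {0..} (\<lambda>t. N t \<omega>) \<and> (\<forall>t\<ge>0. continuous (at_right t) (\<lambda>r. real (N r \<omega>)))"
    using poisson by (simp add: poisson_process_def)
  then show ?thesis by eventually_elim (auto simp: counting_path_def)
qed

lemma euler_converges_AE:
  assumes s: "0 < s" "s < T"
  shows "AE \<omega> in M. (\<lambda>m. path_euler s m x \<omega>)
     \<longlonglongrightarrow> X s T x \<omega>"
proof -
  have "AE \<omega> in M. cadlag_on s T (\<lambda>t. X s t x \<omega>) \<and> (\<forall>t\<in>{s..T}. X s t x \<omega> =
             x + \<epsilon> *\<^sub>R path_integral (\<lambda>r. N r \<omega>) s t (\<lambda>r. v r (Lim (at_left r) (\<lambda>q. X s q x \<omega>)))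
               + \<sigma> *\<^sub>R (compound_walk \<xi> N t \<omega> - compound_walk \<xi> N s \<omega>))"
    using system s unfolding particle_system_def by auto
  then show ?thesis using AE_paths
  proof eventually_elim
    fix \<omega>
    assume X: "cadlag_on s T (\<lambda>t. X s t x \<omega>) \<and> (\<forall>t\<in>{s..T}. X s t x \<omega> =
             x + \<epsilon> *\<^sub>R path_integral (\<lambda>r. N r \<omega>) s t (\<lambda>r. v r (Lim (at_left r) (\<lambda>q. X s q x \<omega>)))
               + \<sigma> *\<^sub>R (compound_walk \<xi> N t \<omega> - compound_walk \<xi> N s \<omega>))"
      and N: "N 0 \<omega> = 0 \<and> counting_path (\<lambda>t. N t \<omega>)"
    obtain L where L: "L \<ge> 0" "\<And>s y z. s \<in> {0..T} \<Longrightarrow> norm (v s y - v s z) \<le> L * norm (y - z)"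
      using v_lipschitz by blast
    interpret P: counting_path "\<lambda>t. N t \<omega>" using N by simp
    interpret P: path_solution "\<lambda>t. N t \<omega>" T s \<epsilon> \<sigma> v "\<lambda>t. X s t x \<omega>" "\<lambda>k. \<xi> k \<omega>" x V L
      by unfold_locales (use s \<epsilon> X L v_bound v_jointly_continuous in \<open>auto simp: compound_walk_def\<close>)
    show "(\<lambda>m. path_euler s m x \<omega>) \<longlonglongrightarrow> X s T x \<omega>"
      by (rule P.euler_converges[OF v_uniform_in_time L(1)])
  qed
qed

definition euler_chain :: "real \<Rightarrow> nat \<Rightarrow> real^2 \<Rightarrow> nat \<Rightarrow> 'w \<Rightarrow> real^2" where
  "euler_chain s m x = driving_noise_grid.chain N \<xi> (grid s T m) m \<epsilon> \<sigma> v x"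

abbreviation final_mean :: "real \<Rightarrow> nat \<Rightarrow> real^2 \<Rightarrow> real" where
  "final_mean s m x \<equiv> expectation (\<lambda>\<omega>. vort T (euler_chain s m x m \<omega>))"

lemma grid_noise:
  assumes s: "0 < s" "s < T" and m: "m > 0"
  shows "driving_noise_grid M (1 / \<epsilon>) N \<xi> (grid s T m) m"
  by unfold_locales (use s m in \<open>auto intro: grid_strict\<close>)

lemma v_grid_continuous:
  assumes s: "0 < s" "s < T" and m: "m > 0" and "i < m"
  shows "continuous_on UNIV (v (grid s T m i))"
  using grid_bounds[OF s(2) m, of i] assms by (intro v_continuous) auto

lemma euler_chain_measurable:
  assumes s: "0 < s" "s < T" and m: "m > 0" and j: "j \<le> m"
  shows "euler_chain s m x j \<in> borel_measurable M"
  unfolding euler_chain_def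
  by (rule driving_noise_grid.chain_measurable[where v=v, OF grid_noise[OF s m] v_grid_continuous[OF s m] j])

text \<open>Almost surely the counts start at zero and are monotone, so truncated differences of natural numbers telescope.\<close>

lemma euler_chain_AE:
  assumes s: "0 < s" "s < T" and m: "m > 0"
  shows "AE \<omega> in M. euler_chain s m x m \<omega> = path_euler s m x \<omega>"
  using AE_paths
proof eventually_elim
  fix \<omega> assume \<omega>: "N 0 \<omega> = 0 \<and> counting_path (\<lambda>t. N t \<omega>)"
  interpret P: counting_path "\<lambda>t. N t \<omega>" using \<omega> by simp
  interpret G: driving_noise_grid M "1 / \<epsilon>" N \<xi> "grid s T m" m by (rule grid_noise[OF s m])
  have pc: "partial_count (\<lambda>i. G.increment i \<omega>) i = N (grid s T m i) \<omega>" if "i \<le> m" for i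
    using that
  proof (induction i)
    case 0
    then show ?case using G.obs_time_Suc[of 0] G.obs_time_0 \<omega> by (simp add: partial_count_def G.increment_def)
  next
    case (Suc i)
    have "N (grid s T m i) \<omega> \<le> N (grid s T m (Suc i)) \<omega>"
      using Suc.prems grid_bounds[OF s(2) m, of i] grid_strict[OF s(2) m, of i "Suc i"] s by (intro P.n_mono) auto
    then show ?case using Suc G.obs_time_Suc[of i] G.obs_time_Suc[of "Suc i"] by (simp add: partial_count_Suc G.increment_def)
  qed
  show "euler_chain s m x m \<omega> = path_euler s m x \<omega>"
  proof -
    have "G.chain \<epsilon> \<sigma> v x m \<omega> = euler \<epsilon> \<sigma> v (grid s T m) x (\<lambda>k. \<xi> k \<omega>) (partial_count (\<lambda>i. G.increment i \<omega>)) m"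
      by (rule G.chain_def) (rule v_grid_continuous[OF s m])
    also have "\<dots> = path_euler s m x \<omega>"
    proof (rule euler_cong)
      show "partial_count (\<lambda>i. G.increment i \<omega>) i \<le> partial_count (\<lambda>i. G.increment i \<omega>) m" if "i \<le> m" for i
        by (rule partial_count_mono[OF that])
    qed (simp_all add: pc)
    finally show ?thesis unfolding euler_chain_def .
  qed
qed

text \<open>Almost sure convergence of the scheme and dominated convergence identify \<open>w s x\<close> as a limit of means over
the chain.\<close>

lemma euler_chain_expectation:
  assumes s: "0 < s" "s < T"
  shows "(\<lambda>m. final_mean s (Suc m) x) \<longlonglongrightarrow> w s x"
proof -
  have "s \<in> {0..T}" using s by simp
  then have wx: "w s x = expectation (\<lambda>\<omega>. vort T (X s T x \<omega>))" by (rule w_expectation)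
  show ?thesis unfolding wx
  proof (rule integral_dominated_convergence[where w="\<lambda>_. B"])
    have "X s T x \<in> borel_measurable M" using system s by (auto simp: particle_system_def)
    then show "(\<lambda>\<omega>. vort T (X s T x \<omega>)) \<in> borel_measurable M" by (rule measurable_compose[OF _ vort_measurable[OF T_in]])
    show "(\<lambda>\<omega>. vort T (euler_chain s (Suc m) x (Suc m) \<omega>)) \<in> borel_measurable M" for m
      by (rule measurable_compose[OF euler_chain_measurable[OF s] vort_measurable[OF T_in]]) auto
    have "AE \<omega> in M. \<forall>m. euler_chain s (Suc m) x (Suc m) \<omega> = path_euler s (Suc m) x \<omega>"
      unfolding AE_all_countable by (intro allI euler_chain_AE[OF s]) simp
    then show "AE \<omega> in M. (\<lambda>m. vort T (euler_chain s (Suc m) x (Suc m) \<omega>)) \<longlonglongrightarrow> vort T (X s T x \<omega>)"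
      using euler_converges_AE[OF s, of x]
    proof eventually_elim
      fix \<omega>
      assume 1: "\<forall>m. euler_chain s (Suc m) x (Suc m) \<omega> = path_euler s (Suc m) x \<omega>"
        and 2: "(\<lambda>m. path_euler s m x \<omega>) \<longlonglongrightarrow> X s T x \<omega>"
      have "(\<lambda>m. euler_chain s (Suc m) x (Suc m) \<omega>) \<longlonglongrightarrow> X s T x \<omega>"
        using LIMSEQ_Suc[OF 2] by (simp only: 1)
      moreover have "isCont (vort T) (X s T x \<omega>)" using vort_continuous[OF T_in] by (simp add: continuous_on_eq_continuous_at)
      ultimately show "(\<lambda>m. vort T (euler_chain s (Suc m) x (Suc m) \<omega>)) \<longlonglongrightarrow> vort T (X s T x \<omega>)"
        by (rule isCont_tendsto_compose[rotated])
    qed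
    show "AE \<omega> in M. norm (vort T (euler_chain s (Suc m) x (Suc m) \<omega>)) \<le> B" for m
      using vort_le[OF T_in] by simp
  qed simp
qed

end

section \<open>The error estimate\<close>


context particle_approximation
begin

text \<open>The constant of \<open>generator_estimate\<close>.\<close>

definition consistency :: real where "consistency = B * (8 * \<nu>\<^sup>2 + 3 * V\<^sup>2 + 4 * \<nu> * V)"

text \<open>Two velocity components, each tested against a derivative bounded by \<open>B\<close>.\<close>

definition growth :: real where "growth = 2 * B * kernel_mass"

lemma consistency_nonneg: "consistency \<ge> 0"
  using B_nonneg V_nonneg \<nu> by (simp add: consistency_def)

lemma growth_nonneg: "growth \<ge> 0"
  using B_nonneg kernel_mass_nonneg by (simp add: growth_def)

lemma drift_jointly_continuous: "jointly_continuous T drift"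
  unfolding drift_def
  by (intro jointly_continuous_add jointly_continuous_cmult jointly_continuous_mult C_time_jointly_continuous[OF vort_C4]
       C_time_jointly_continuous[OF component_C5, of "[]", simplified]) auto

lemma drift_periodic: "s \<in> {0..T} \<Longrightarrow> torus_periodic (drift s)"
  using torus_periodic_partials[OF C_time_periodic[OF vort_C4, of s], of "[1,1]"]
    torus_periodic_partials[OF C_time_periodic[OF vort_C4, of s], of "[2,2]"]
    torus_periodic_partials[OF C_time_periodic[OF vort_C4, of s], of "[1]"]
    torus_periodic_partials[OF C_time_periodic[OF vort_C4, of s], of "[2]"]
    C_time_periodic[OF velocity_C5, of s]
  by (simp add: torus_periodic_def drift_def)

text \<open>Over one cell the vorticity changes by minus the drift, while the chain adds the jump generator. Their difference
consists of the consistency error, the velocity error tested against the gradient, and oscillations \<open>\<eta>\<close> over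
the cell.\<close>

lemma local_error:
  assumes t: "0 \<le> t" "t \<le> t'" "t' \<le> T" and c: "\<And>y. \<bar>w t' y - vort t' y\<bar> \<le> c"
    and \<eta>: "\<And>r. r \<in> {t..t'} \<Longrightarrow> \<bar>drift r y - drift t' y\<bar> \<le> \<eta>" "norm (v t y - v t' y) \<le> \<eta>"
  shows "\<bar>(vort t' y - vort t y) + ((t' - t) / \<epsilon>) * ((\<Sum>z\<in>unit_steps. vort t' (y + \<epsilon> *\<^sub>R v t y + \<sigma> *\<^sub>R z)) / 4 - vort t' y)\<bar>
     \<le> (t' - t) * (growth * c + consistency * \<epsilon> + (2 * B + 1) * \<eta>)"
proof -
  have tT: "t \<in> {0..T}" "t' \<in> {0..T}" using t by auto
  define \<delta> where "\<delta> = t' - t"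
  have \<delta>: "\<delta> \<ge> 0" using t by (simp add: \<delta>_def)
  define g where "g = vort t'"
  define A where "A = (\<Sum>z\<in>unit_steps. g (y + \<epsilon> *\<^sub>R v t y + \<sigma> *\<^sub>R z)) / 4"
  define G where "G = v t y $ 1 * partials [1] g y + v t y $ 2 * partials [2] g y + \<nu> * (partials [1,1] g y + partials [2,2] g y)"
  have gB: "\<bar>partials ds g y\<bar> \<le> B" if "length ds \<le> 4" for ds y
    unfolding g_def using vort_bound that tT by blast
  have "\<bar>A - g y - \<epsilon> * G\<bar> \<le> consistency * \<epsilon>\<^sup>2"
    unfolding A_def G_def consistency_def
    by (rule generator_estimate[OF C_time_Ck[OF vort_C4 tT(2), folded g_def] gB v_bound[OF tT(1)] \<epsilon> \<nu>])
  then have "(\<delta> / \<epsilon>) * \<bar>A - g y - \<epsilon> * G\<bar> \<le> (\<delta> / \<epsilon>) * (consistency * \<epsilon>\<^sup>2)"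
    using \<delta> \<epsilon> by (intro mult_left_mono) auto
  also have "(\<delta> / \<epsilon>) * \<bar>A - g y - \<epsilon> * G\<bar> = \<bar>(\<delta> / \<epsilon>) * (A - g y) - \<delta> * G\<bar>"
  proof -
    have "(\<delta> / \<epsilon>) * (A - g y) - \<delta> * G = (\<delta> / \<epsilon>) * (A - g y - \<epsilon> * G)" using \<epsilon> by (simp add: field_simps)
    then show ?thesis using \<delta> \<epsilon> by (simp add: abs_mult)
  qed
  finally have e1: "\<bar>(\<delta> / \<epsilon>) * (A - g y) - \<delta> * G\<bar> \<le> \<delta> * (consistency * \<epsilon>)"
    using \<epsilon> by (simp add: power2_eq_square)
  have int: "(\<lambda>r. drift r y) integrable_on {t..t'}"
    using t by (intro integrable_continuous_interval continuous_on_subset[OF jointly_continuous_time[OF drift_jointly_continuous]]) auto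
  have "integral {t..t'} (\<lambda>r. drift r y) - \<delta> * drift t' y = integral {t..t'} (\<lambda>r. drift r y - drift t' y)"
    using t integral_diff[OF int integrable_const_ivl[of "drift t' y"]] by (simp add: \<delta>_def)
  moreover have "norm (integral {t..t'} (\<lambda>r. drift r y - drift t' y)) \<le> integral {t..t'} (\<lambda>r. \<eta>)"
    using int \<eta>(1) by (intro integral_norm_bound_integral integrable_diff) auto
  ultimately have e2: "\<bar>integral {t..t'} (\<lambda>r. drift r y) - \<delta> * drift t' y\<bar> \<le> \<delta> * \<eta>"
    using t by (simp add: \<delta>_def)
  have gt: "g y - vort t y = - integral {t..t'} (\<lambda>r. drift r y)"
    unfolding g_def by (rule vorticity_equation[OF t])
  have comp: "\<bar>v t y $ i - u t' y $ i\<bar> \<le> \<eta> + c * kernel_mass" for i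
  proof -
    have "\<bar>v t y $ i - u t' y $ i\<bar> \<le> norm (v t y - u t' y)" using component_le_norm_cart[of "v t y - u t' y" i] by simp
    also have "\<dots> \<le> norm (v t y - v t' y) + norm (v t' y - u t' y)"
      using norm_triangle_ineq[of "v t y - v t' y" "v t' y - u t' y"] by simp
    finally show ?thesis using \<eta>(2) velocity_error[OF tT(2) c, of y] by linarith
  qed
  have e0: "\<eta> + c * kernel_mass \<ge> 0" using comp[of 1] by linarith
  \<comment> \<open>The viscous terms agree and cancel.\<close>
  have "G - drift t' y = (v t y $ 1 - u t' y $ 1) * partials [1] g y + (v t y $ 2 - u t' y $ 2) * partials [2] g y"
    by (simp add: G_def drift_def g_def algebra_simps)
  also have "\<bar>\<dots>\<bar> \<le> (\<eta> + c * kernel_mass) * B + (\<eta> + c * kernel_mass) * B"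
  proof (rule order_trans[OF abs_triangle_ineq], rule add_mono)
    show "\<bar>(v t y $ 1 - u t' y $ 1) * partials [1] g y\<bar> \<le> (\<eta> + c * kernel_mass) * B"
      unfolding abs_mult using comp[of 1] gB[of "[1]" y] e0 by (intro mult_mono) auto
    show "\<bar>(v t y $ 2 - u t' y $ 2) * partials [2] g y\<bar> \<le> (\<eta> + c * kernel_mass) * B"
      unfolding abs_mult using comp[of 2] gB[of "[2]" y] e0 by (intro mult_mono) auto
  qed
  finally have "\<delta> * \<bar>G - drift t' y\<bar> \<le> \<delta> * ((\<eta> + c * kernel_mass) * B + (\<eta> + c * kernel_mass) * B)"
    using \<delta> by (intro mult_left_mono)
  also have "\<delta> * \<bar>G - drift t' y\<bar> = \<bar>\<delta> * G - \<delta> * drift t' y\<bar>"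
    using \<delta> by (simp add: right_diff_distrib[symmetric] abs_mult del: right_diff_distrib)
  finally have e3: "\<bar>\<delta> * G - \<delta> * drift t' y\<bar> \<le> \<delta> * (2 * B * \<eta> + growth * c)"
    by (simp add: growth_def algebra_simps)
  have "\<bar>(g y - vort t y) + (\<delta> / \<epsilon>) * (A - g y)\<bar> \<le> \<delta> * (consistency * \<epsilon>) + \<delta> * \<eta> + \<delta> * (2 * B * \<eta> + growth * c)"
    unfolding gt using e1 e2 e3 by linarith
  also have "\<dots> = \<delta> * (growth * c + consistency * \<epsilon> + (2 * B + 1) * \<eta>)" by (simp add: algebra_simps)
  finally show ?thesis unfolding A_def g_def \<delta>_def .
qed

lemma expectation_step:
  assumes s: "0 < s" "s < T" and m: "m > 0" and j: "j < m"
    and c: "\<And>y. \<bar>w (grid s T m (Suc j)) y - vort (grid s T m (Suc j)) y\<bar> \<le> c"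
    and \<eta>: "\<And>q r y. q \<in> {0..T} \<Longrightarrow> r \<in> {0..T} \<Longrightarrow> \<bar>q - r\<bar> \<le> (T - s) / real m \<Longrightarrow> \<bar>drift q y - drift r y\<bar> \<le> \<eta>"
      "\<And>q r y. q \<in> {0..T} \<Longrightarrow> r \<in> {0..T} \<Longrightarrow> \<bar>q - r\<bar> \<le> (T - s) / real m \<Longrightarrow> norm (v q y - v r y) \<le> \<eta>"
  shows "\<bar>expectation (\<lambda>\<omega>. vort (grid s T m (Suc j)) (euler_chain s m x (Suc j) \<omega>)) - expectation (\<lambda>\<omega>. vort (grid s T m j) (euler_chain s m x j \<omega>))\<bar>
    \<le> (T - s) / real m * (growth * c + consistency * \<epsilon> + (2 * B + 1) * \<eta>) + 3 * B * ((T - s) / real m / \<epsilon>)\<^sup>2"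
proof -
  interpret G: driving_noise_grid M "1 / \<epsilon>" N \<xi> "grid s T m" m by (rule grid_noise[OF s m])
  define t t' where "t = grid s T m j" and "t' = grid s T m (Suc j)"
  have tt: "0 \<le> t" "t \<le> t'" "t' \<le> T" "t' - t = (T - s) / real m"
    using grid_bounds[OF s(2) m, of j] grid_bounds[OF s(2) m, of "Suc j"] j s grid_strict[OF s(2) m, of j "Suc j"]
    by (auto simp: t_def t'_def grid_Suc)
  have tT: "t \<in> {0..T}" "t' \<in> {0..T}" using tt by auto
  define Y where "Y = euler_chain s m x j"
  have Y: "Y \<in> borel_measurable M" unfolding Y_def using j by (intro euler_chain_measurable[OF s m]) auto
  define h where "h = (t' - t) / \<epsilon>"
  define A where "A y = (\<Sum>z\<in>unit_steps. vort t' (y + \<epsilon> *\<^sub>R v t y + \<sigma> *\<^sub>R z)) / 4" for y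
  have jump: "G.jump \<epsilon> \<sigma> v j y z = y + \<epsilon> *\<^sub>R v t y + \<sigma> *\<^sub>R z" for y z
    unfolding t_def by (rule G.jump_def[where v=v, OF v_grid_continuous[OF s m]])
  have "\<bar>expectation (\<lambda>\<omega>. vort t' (euler_chain s m x (Suc j) \<omega>)) - expectation (\<lambda>\<omega>. vort t' (Y \<omega>))
     - h * (expectation (\<lambda>\<omega>. A (Y \<omega>)) - expectation (\<lambda>\<omega>. vort t' (Y \<omega>)))\<bar> \<le> 3 * B * h\<^sup>2"
    using G.one_step[where v=v and \<epsilon>=\<epsilon> and \<sigma>=\<sigma> and x=x, OF v_grid_continuous[OF s m] j vort_measurable[OF tT(2)] vort_le[OF tT(2)]]
    unfolding jump by (simp add: A_def Y_def euler_chain_def h_def t_def t'_def)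
  moreover have "expectation (\<lambda>\<omega>. vort t' (Y \<omega>)) + h * (expectation (\<lambda>\<omega>. A (Y \<omega>)) - expectation (\<lambda>\<omega>. vort t' (Y \<omega>))) - expectation (\<lambda>\<omega>. vort t (Y \<omega>))
     = expectation (\<lambda>\<omega>. (vort t' (Y \<omega>) - vort t (Y \<omega>)) + h * (A (Y \<omega>) - vort t' (Y \<omega>)))"
  proof -
    have [measurable]: "vort t \<in> borel_measurable borel" "vort t' \<in> borel_measurable borel" "v t \<in> borel_measurable borel" "Y \<in> borel_measurable M"
      using vort_measurable tT Y borel_measurable_continuous_onI[OF v_continuous[OF tT(1)]] by auto
    have [measurable]: "A \<in> borel_measurable borel" unfolding A_def by measurable
    have AB: "\<bar>A y\<bar> \<le> B" for y
    proof -
      have "\<bar>\<Sum>z\<in>unit_steps. vort t' (y + \<epsilon> *\<^sub>R v t y + \<sigma> *\<^sub>R z)\<bar> \<le> (\<Sum>z\<in>unit_steps. B)"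
        by (rule order_trans[OF sum_abs]) (intro sum_mono vort_le tT)
      then show ?thesis by (simp add: A_def card_unit_steps)
    qed
    have "integrable M (\<lambda>\<omega>. vort t' (Y \<omega>))" "integrable M (\<lambda>\<omega>. vort t (Y \<omega>))" "integrable M (\<lambda>\<omega>. A (Y \<omega>))"
      using vort_le tT AB by (auto intro!: integrable_const_bound[where B=B])
    then show ?thesis by simp
  qed
  moreover have "\<bar>expectation (\<lambda>\<omega>. (vort t' (Y \<omega>) - vort t (Y \<omega>)) + h * (A (Y \<omega>) - vort t' (Y \<omega>)))\<bar>
     \<le> (t' - t) * (growth * c + consistency * \<epsilon> + (2 * B + 1) * \<eta>)"
  proof (rule abs_expectation_le)
    fix \<omega>
    show "\<bar>(vort t' (Y \<omega>) - vort t (Y \<omega>)) + h * (A (Y \<omega>) - vort t' (Y \<omega>))\<bar> \<le> (t' - t) * (growth * c + consistency * \<epsilon> + (2 * B + 1) * \<eta>)"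
      unfolding h_def A_def
    proof (rule local_error[OF tt(1-3)])
      show "\<bar>w t' y - vort t' y\<bar> \<le> c" for y using c by (simp add: t'_def)
      show "\<bar>drift r (Y \<omega>) - drift t' (Y \<omega>)\<bar> \<le> \<eta>" if "r \<in> {t..t'}" for r
        using that tt by (intro \<eta>(1)) auto
      show "norm (v t (Y \<omega>) - v t' (Y \<omega>)) \<le> \<eta>" using tt by (intro \<eta>(2)) auto
    qed
  qed
  ultimately show ?thesis unfolding tt(4)[symmetric] h_def t_def[symmetric] t'_def[symmetric] Y_def[symmetric] by linarith
qed

text \<open>The weights sum by telescoping: \<open>\<beta> \<delta> exp (\<beta> (T - t\<^sub>j\<^sub>+\<^sub>1))\<close> is at most the difference of the weights at \<open>t\<^sub>j\<close>
and \<open>t\<^sub>j\<^sub>+\<^sub>1\<close>. The right end point is the one for which this inequality holds.\<close>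

lemma chain_error:
  assumes s: "0 < s" "s < T" and m: "m > 0" and E: "E \<ge> 0" and \<beta>: "\<beta> > 0"
    and bound: "\<And>r y. r \<in> {0..T} \<Longrightarrow> \<bar>w r y - vort r y\<bar> \<le> E * exp (\<beta> * (T - r))"
    and \<eta>0: "\<eta> \<ge> 0"
    and \<eta>: "\<And>q r y. q \<in> {0..T} \<Longrightarrow> r \<in> {0..T} \<Longrightarrow> \<bar>q - r\<bar> \<le> (T - s) / real m \<Longrightarrow> \<bar>drift q y - drift r y\<bar> \<le> \<eta>"
      "\<And>q r y. q \<in> {0..T} \<Longrightarrow> r \<in> {0..T} \<Longrightarrow> \<bar>q - r\<bar> \<le> (T - s) / real m \<Longrightarrow> norm (v q y - v r y) \<le> \<eta>"
  shows "\<bar>final_mean s m x - vort s x\<bar>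
    \<le> growth * E / \<beta> * exp (\<beta> * (T - s)) + T * (consistency * \<epsilon> + (2 * B + 1) * \<eta>) + 3 * B * (T / \<epsilon>)\<^sup>2 / real m"
proof -
  define \<delta> where "\<delta> = (T - s) / real m"
  have \<delta>: "\<delta> > 0" using s m by (simp add: \<delta>_def)
  define a where "a j = expectation (\<lambda>\<omega>. vort (grid s T m j) (euler_chain s m x j \<omega>))" for j
  define Q where "Q = consistency * \<epsilon> + (2 * B + 1) * \<eta>"
  have Q: "Q \<ge> 0" using consistency_nonneg \<epsilon> B_nonneg \<eta>0 by (simp add: Q_def)
  interpret G: driving_noise_grid M "1 / \<epsilon>" N \<xi> "grid s T m" m by (rule grid_noise[OF s m])
  have a0: "a 0 = vort s x"
    by (simp add: a_def euler_chain_def G.chain_def[where v=v, OF v_grid_continuous[OF s m]] prob_space)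
  have ind: "j \<le> m \<Longrightarrow> \<bar>a j - a 0\<bar> \<le> growth * E / \<beta> * (exp (\<beta> * (T - s)) - exp (\<beta> * (T - grid s T m j))) + real j * (\<delta> * Q + 3 * B * (\<delta> / \<epsilon>)\<^sup>2)" for j
  proof (induction j)
    case (Suc j)
    define e where "e = exp (\<beta> * (T - grid s T m (Suc j)))"
    have gs: "grid s T m (Suc j) \<in> {0..T}" using grid_bounds[OF s(2) m Suc.prems] s by auto
    have "\<bar>a (Suc j) - a j\<bar> \<le> \<delta> * (growth * (E * e) + consistency * \<epsilon> + (2 * B + 1) * \<eta>) + 3 * B * (\<delta> / \<epsilon>)\<^sup>2"
      unfolding a_def \<delta>_def e_def
      by (rule expectation_step[OF s m _ bound[OF gs] \<eta>]) (use Suc.prems in auto)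
    also have "\<dots> = growth * E / \<beta> * (\<beta> * \<delta> * e) + (\<delta> * Q + 3 * B * (\<delta> / \<epsilon>)\<^sup>2)"
      using \<beta> by (simp add: Q_def algebra_simps)
    also have "growth * E / \<beta> * (\<beta> * \<delta> * e) \<le> growth * E / \<beta> * (exp (\<beta> * (T - grid s T m j)) - e)"
    proof (rule mult_left_mono)
      have "e * (1 + \<beta> * \<delta>) \<le> e * exp (\<beta> * \<delta>)" by (intro mult_left_mono exp_ge_add_one_self) (simp add: e_def)
      also have "\<dots> = exp (\<beta> * (T - grid s T m j))"
        unfolding e_def exp_add[symmetric] by (simp add: grid_Suc \<delta>_def algebra_simps)
      finally show "\<beta> * \<delta> * e \<le> exp (\<beta> * (T - grid s T m j)) - e" by (simp add: algebra_simps)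
      show "growth * E / \<beta> \<ge> 0" using growth_nonneg E \<beta> by simp
    qed
    finally have step: "\<bar>a (Suc j) - a j\<bar> \<le> growth * E / \<beta> * (exp (\<beta> * (T - grid s T m j)) - e) + (\<delta> * Q + 3 * B * (\<delta> / \<epsilon>)\<^sup>2)" by simp
    have "\<bar>a (Suc j) - a 0\<bar> \<le> \<bar>a (Suc j) - a j\<bar> + \<bar>a j - a 0\<bar>" by simp
    also have "\<dots> \<le> growth * E / \<beta> * (exp (\<beta> * (T - grid s T m j)) - e) + (\<delta> * Q + 3 * B * (\<delta> / \<epsilon>)\<^sup>2)
       + (growth * E / \<beta> * (exp (\<beta> * (T - s)) - exp (\<beta> * (T - grid s T m j))) + real j * (\<delta> * Q + 3 * B * (\<delta> / \<epsilon>)\<^sup>2))"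
      using step Suc by (intro add_mono) auto
    also have "\<dots> = growth * E / \<beta> * (exp (\<beta> * (T - s)) - e) + real (Suc j) * (\<delta> * Q + 3 * B * (\<delta> / \<epsilon>)\<^sup>2)"
      by (simp add: right_diff_distrib distrib_right)
    finally show ?case unfolding e_def .
  qed simp
  have "a m = final_mean s m x" by (simp add: a_def grid_end[OF m])
  then have "\<bar>final_mean s m x - vort s x\<bar> \<le>
      growth * E / \<beta> * (exp (\<beta> * (T - s)) - 1) + real m * (\<delta> * Q + 3 * B * (\<delta> / \<epsilon>)\<^sup>2)"
    using ind[OF order_refl] a0 by (simp add: grid_end[OF m])
  also have "\<dots> \<le> growth * E / \<beta> * exp (\<beta> * (T - s)) + (T * Q + 3 * B * (T / \<epsilon>)\<^sup>2 / real m)"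
  proof (rule add_mono)
    show "growth * E / \<beta> * (exp (\<beta> * (T - s)) - 1) \<le> growth * E / \<beta> * exp (\<beta> * (T - s))"
      using growth_nonneg E \<beta> by (intro mult_left_mono) auto
    have m\<delta>: "real m * \<delta> = T - s" using m by (simp add: \<delta>_def)
    have "real m * (\<delta> * Q + 3 * B * (\<delta> / \<epsilon>)\<^sup>2) = (real m * \<delta>) * Q + 3 * B * ((real m * \<delta>) / \<epsilon>)\<^sup>2 / real m"
      using m by (simp add: power2_eq_square field_simps)
    also have "\<dots> \<le> T * Q + 3 * B * (T / \<epsilon>)\<^sup>2 / real m"
      unfolding m\<delta> using s Q B_nonneg \<epsilon>
      by (intro add_mono mult_right_mono divide_right_mono mult_left_mono power_mono) auto
    finally show "real m * (\<delta> * Q + 3 * B * (\<delta> / \<epsilon>)\<^sup>2) \<le> T * Q + 3 * B * (T / \<epsilon>)\<^sup>2 / real m" .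
  qed
  finally show ?thesis by (simp add: Q_def)
qed

text \<open>First the grid is refined, which removes the terms in \<open>1 / m\<close>, then the oscillation \<open>\<eta>\<close> is sent to zero.\<close>

lemma vorticity_error_improves:
  assumes s: "0 < s" "s < T" and E: "E \<ge> 0" and \<beta>: "\<beta> > 0"
    and bound: "\<And>r y. r \<in> {0..T} \<Longrightarrow> \<bar>w r y - vort r y\<bar> \<le> E * exp (\<beta> * (T - r))"
  shows "\<bar>w s x - vort s x\<bar> \<le> growth * E / \<beta> * exp (\<beta> * (T - s)) + T * (consistency * \<epsilon>)"
proof (rule field_le_epsilon)
  fix e :: real assume e: "e > 0"
  define D where "D = T * (2 * B + 1)"
  define \<eta> where "\<eta> = e / D"
  have D: "D > 0" using T B_nonneg by (simp add: D_def)
  have \<eta>: "\<eta> > 0" using e D by (simp add: \<eta>_def)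
  have "D * \<eta> = e" using D by (simp add: \<eta>_def)
  then have T\<eta>: "T * ((2 * B + 1) * \<eta>) = e" by (simp add: D_def mult.assoc)
  obtain d where d: "d > 0" "\<And>r s x. r \<in> {0..T} \<Longrightarrow> s \<in> {0..T} \<Longrightarrow> \<bar>r - s\<bar> < d \<Longrightarrow> dist (drift r x) (drift s x) < \<eta>"
    using jointly_continuous_uniform_in_time[OF drift_jointly_continuous drift_periodic \<eta>] by blast
  obtain d' where d': "d' > 0" "\<forall>q\<in>{0..T}. \<forall>r\<in>{0..T}. \<bar>q - r\<bar> < d' \<longrightarrow> (\<forall>y. norm (v q y - v r y) \<le> \<eta>)"
    using v_uniform_in_time[OF \<eta>] by blast
  define A where "A = growth * E / \<beta> * exp (\<beta> * (T - s)) + T * (consistency * \<epsilon> + (2 * B + 1) * \<eta>)"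
  have lim: "(\<lambda>m. \<bar>final_mean s (Suc m) x - vort s x\<bar>) \<longlonglongrightarrow> \<bar>w s x - vort s x\<bar>"
    by (intro tendsto_intros euler_chain_expectation[OF s])
  have lim2: "(\<lambda>m. A + 3 * B * (T / \<epsilon>)\<^sup>2 * inverse (real (Suc m))) \<longlonglongrightarrow> A + 3 * B * (T / \<epsilon>)\<^sup>2 * 0"
    by (intro tendsto_intros LIMSEQ_inverse_real_of_nat)
  have "(\<lambda>m. (T - s) * inverse (real (Suc m))) \<longlonglongrightarrow> (T - s) * 0"
    by (intro tendsto_intros LIMSEQ_inverse_real_of_nat)
  then have "\<forall>\<^sub>F m in sequentially. (T - s) * inverse (real (Suc m)) < min d d'"
    by (rule order_tendstoD) (use d d' in auto)
  then have ev: "\<forall>\<^sub>F m in sequentially. \<bar>final_mean s (Suc m) x - vort s x\<bar> \<le> A + 3 * B * (T / \<epsilon>)\<^sup>2 * inverse (real (Suc m))"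
  proof eventually_elim
    fix m assume "(T - s) * inverse (real (Suc m)) < min d d'"
    then have small: "(T - s) / real (Suc m) < d" "(T - s) / real (Suc m) < d'" by (simp_all add: divide_inverse)
    have "\<bar>final_mean s (Suc m) x - vort s x\<bar>
      \<le> growth * E / \<beta> * exp (\<beta> * (T - s)) + T * (consistency * \<epsilon> + (2 * B + 1) * \<eta>) + 3 * B * (T / \<epsilon>)\<^sup>2 / real (Suc m)"
    proof (rule chain_error[OF s _ E \<beta> bound])
      fix q r y assume qr: "q \<in> {0..T}" "r \<in> {0..T}" "\<bar>q - r\<bar> \<le> (T - s) / real (Suc m)"
      then have "\<bar>q - r\<bar> < d" "\<bar>q - r\<bar> < d'" using small by auto
      then show "\<bar>drift q y - drift r y\<bar> \<le> \<eta>" "norm (v q y - v r y) \<le> \<eta>"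
        using d(2)[OF qr(1,2), of y] d'(2) qr(1,2) by (auto simp: dist_real_def)
    qed (use \<eta> in auto)
    then show "\<bar>final_mean s (Suc m) x - vort s x\<bar> \<le> A + 3 * B * (T / \<epsilon>)\<^sup>2 * inverse (real (Suc m))"
      by (simp only: A_def divide_inverse)
  qed
  have "\<bar>w s x - vort s x\<bar> \<le> A + 3 * B * (T / \<epsilon>)\<^sup>2 * 0"
    by (rule tendsto_le[OF _ lim2 lim ev]) simp
  also have "\<dots> = growth * E / \<beta> * exp (\<beta> * (T - s)) + T * (consistency * \<epsilon>) + e"
    using T\<eta> by (simp add: A_def distrib_left)
  finally show "\<bar>w s x - vort s x\<bar> \<le> growth * E / \<beta> * exp (\<beta> * (T - s)) + T * (consistency * \<epsilon>) + e" .
qed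

text \<open>The end points are limits of interior times. At time zero the grid of the chain would not be strictly above
the starting time of the clock.\<close>

lemma vorticity_error_improves_closed:
  assumes s: "s \<in> {0..T}" and E: "E \<ge> 0" and \<beta>: "\<beta> > 0"
    and bound: "\<And>r y. r \<in> {0..T} \<Longrightarrow> \<bar>w r y - vort r y\<bar> \<le> E * exp (\<beta> * (T - r))"
  shows "\<bar>w s x - vort s x\<bar> \<le> growth * E / \<beta> * exp (\<beta> * (T - s)) + T * (consistency * \<epsilon>)"
proof -
  have cl: "closure {0<..<T} = {0..T}" using T by simp
  have jw: "jointly_continuous T w" using C_time_jointly_continuous[OF w_C1, of "[]"] by simp
  have jv: "jointly_continuous T vort" using C_time_jointly_continuous[OF vort_C4, of "[]"] by simp
  have "continuous_on (closure {0<..<T}) (\<lambda>s. \<bar>w s x - vort s x\<bar> - growth * E / \<beta> * exp (\<beta> * (T - s)))"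
    unfolding cl by (intro continuous_intros jointly_continuous_time[OF jw] jointly_continuous_time[OF jv])
  moreover have "\<bar>w s x - vort s x\<bar> - growth * E / \<beta> * exp (\<beta> * (T - s)) \<le> T * (consistency * \<epsilon>)" if "s \<in> {0<..<T}" for s
    using vorticity_error_improves[OF _ _ E \<beta> bound, of s x] that by simp
  moreover have "s \<in> closure {0<..<T}" using s by (simp only: cl)
  ultimately have "\<bar>w s x - vort s x\<bar> - growth * E / \<beta> * exp (\<beta> * (T - s)) \<le> T * (consistency * \<epsilon>)"
    using continuous_le_on_closure[of "{0<..<T}" "\<lambda>s. \<bar>w s x - vort s x\<bar> - growth * E / \<beta> * exp (\<beta> * (T - s))" s "T * (consistency * \<epsilon>)"]
    by blast
  then show ?thesis by simp
qed

text \<open>For \<open>\<beta> = 2 growth + 1\<close> the factor \<open>growth / \<beta>\<close> is below one half, so the best weighted bound \<open>E\<close>, finite because both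
vorticities are bounded by \<open>B\<close>, satisfies \<open>E \<le> E / 2 + T consistency \<epsilon>\<close>.\<close>

lemma vorticity_error:
  assumes s: "s \<in> {0..T}"
  shows "\<bar>w s x - vort s x\<bar> \<le> 2 * T * consistency * exp ((2 * growth + 1) * T) * \<epsilon>"
proof -
  define \<beta> where "\<beta> = 2 * growth + 1"
  have \<beta>: "\<beta> > 0" using growth_nonneg by (simp add: \<beta>_def)
  define f where "f p = \<bar>w (fst p) (snd p) - vort (fst p) (snd p)\<bar> * exp (- \<beta> * (T - fst p))" for p
  define E where "E = (SUP p\<in>{0..T} \<times> UNIV. f p)"
  have f_le: "f p \<le> 2 * B" if "p \<in> {0..T} \<times> UNIV" for p
  proof -
    have "\<bar>w (fst p) (snd p) - vort (fst p) (snd p)\<bar> \<le> 2 * B"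
      using w_bound[of "fst p" "snd p"] vort_le[of "fst p" "snd p"] that by (auto simp: mem_Times_iff)
    moreover have "exp (- \<beta> * (T - fst p)) \<le> 1" using \<beta> that by (auto simp: mem_Times_iff mult_nonneg_nonneg)
    ultimately have "f p \<le> (2 * B) * 1" unfolding f_def using B_nonneg by (intro mult_mono) auto
    then show ?thesis by simp
  qed
  have bdd: "bdd_above (f ` ({0..T} \<times> UNIV))" using f_le by (intro bdd_aboveI2)
  have fE: "f p \<le> E" if "p \<in> {0..T} \<times> UNIV" for p unfolding E_def by (rule cSUP_upper[OF that bdd])
  have "f (T, 0) \<ge> 0" by (simp add: f_def)
  then have E0: "E \<ge> 0" using fE[of "(T, 0)"] T_in by force
  have bound: "\<bar>w r y - vort r y\<bar> \<le> E * exp (\<beta> * (T - r))" if "r \<in> {0..T}" for r y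
  proof -
    have "f (r, y) * exp (\<beta> * (T - r)) \<le> E * exp (\<beta> * (T - r))" using fE that by (intro mult_right_mono) auto
    then show ?thesis by (simp add: f_def exp_minus mult.assoc)
  qed
  have "E \<le> E / 2 + T * (consistency * \<epsilon>)"
    unfolding E_def
  proof (rule cSUP_least)
    fix p :: "real \<times> (real^2)" assume p: "p \<in> {0..T} \<times> UNIV"
    define r y where "r = fst p" and "y = snd p"
    have r: "r \<in> {0..T}" using p by (auto simp: r_def)
    have "f p = \<bar>w r y - vort r y\<bar> * exp (- \<beta> * (T - r))" by (simp add: f_def r_def y_def)
    also have "\<dots> \<le> (growth * E / \<beta> * exp (\<beta> * (T - r)) + T * (consistency * \<epsilon>)) * exp (- \<beta> * (T - r))"
      by (intro mult_right_mono vorticity_error_improves_closed[OF r E0 \<beta> bound]) auto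
    also have "\<dots> = growth * E / \<beta> + T * (consistency * \<epsilon>) * exp (- \<beta> * (T - r))"
      by (simp add: distrib_right exp_minus mult.assoc)
    also have "\<dots> \<le> E / 2 + T * (consistency * \<epsilon>) * 1"
    proof (intro add_mono mult_left_mono)
      have "growth / \<beta> \<le> 1 / 2" using growth_nonneg by (simp add: \<beta>_def field_simps)
      then have "growth / \<beta> * E \<le> 1 / 2 * E" using E0 by (intro mult_right_mono)
      then show "growth * E / \<beta> \<le> E / 2" by simp
      show "exp (- \<beta> * (T - r)) \<le> 1" using \<beta> r by (auto simp: mult_nonneg_nonneg)
      show "T * (consistency * \<epsilon>) \<ge> 0" using T consistency_nonneg \<epsilon> by simp
    qed
    finally show "f p \<le> (SUP p\<in>{0..T} \<times> UNIV. f p) / 2 + T * (consistency * \<epsilon>)" by (simp add: E_def)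
  qed (use T_in in auto)
  then have E: "E \<le> 2 * T * consistency * \<epsilon>" by simp
  have "\<bar>w s x - vort s x\<bar> \<le> E * exp (\<beta> * (T - s))" by (rule bound[OF s])
  also have "\<dots> \<le> (2 * T * consistency * \<epsilon>) * exp (\<beta> * T)"
    using E order_trans[OF E0 E] \<beta> s by (intro mult_mono) auto
  finally show ?thesis by (simp add: \<beta>_def mult_ac)
qed

lemma velocity_convergence:
  assumes s: "s \<in> {0..T}"
  shows "norm (v s x - u s x) \<le> 2 * T * consistency * exp ((2 * growth + 1) * T) * kernel_mass * \<epsilon>"
  using velocity_error[OF s vorticity_error[OF s], of x] by (simp add: mult_ac)

end

theorem theorem4p7:
  fixes T \<nu> :: real
    and \<phi> :: "real^2 \<Rightarrow> real^2"
    and u :: "real \<Rightarrow> real^2 \<Rightarrow> real^2"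
    and K :: "real^2 \<Rightarrow> real^2"
    and M :: "'w measure"
    and N :: "real \<Rightarrow> real \<Rightarrow> 'w \<Rightarrow> nat"
    and \<xi> :: "nat \<Rightarrow> 'w \<Rightarrow> real^2"
    and X\<^sub>\<epsilon> :: "real \<Rightarrow> real \<Rightarrow> real \<Rightarrow> real^2 \<Rightarrow> 'w \<Rightarrow> real^2"
    and w\<^sub>\<epsilon> :: "real \<Rightarrow> real \<Rightarrow> real^2 \<Rightarrow> real"
    and u\<^sub>\<epsilon> :: "real \<Rightarrow> real \<Rightarrow> real^2 \<Rightarrow> real^2"
  assumes "T > 0" and "\<nu> \<ge> 0"
    and "Ck_torus 5 \<phi>" and "\<forall>x. divergence \<phi> x = 0" and "(LINT x:torus_cell|lborel. \<phi> x) = 0"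
    and "backward_navier_stokes \<nu> T \<phi> u"
    and "biot_savart_kernel K"
    and "prob_space M"
    and "\<forall>\<epsilon>\<in>{0<..<1}. poisson_process M (1 / \<epsilon>) (N \<epsilon>)"
    and "random_walk_steps M \<xi>"
    and "\<forall>\<epsilon>\<in>{0<..<1}. steps_indep_of_process M \<xi> (N \<epsilon>)"
    and "\<forall>\<epsilon>\<in>{0<..<1}.
           particle_system (4 * \<nu>) T K (curl \<phi>) M (N \<epsilon>) \<xi> \<epsilon> (X\<^sub>\<epsilon> \<epsilon>) (w\<^sub>\<epsilon> \<epsilon>) (u\<^sub>\<epsilon> \<epsilon>)"
  shows "\<exists>C>0. \<forall>\<epsilon>\<in>{0<..<1}.
           (SUP s\<in>{0..T}. sup_norm (\<lambda>x. u\<^sub>\<epsilon> \<epsilon> s x - u s x)) \<le> ereal (C * \<epsilon>)"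
proof -
  interpret NS: navier_stokes T \<nu> \<phi> u by unfold_locales fact+
  interpret BS: biot_savart K by unfold_locales fact
  obtain B where B: "B > 0" "\<And>ds s x. length ds \<le> 4 \<Longrightarrow> s \<in> {0..T} \<Longrightarrow> norm (partials ds (NS.vort s) x) \<le> B"
    using C_time_bounded[OF NS.vort_C4] by blast
  define V where "V = B * BS.kernel_mass"
  define C where "C = 2 * T * (B * (8 * \<nu>\<^sup>2 + 3 * V\<^sup>2 + 4 * \<nu> * V)) * exp ((2 * (2 * B * BS.kernel_mass) + 1) * T) * BS.kernel_mass"
  have C: "C \<ge> 0" using assms(1,2) B(1) BS.kernel_mass_nonneg by (simp add: C_def V_def)
  have main: "norm (u\<^sub>\<epsilon> \<epsilon> s x - u s x) \<le> (C + 1) * \<epsilon>" if \<epsilon>: "\<epsilon> \<in> {0<..<1}" and s: "s \<in> {0..T}" for \<epsilon> s x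
  proof -
    interpret P: prob_space M by fact
    interpret P: particle_approximation T \<nu> \<phi> u K M \<epsilon> "N \<epsilon>" \<xi> "X\<^sub>\<epsilon> \<epsilon>" "w\<^sub>\<epsilon> \<epsilon>" "u\<^sub>\<epsilon> \<epsilon>" B
      by unfold_locales (use assms \<epsilon> B in auto)
    have "norm (u\<^sub>\<epsilon> \<epsilon> s x - u s x) \<le> C * \<epsilon>"
      using P.velocity_convergence[OF s, of x] by (simp add: C_def V_def P.consistency_def P.growth_def P.V_def)
    also have "\<dots> \<le> (C + 1) * \<epsilon>" using \<epsilon> by simp
    finally show ?thesis .
  qed
  show ?thesis
  proof (intro exI[of _ "C + 1"] conjI ballI)
    fix \<epsilon> :: real assume \<epsilon>: "\<epsilon> \<in> {0<..<1}"
    show "(SUP s\<in>{0..T}. sup_norm (\<lambda>x. u\<^sub>\<epsilon> \<epsilon> s x - u s x)) \<le> ereal ((C + 1) * \<epsilon>)"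
      unfolding sup_norm_def by (intro SUP_least) (simp add: main[OF \<epsilon>])
  qed (use C in simp)
qed

end
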